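(* Let $R$ be a graded-commutative noetherian ring and $\mathsf T$ a compactly generated $R$-linear triangulated category with arbitrary coproducts. Suppose the local-global principle holds for $\mathsf T$. Then there is a one-to-one correspondence between localizing subcategories of $\mathsf T$ and functions assigning to each $\mathfrak p\in\operatorname{Spec}R$ a localizing subcategory of $\varGamma_{\mathfrak p}\mathsf T$; the function corresponding to a localizing subcategory $\mathsf S$ sends $\mathfrak p$ to $\mathsf S\cap\varGamma_{\mathfrak p}\mathsf T$.
   Context: Graded-commutative: $R$ is $\mathbb Z$-graded with $rs=(-1)^{|r||s|}sr$ for homogeneous $r,s$. $\operatorname{Spec}R$ is the set of homogeneous prime ideals; $\mathcal V(\mathfrak a)=\{\mathfrak p\in\operatorname{Spec}R\mid\mathfrak p\supseteq\mathfrak a\}$ for a homogeneous ideal $\mathfrak a$. $R$-modules are graded and $M_{\mathfrak p}$ is homogeneous localization. A subset $\mathcal V\subseteq\operatorname{Spec}R$ is specialization closed if $\mathfrak p\in\mathcal V$, $\mathfrak p\subseteq\mathfrak q$ imply $\mathfrak q\in\mathcal V$. $\mathsf T$ has suspension $\Sigma$. A localizing subcategory is a full triangulated subcategory closed under coproducts; $\operatorname{Loc}_{\mathsf T}(\mathsf C)$ is the smallest one containing $\mathsf C$. An object $C$ is compact if $\operatorname{Hom}_{\mathsf T}(C,-)$ commutes with coproducts; $\mathsf T^c$ is the full subcategory of compact objects. $\mathsf T$ is compactly generated if $\mathsf T=\operatorname{Loc}_{\mathsf T}(\mathsf G)$ for a set $\mathsf G$ of compact objects. $\mathsf T$ is $R$-linear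 if there is given a homomorphism of graded rings $R\to Z^*(\mathsf T)$ to the graded center ($Z^n(\mathsf T)$ consists of natural transformations $\eta\colon\mathrm{Id}\to\Sigma^n$ with $\eta\Sigma=(-1)^n\Sigma\eta$); then $\operatorname{Hom}^*_{\mathsf T}(X,Y)=\bigoplus_i\operatorname{Hom}_{\mathsf T}(X,\Sigma^iY)$ is a graded $R$-module. For specialization closed $\mathcal V$, let $\mathsf T_{\mathcal V}=\{X\in\mathsf T\mid\operatorname{Hom}^*_{\mathsf T}(C,X)_{\mathfrak p}=0\text{ for all }C\in\mathsf T^c,\ \mathfrak p\in\operatorname{Spec}R\setminus\mathcal V\}$. This is a localizing subcategory and there is a localization functor $L_{\mathcal V}\colon\mathsf T\to\mathsf T$ with $\operatorname{Ker}L_{\mathcal V}=\mathsf T_{\mathcal V}$, giving functorial exact triangles $\varGamma_{\mathcal V}X\to X\to L_{\mathcal V}X\to$ with $\varGamma_{\mathcal V}X\in\mathsf T_{\mathcal V}$ and $\operatorname{Hom}_{\mathsf T}(\mathsf T_{\mathcal V},L_{\mathcal V}X)=0$. For $\mathfrak p\in\operatorname{Spec}R$ put $\mathcal Z(\mathfrak p)=\{\mathfrak q\in\operatorname{Spec}R\mid\mathfrak q\not\subseteq\mathfrak p\}$, $X_{\mathfrak p}=L_{\mathcal Z(\mathfrak p)}X$, $\varGamma_{\mathfrak p}X=\varGamma_{\mathcal V(\mathfrak p)}(X_{\mathfrak p})$. $\varGamma_{\mathfrak p}\mathsf T$ is the essential image of $\varGamma_{\mathfrak p}$, a localizing subcategory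 of $\mathsf T$. The local-global principle holds for $\mathsf T$ if $\operatorname{Loc}_{\mathsf T}(X)=\operatorname{Loc}_{\mathsf T}(\{\varGamma_{\mathfrak p}X\mid\mathfrak p\in\operatorname{Spec}R\})$ for every object $X$ of $\mathsf T$. *)

theory Defs
  imports "HOL-Algebra.Ideal" "HOL-Algebra.Product_Groups"
begin

unbundle cardinal_syntax

text \<open>
  Smallness. "Arbitrary" coproducts of a category whose objects form a large collection are indexed
  by small sets.  Small means here: of cardinality less than \<open>\<kappa>\<close>, where \<open>\<kappa>\<close> is a fixed uncountable
  regular cardinal.  For \<open>\<kappa>\<close> strongly inaccessible these are the sets in a Grothendieck universe.
  Every small set is in bijection with a small subset of the type \<open>'i\<close> underlying \<open>\<kappa>\<close>, so it is
  enough to let families be indexed by small subsets of \<open>'i\<close>.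
\<close>

definition uncountable_regular :: "'i rel \<Rightarrow> bool" where
  "uncountable_regular \<kappa> \<longleftrightarrow> Card_order \<kappa> \<and> natLeq <o \<kappa> \<and> regularCard \<kappa>"

definition small :: "'i rel \<Rightarrow> 'a set \<Rightarrow> bool" where
  "small \<kappa> A \<longleftrightarrow> |A| <o \<kappa>"


section \<open>Graded-commutative rings\<close>

locale graded_ring = ring R for R (structure) +
  fixes gr :: "int \<Rightarrow> 'a set"
  assumes gr_subgroup: "\<And>n. additive_subgroup (gr n) R"
    and gr_one: "\<one> \<in> gr 0"
    and gr_mult: "\<And>m n r s. r \<in> gr m \<Longrightarrow> s \<in> gr n \<Longrightarrow> r \<otimes> s \<in> gr (m + n)"
    and gr_direct_sum:
      "\<And>x. x \<in> carrier R \<Longrightarrow>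
         \<exists>!c. (\<forall>n. c n \<in> gr n) \<and> finite {n. c n \<noteq> \<zero>} \<and> x = (\<Oplus>n\<in>{n. c n \<noteq> \<zero>}. c n)"

locale graded_commutative_ring = graded_ring +
  assumes graded_comm:
    "\<And>m n r s. r \<in> gr m \<Longrightarrow> s \<in> gr n \<Longrightarrow>
       r \<otimes> s = (if even (m * n) then s \<otimes> r else \<ominus> (s \<otimes> r))"

definition homogeneous_ideal :: "('r, 'b) ring_scheme \<Rightarrow> (int \<Rightarrow> 'r set) \<Rightarrow> 'r set \<Rightarrow> bool" where
  "homogeneous_ideal R gr I \<longleftrightarrow> ideal I R \<and> I = genideal R (I \<inter> (\<Union>n. gr n))"

text \<open>
  In the graded setting all ideals are homogeneous, so the noetherian condition is imposed on
  homogeneous ideals only.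
\<close>

definition graded_noetherian :: "('r, 'b) ring_scheme \<Rightarrow> (int \<Rightarrow> 'r set) \<Rightarrow> bool" where
  "graded_noetherian R gr \<longleftrightarrow>
     (\<forall>I. homogeneous_ideal R gr I \<longrightarrow> (\<exists>A \<subseteq> carrier R. finite A \<and> I = genideal R A))"

definition Spec :: "('r, 'b) ring_scheme \<Rightarrow> (int \<Rightarrow> 'r set) \<Rightarrow> 'r set set" where
  "Spec R gr = {p. homogeneous_ideal R gr p \<and> p \<noteq> carrier R \<and>
     (\<forall>r \<in> (\<Union>n. gr n). \<forall>s \<in> (\<Union>n. gr n). r \<otimes>\<^bsub>R\<^esub> s \<in> p \<longrightarrow> r \<in> p \<or> s \<in> p)}"

definition V_set :: "('r, 'b) ring_scheme \<Rightarrow> (int \<Rightarrow> 'r set) \<Rightarrow> 'r set \<Rightarrow> 'r set set" where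
  "V_set R gr a = {p \<in> Spec R gr. a \<subseteq> p}"

definition Z_set :: "('r, 'b) ring_scheme \<Rightarrow> (int \<Rightarrow> 'r set) \<Rightarrow> 'r set \<Rightarrow> 'r set set" where
  "Z_set R gr p = {q \<in> Spec R gr. \<not> q \<subseteq> p}"


section \<open>Homogeneous localization\<close>

text \<open>
  A graded left module is given by its components \<open>M n\<close>, their zero elements \<open>z n\<close>, and the action
  \<open>act m r n : M n \<rightarrow> M (m + n)\<close> of \<open>r \<in> gr m\<close>.  A triple \<open>(k, x, s)\<close> stands for the left fraction
  \<open>s\<^sup>-\<^sup>1 x\<close> with \<open>s\<close> homogeneous of degree \<open>k\<close> and not in \<open>p\<close>; its degree \<open>n\<close> is the degree of \<open>x\<close>
  minus \<open>k\<close>.  Two fractions are identified as in Ore localization: they become equal after expanding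
  to a common denominator \<open>a s = b t\<close> outside \<open>p\<close>.  This form needs no sign conventions.
\<close>

definition fractions ::
    "(int \<Rightarrow> 'r set) \<Rightarrow> 'r set \<Rightarrow> (int \<Rightarrow> 'm set) \<Rightarrow> int \<Rightarrow> (int \<times> 'm \<times> 'r) set" where
  "fractions gr p M n = {(k, x, s). s \<in> gr k - p \<and> x \<in> M (n + k)}"

definition fraction_rel ::
    "('r, 'b) ring_scheme \<Rightarrow> (int \<Rightarrow> 'r set) \<Rightarrow> 'r set \<Rightarrow> (int \<Rightarrow> 'm set) \<Rightarrow>
     (int \<Rightarrow> 'r \<Rightarrow> int \<Rightarrow> 'm \<Rightarrow> 'm) \<Rightarrow> int \<Rightarrow> (int \<times> 'm \<times> 'r) rel" where
  "fraction_rel R gr p M act n =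
     {((k, x, s), (l, y, t)).
        (k, x, s) \<in> fractions gr p M n \<and> (l, y, t) \<in> fractions gr p M n \<and>
        (\<exists>i j. \<exists>a \<in> gr i. \<exists>b \<in> gr j.
           i + k = j + l \<and> a \<otimes>\<^bsub>R\<^esub> s = b \<otimes>\<^bsub>R\<^esub> t \<and> a \<otimes>\<^bsub>R\<^esub> s \<notin> p \<and>
           act i a (n + k) x = act j b (n + l) y)}"

definition homogeneous_localization ::
    "('r, 'b) ring_scheme \<Rightarrow> (int \<Rightarrow> 'r set) \<Rightarrow> 'r set \<Rightarrow> (int \<Rightarrow> 'm set) \<Rightarrow>
     (int \<Rightarrow> 'r \<Rightarrow> int \<Rightarrow> 'm \<Rightarrow> 'm) \<Rightarrow> int \<Rightarrow> (int \<times> 'm \<times> 'r) set set" where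
  "homogeneous_localization R gr p M act n =
     fractions gr p M n // fraction_rel R gr p M act n"

definition localization_vanishes ::
    "('r, 'b) ring_scheme \<Rightarrow> (int \<Rightarrow> 'r set) \<Rightarrow> 'r set \<Rightarrow> (int \<Rightarrow> 'm set) \<Rightarrow> (int \<Rightarrow> 'm) \<Rightarrow>
     (int \<Rightarrow> 'r \<Rightarrow> int \<Rightarrow> 'm \<Rightarrow> 'm) \<Rightarrow> bool" where
  "localization_vanishes R gr p M z act \<longleftrightarrow>
     (\<forall>n. homogeneous_localization R gr p M act n =
            {fraction_rel R gr p M act n `` {(0, z n, \<one>\<^bsub>R\<^esub>)}})"


section \<open>Triangulated categories\<close>

text \<open>
  \<open>Zer X Y\<close> is the zero morphism from \<open>X\<close> to \<open>Y\<close>; \<open>SuspO\<close> and \<open>SuspM\<close> are the suspension on objects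
  and on morphisms; \<open>Tri\<close> contains the exact triangles \<open>(f, g, h)\<close>.
\<close>

record ('o, 'm) tricat =
  Obj :: "'o set"
  Mor :: "'m set"
  Dom :: "'m \<Rightarrow> 'o"
  Cod :: "'m \<Rightarrow> 'o"
  Cmp :: "'m \<Rightarrow> 'm \<Rightarrow> 'm" (infixl "\<cdot>\<index>" 70)
  Idn :: "'o \<Rightarrow> 'm"
  Add :: "'m \<Rightarrow> 'm \<Rightarrow> 'm"
  Zer :: "'o \<Rightarrow> 'o \<Rightarrow> 'm"
  SuspO :: "'o \<Rightarrow> 'o"
  SuspM :: "'m \<Rightarrow> 'm"
  Tri :: "('m \<times> 'm \<times> 'm) set"

definition Hom :: "('o, 'm) tricat \<Rightarrow> 'o \<Rightarrow> 'o \<Rightarrow> 'm set" where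
  "Hom T X Y = {f \<in> Mor T. Dom T f = X \<and> Cod T f = Y}"

text \<open>The abelian group of morphisms, written multiplicatively as all groups in HOL-Algebra.\<close>

definition Hom_group :: "('o, 'm) tricat \<Rightarrow> 'o \<Rightarrow> 'o \<Rightarrow> 'm monoid" where
  "Hom_group T X Y = \<lparr>carrier = Hom T X Y, monoid.mult = Add T, one = Zer T X Y\<rparr>"

definition Neg :: "('o, 'm) tricat \<Rightarrow> 'm \<Rightarrow> 'm" where
  "Neg T f = inv\<^bsub>Hom_group T (Dom T f) (Cod T f)\<^esub> f"

definition isomorphism :: "('o, 'm) tricat \<Rightarrow> 'o \<Rightarrow> 'o \<Rightarrow> 'm \<Rightarrow> bool" where
  "isomorphism T X Y f \<longleftrightarrow>
     f \<in> Hom T X Y \<and> (\<exists>g \<in> Hom T Y X. g \<cdot>\<^bsub>T\<^esub> f = Idn T X \<and> f \<cdot>\<^bsub>T\<^esub> g = Idn T Y)"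

definition zero_object :: "('o, 'm) tricat \<Rightarrow> 'o \<Rightarrow> bool" where
  "zero_object T Z \<longleftrightarrow>
     Z \<in> Obj T \<and> (\<forall>X \<in> Obj T. (\<exists>!f. f \<in> Hom T X Z) \<and> (\<exists>!f. f \<in> Hom T Z X))"

definition coproduct ::
    "('o, 'm) tricat \<Rightarrow> 'k set \<Rightarrow> ('k \<Rightarrow> 'o) \<Rightarrow> 'o \<Rightarrow> ('k \<Rightarrow> 'm) \<Rightarrow> bool" where
  "coproduct T I X S \<iota> \<longleftrightarrow>
     S \<in> Obj T \<and> (\<forall>i \<in> I. \<iota> i \<in> Hom T (X i) S) \<and>
     (\<forall>Y \<in> Obj T. \<forall>f. (\<forall>i \<in> I. f i \<in> Hom T (X i) Y) \<longrightarrow>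
        (\<exists>!h. h \<in> Hom T S Y \<and> (\<forall>i \<in> I. h \<cdot>\<^bsub>T\<^esub> \<iota> i = f i)))"

definition exact_triangle ::
    "('o, 'm) tricat \<Rightarrow> 'o \<Rightarrow> 'o \<Rightarrow> 'o \<Rightarrow> 'm \<Rightarrow> 'm \<Rightarrow> 'm \<Rightarrow> bool" where
  "exact_triangle T X Y Z f g h \<longleftrightarrow>
     X \<in> Obj T \<and> Y \<in> Obj T \<and> Z \<in> Obj T \<and>
     f \<in> Hom T X Y \<and> g \<in> Hom T Y Z \<and> h \<in> Hom T Z (SuspO T X) \<and> (f, g, h) \<in> Tri T"

locale category =
  fixes T :: "('o, 'm) tricat" (structure)
  assumes dom_obj: "\<And>f. f \<in> Mor T \<Longrightarrow> Dom T f \<in> Obj T"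
    and cod_obj: "\<And>f. f \<in> Mor T \<Longrightarrow> Cod T f \<in> Obj T"
    and id_hom: "\<And>X. X \<in> Obj T \<Longrightarrow> Idn T X \<in> Hom T X X"
    and comp_hom: "\<And>X Y Z f g. f \<in> Hom T X Y \<Longrightarrow> g \<in> Hom T Y Z \<Longrightarrow> g \<cdot> f \<in> Hom T X Z"
    and comp_id: "\<And>X Y f. f \<in> Hom T X Y \<Longrightarrow> f \<cdot> Idn T X = f"
    and id_comp: "\<And>X Y f. f \<in> Hom T X Y \<Longrightarrow> Idn T Y \<cdot> f = f"
    and comp_assoc:
      "\<And>W X Y Z f g h. f \<in> Hom T W X \<Longrightarrow> g \<in> Hom T X Y \<Longrightarrow> h \<in> Hom T Y Z \<Longrightarrow>
         (h \<cdot> g) \<cdot> f = h \<cdot> (g \<cdot> f)"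

locale additive_category = category +
  assumes Hom_comm_group: "\<And>X Y. X \<in> Obj T \<Longrightarrow> Y \<in> Obj T \<Longrightarrow> comm_group (Hom_group T X Y)"
    and comp_add_left:
      "\<And>X Y Z f g g'. f \<in> Hom T X Y \<Longrightarrow> g \<in> Hom T Y Z \<Longrightarrow> g' \<in> Hom T Y Z \<Longrightarrow>
         Add T g g' \<cdot> f = Add T (g \<cdot> f) (g' \<cdot> f)"
    and comp_add_right:
      "\<And>X Y Z f f' g. f \<in> Hom T X Y \<Longrightarrow> f' \<in> Hom T X Y \<Longrightarrow> g \<in> Hom T Y Z \<Longrightarrow>
         g \<cdot> Add T f f' = Add T (g \<cdot> f) (g \<cdot> f')"
    and zero_object_exists: "\<exists>Z. zero_object T Z"
    and binary_coproducts:
      "\<And>X Y. X \<in> Obj T \<Longrightarrow> Y \<in> Obj T \<Longrightarrow>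
         \<exists>S \<iota>. coproduct T UNIV (\<lambda>b::bool. if b then X else Y) S \<iota>"

text \<open>The suspension is an additive automorphism of the category.\<close>

locale suspended_category = additive_category +
  assumes susp_bij_obj: "bij_betw (SuspO T) (Obj T) (Obj T)"
    and susp_bij_mor: "bij_betw (SuspM T) (Mor T) (Mor T)"
    and susp_hom: "\<And>X Y f. f \<in> Hom T X Y \<Longrightarrow> SuspM T f \<in> Hom T (SuspO T X) (SuspO T Y)"
    and susp_id: "\<And>X. X \<in> Obj T \<Longrightarrow> SuspM T (Idn T X) = Idn T (SuspO T X)"
    and susp_comp:
      "\<And>X Y Z f g. f \<in> Hom T X Y \<Longrightarrow> g \<in> Hom T Y Z \<Longrightarrow>
         SuspM T (g \<cdot> f) = SuspM T g \<cdot> SuspM T f"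
    and susp_add:
      "\<And>X Y f g. f \<in> Hom T X Y \<Longrightarrow> g \<in> Hom T X Y \<Longrightarrow>
         SuspM T (Add T f g) = Add T (SuspM T f) (SuspM T g)"

locale triangulated_category = suspended_category +
  assumes tri_id:
      "\<And>X Z. X \<in> Obj T \<Longrightarrow> zero_object T Z \<Longrightarrow>
         exact_triangle T X X Z (Idn T X) (Zer T X Z) (Zer T Z (SuspO T X))"
    and tri_complete:
      "\<And>X Y f. f \<in> Hom T X Y \<Longrightarrow> \<exists>Z g h. exact_triangle T X Y Z f g h"
    and tri_iso:
      "\<And>X Y Z X' Y' Z' f g h f' g' h' a b c.
         exact_triangle T X Y Z f g h \<Longrightarrow>
         f' \<in> Hom T X' Y' \<Longrightarrow> g' \<in> Hom T Y' Z' \<Longrightarrow> h' \<in> Hom T Z' (SuspO T X') \<Longrightarrow>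
         isomorphism T X X' a \<Longrightarrow> isomorphism T Y Y' b \<Longrightarrow> isomorphism T Z Z' c \<Longrightarrow>
         b \<cdot> f = f' \<cdot> a \<Longrightarrow> c \<cdot> g = g' \<cdot> b \<Longrightarrow> SuspM T a \<cdot> h = h' \<cdot> c \<Longrightarrow>
         exact_triangle T X' Y' Z' f' g' h'"
    and tri_rotate:
      "\<And>X Y Z f g h.
         f \<in> Hom T X Y \<Longrightarrow> g \<in> Hom T Y Z \<Longrightarrow> h \<in> Hom T Z (SuspO T X) \<Longrightarrow>
         exact_triangle T X Y Z f g h \<longleftrightarrow>
         exact_triangle T Y Z (SuspO T X) g h (Neg T (SuspM T f))"
    and tri_morphism:
      "\<And>X Y Z X' Y' Z' f g h f' g' h' a b.
         exact_triangle T X Y Z f g h \<Longrightarrow> exact_triangle T X' Y' Z' f' g' h' \<Longrightarrow>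
         a \<in> Hom T X X' \<Longrightarrow> b \<in> Hom T Y Y' \<Longrightarrow> b \<cdot> f = f' \<cdot> a \<Longrightarrow>
         \<exists>c \<in> Hom T Z Z'. c \<cdot> g = g' \<cdot> b \<and> SuspM T a \<cdot> h = h' \<cdot> c"
    and tri_octahedral:
      "\<And>X Y Z A B C f g u u' v v' w w'.
         exact_triangle T X Y A f u u' \<Longrightarrow>
         exact_triangle T Y Z C g v v' \<Longrightarrow>
         exact_triangle T X Z B (g \<cdot> f) w w' \<Longrightarrow>
         \<exists>a b. exact_triangle T A B C a b (SuspM T u \<cdot> v') \<and>
           a \<cdot> u = w \<cdot> g \<and> w' \<cdot> a = u' \<and> b \<cdot> w = v \<and> v' \<cdot> b = SuspM T f \<cdot> w'"

definition locally_small :: "'i rel \<Rightarrow> ('o, 'm) tricat \<Rightarrow> bool" where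
  "locally_small \<kappa> T \<longleftrightarrow> (\<forall>X \<in> Obj T. \<forall>Y \<in> Obj T. small \<kappa> (Hom T X Y))"

definition has_small_coproducts :: "'i rel \<Rightarrow> ('o, 'm) tricat \<Rightarrow> bool" where
  "has_small_coproducts \<kappa> T \<longleftrightarrow>
     (\<forall>(I :: 'i set) X. small \<kappa> I \<longrightarrow> (\<forall>i \<in> I. X i \<in> Obj T) \<longrightarrow> (\<exists>S \<iota>. coproduct T I X S \<iota>))"

text \<open>
  \<open>Hom(C, -)\<close> commutes with coproducts: the canonical map from the direct sum of the \<open>Hom(C, X i)\<close>,
  sending a finitely supported family \<open>c\<close> to the sum of the \<open>\<iota> i \<cdot> c i\<close>, is an isomorphism.
\<close>

definition compact_object :: "'i rel \<Rightarrow> ('o, 'm) tricat \<Rightarrow> 'o \<Rightarrow> bool" where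
  "compact_object \<kappa> T C \<longleftrightarrow> C \<in> Obj T \<and>
     (\<forall>(I :: 'i set) X S \<iota>. small \<kappa> I \<longrightarrow> (\<forall>i \<in> I. X i \<in> Obj T) \<longrightarrow> coproduct T I X S \<iota> \<longrightarrow>
        (\<lambda>c. finprod (Hom_group T C S) (\<lambda>i. \<iota> i \<cdot>\<^bsub>T\<^esub> c i) {i \<in> I. c i \<noteq> Zer T C (X i)})
          \<in> iso (sum_group I (\<lambda>i. Hom_group T C (X i))) (Hom_group T C S))"

text \<open>Full subcategories are represented by their sets of objects, closed under isomorphism.\<close>

definition localizing :: "'i rel \<Rightarrow> ('o, 'm) tricat \<Rightarrow> 'o set \<Rightarrow> bool" where
  "localizing \<kappa> T S \<longleftrightarrow>
     S \<subseteq> Obj T \<and>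
     (\<forall>Z. zero_object T Z \<longrightarrow> Z \<in> S) \<and>
     (\<forall>X \<in> S. \<forall>Y \<in> Obj T. \<forall>f. isomorphism T X Y f \<longrightarrow> Y \<in> S) \<and>
     (\<forall>X \<in> Obj T. SuspO T X \<in> S \<longleftrightarrow> X \<in> S) \<and>
     (\<forall>X Y Z f g h. exact_triangle T X Y Z f g h \<longrightarrow> X \<in> S \<longrightarrow> Y \<in> S \<longrightarrow> Z \<in> S) \<and>
     (\<forall>(I :: 'i set) X C \<iota>. small \<kappa> I \<longrightarrow> (\<forall>i \<in> I. X i \<in> S) \<longrightarrow> coproduct T I X C \<iota> \<longrightarrow> C \<in> S)"

definition Loc :: "'i rel \<Rightarrow> ('o, 'm) tricat \<Rightarrow> 'o set \<Rightarrow> 'o set" where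
  "Loc \<kappa> T C = \<Inter>{S. localizing \<kappa> T S \<and> C \<subseteq> S}"

definition compactly_generated :: "'i rel \<Rightarrow> ('o, 'm) tricat \<Rightarrow> bool" where
  "compactly_generated \<kappa> T \<longleftrightarrow>
     (\<exists>G. small \<kappa> G \<and> (\<forall>C \<in> G. compact_object \<kappa> T C) \<and> Loc \<kappa> T G = Obj T)"


section \<open>Linear structure\<close>

definition shiftO :: "('o, 'm) tricat \<Rightarrow> int \<Rightarrow> 'o \<Rightarrow> 'o" where
  "shiftO T n = (if 0 \<le> n then SuspO T ^^ nat n else inv_into (Obj T) (SuspO T) ^^ nat (- n))"

definition shiftM :: "('o, 'm) tricat \<Rightarrow> int \<Rightarrow> 'm \<Rightarrow> 'm" where
  "shiftM T n = (if 0 \<le> n then SuspM T ^^ nat n else inv_into (Mor T) (SuspM T) ^^ nat (- n))"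

definition graded_center :: "('o, 'm) tricat \<Rightarrow> int \<Rightarrow> ('o \<Rightarrow> 'm) set" where
  "graded_center T n = {\<eta>.
     (\<forall>X \<in> Obj T. \<eta> X \<in> Hom T X (shiftO T n X)) \<and>
     (\<forall>X \<in> Obj T. \<forall>Y \<in> Obj T. \<forall>f \<in> Hom T X Y. shiftM T n f \<cdot>\<^bsub>T\<^esub> \<eta> X = \<eta> Y \<cdot>\<^bsub>T\<^esub> f) \<and>
     (\<forall>X \<in> Obj T. \<eta> (SuspO T X) =
        (if even n then SuspM T (\<eta> X) else Neg T (SuspM T (\<eta> X))))}"

text \<open>
  A homomorphism of graded rings to the graded center, where the product of \<open>\<eta>\<close> and \<open>\<theta>\<close> of degrees
  \<open>m\<close> and \<open>n\<close> is \<open>X \<mapsto> shiftM n (\<eta> X) \<cdot> \<theta> X\<close>.  It is given degreewise: \<open>\<phi> n\<close> is defined on \<open>gr n\<close>.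
\<close>

definition linear_structure ::
    "('r, 'b) ring_scheme \<Rightarrow> (int \<Rightarrow> 'r set) \<Rightarrow> ('o, 'm) tricat \<Rightarrow> (int \<Rightarrow> 'r \<Rightarrow> 'o \<Rightarrow> 'm) \<Rightarrow> bool" where
  "linear_structure R gr T \<phi> \<longleftrightarrow>
     (\<forall>n. \<forall>r \<in> gr n. \<phi> n r \<in> graded_center T n) \<and>
     (\<forall>n. \<forall>r \<in> gr n. \<forall>s \<in> gr n. \<forall>X \<in> Obj T.
        \<phi> n (r \<oplus>\<^bsub>R\<^esub> s) X = Add T (\<phi> n r X) (\<phi> n s X)) \<and>
     (\<forall>m n. \<forall>r \<in> gr m. \<forall>s \<in> gr n. \<forall>X \<in> Obj T.
        \<phi> (m + n) (r \<otimes>\<^bsub>R\<^esub> s) X = shiftM T n (\<phi> m r X) \<cdot>\<^bsub>T\<^esub> \<phi> n s X) \<and>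
     (\<forall>X \<in> Obj T. \<phi> 0 \<one>\<^bsub>R\<^esub> X = Idn T X)"

definition graded_Hom :: "('o, 'm) tricat \<Rightarrow> 'o \<Rightarrow> 'o \<Rightarrow> int \<Rightarrow> 'm set" where
  "graded_Hom T X Y n = Hom T X (shiftO T n Y)"

definition graded_Hom_act ::
    "('o, 'm) tricat \<Rightarrow> (int \<Rightarrow> 'r \<Rightarrow> 'o \<Rightarrow> 'm) \<Rightarrow> 'o \<Rightarrow> int \<Rightarrow> 'r \<Rightarrow> int \<Rightarrow> 'm \<Rightarrow> 'm" where
  "graded_Hom_act T \<phi> Y m r n f = shiftM T n (\<phi> m r Y) \<cdot>\<^bsub>T\<^esub> f"

definition torsion_objects ::
    "'i rel \<Rightarrow> ('r, 'b) ring_scheme \<Rightarrow> (int \<Rightarrow> 'r set) \<Rightarrow> ('o, 'm) tricat \<Rightarrow>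
     (int \<Rightarrow> 'r \<Rightarrow> 'o \<Rightarrow> 'm) \<Rightarrow> 'r set set \<Rightarrow> 'o set" where
  "torsion_objects \<kappa> R gr T \<phi> V = {X \<in> Obj T.
     \<forall>C. compact_object \<kappa> T C \<longrightarrow> (\<forall>p \<in> Spec R gr - V.
       localization_vanishes R gr p (graded_Hom T C X) (\<lambda>n. Zer T C (shiftO T n X))
         (graded_Hom_act T \<phi> X))}"


section \<open>Local cohomology and localization\<close>

text \<open>
  The exact triangle \<open>\<Gamma>\<^sub>V X \<rightarrow> X \<rightarrow> L\<^sub>V X \<rightarrow>\<close> is determined up to isomorphism by \<open>\<Gamma>\<^sub>V X \<in> T\<^sub>V\<close> and
  \<open>Hom(T\<^sub>V, L\<^sub>V X) = 0\<close>.  The objects \<open>\<Gamma>\<^sub>V X\<close> and \<open>L\<^sub>V X\<close> are therefore represented by their isomorphism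
  classes: \<open>Gamma_V \<dots> V X\<close> is the set of all objects that occur as \<open>\<Gamma>\<^sub>V X\<close>, and likewise for the
  other operations.
\<close>

definition localization_triangle ::
    "'i rel \<Rightarrow> ('r, 'b) ring_scheme \<Rightarrow> (int \<Rightarrow> 'r set) \<Rightarrow> ('o, 'm) tricat \<Rightarrow>
     (int \<Rightarrow> 'r \<Rightarrow> 'o \<Rightarrow> 'm) \<Rightarrow> 'r set set \<Rightarrow> 'o \<Rightarrow> 'o \<Rightarrow> 'o \<Rightarrow> bool" where
  "localization_triangle \<kappa> R gr T \<phi> V G X L \<longleftrightarrow>
     (\<exists>f g h. exact_triangle T G X L f g h) \<and>
     G \<in> torsion_objects \<kappa> R gr T \<phi> V \<and>
     (\<forall>A \<in> torsion_objects \<kappa> R gr T \<phi> V. Hom T A L = {Zer T A L})"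

definition Gamma_V ::
    "'i rel \<Rightarrow> ('r, 'b) ring_scheme \<Rightarrow> (int \<Rightarrow> 'r set) \<Rightarrow> ('o, 'm) tricat \<Rightarrow>
     (int \<Rightarrow> 'r \<Rightarrow> 'o \<Rightarrow> 'm) \<Rightarrow> 'r set set \<Rightarrow> 'o \<Rightarrow> 'o set" where
  "Gamma_V \<kappa> R gr T \<phi> V X = {G. \<exists>L. localization_triangle \<kappa> R gr T \<phi> V G X L}"

definition L_V ::
    "'i rel \<Rightarrow> ('r, 'b) ring_scheme \<Rightarrow> (int \<Rightarrow> 'r set) \<Rightarrow> ('o, 'm) tricat \<Rightarrow>
     (int \<Rightarrow> 'r \<Rightarrow> 'o \<Rightarrow> 'm) \<Rightarrow> 'r set set \<Rightarrow> 'o \<Rightarrow> 'o set" where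
  "L_V \<kappa> R gr T \<phi> V X = {L. \<exists>G. localization_triangle \<kappa> R gr T \<phi> V G X L}"

definition Gamma_at ::
    "'i rel \<Rightarrow> ('r, 'b) ring_scheme \<Rightarrow> (int \<Rightarrow> 'r set) \<Rightarrow> ('o, 'm) tricat \<Rightarrow>
     (int \<Rightarrow> 'r \<Rightarrow> 'o \<Rightarrow> 'm) \<Rightarrow> 'r set \<Rightarrow> 'o \<Rightarrow> 'o set" where
  "Gamma_at \<kappa> R gr T \<phi> p X =
     (\<Union>Y \<in> L_V \<kappa> R gr T \<phi> (Z_set R gr p) X. Gamma_V \<kappa> R gr T \<phi> (V_set R gr p) Y)"

definition Gamma_image ::
    "'i rel \<Rightarrow> ('r, 'b) ring_scheme \<Rightarrow> (int \<Rightarrow> 'r set) \<Rightarrow> ('o, 'm) tricat \<Rightarrow>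
     (int \<Rightarrow> 'r \<Rightarrow> 'o \<Rightarrow> 'm) \<Rightarrow> 'r set \<Rightarrow> 'o set" where
  "Gamma_image \<kappa> R gr T \<phi> p = (\<Union>X \<in> Obj T. Gamma_at \<kappa> R gr T \<phi> p X)"

definition local_global_principle ::
    "'i rel \<Rightarrow> ('r, 'b) ring_scheme \<Rightarrow> (int \<Rightarrow> 'r set) \<Rightarrow> ('o, 'm) tricat \<Rightarrow>
     (int \<Rightarrow> 'r \<Rightarrow> 'o \<Rightarrow> 'm) \<Rightarrow> bool" where
  "local_global_principle \<kappa> R gr T \<phi> \<longleftrightarrow>
     (\<forall>X \<in> Obj T. Loc \<kappa> T {X} = Loc \<kappa> T (\<Union>p \<in> Spec R gr. Gamma_at \<kappa> R gr T \<phi> p X))"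

end

theory Submission
  imports Defs "HOL-Library.Countable_Set"
begin

text \<open>
  Write \<open>T\<^sub>V\<close> for the torsion objects of \<open>V\<close> and \<open>T\<^sub>V\<^sup>\<bottom>\<close> for their right orthogonal.  Both for
  \<open>V = Z(p)\<close> and for \<open>V = V(p)\<close> a small set of compact Koszul objects in \<open>T\<^sub>V\<close> detects the nonzero
  objects of \<open>T\<^sub>V\<close>; mapping the homotopy colimit built from this set to an object orthogonal to it shows
  that the set has the same orthogonal as \<open>T\<^sub>V\<close>, so \<open>T\<^sub>V\<^sup>\<bottom>\<close> is closed under coproducts.  The image of
  \<open>\<Gamma>\<^sub>p\<close> is the localizing subcategory \<open>T\<^sub>V\<^sub>(\<^sub>p\<^sub>) \<inter> T\<^sub>Z\<^sub>(\<^sub>p\<^sub>)\<^sup>\<bottom>\<close>.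

  The local-global principle says at once that a localizing subcategory is determined by its
  intersections with the images of the \<open>\<Gamma>\<^sub>p\<close>.  Conversely, given \<open>U(q)\<close> for all \<open>q\<close>, the objects filtered
  by a piece in \<open>T\<^sub>Z\<^sub>(\<^sub>p\<^sub>)\<close>, a piece in \<open>U(p)\<close> and a piece orthogonal to \<open>T\<^sub>Z\<^sub>(\<^sub>p\<^sub>)\<close> and \<open>T\<^sub>V\<^sub>(\<^sub>p\<^sub>)\<close> form a
  localizing subcategory containing every \<open>U(q)\<close>, and for an object in the image of \<open>\<Gamma>\<^sub>p\<close> the two
  outer pieces vanish.  No localization functor has to be constructed.
\<close>

section \<open>Small sets and additive categories\<close>

text \<open>Gluing pieces into a localizing subcategory hinges on coproducts. The cone of a
  coproduct of maps is a coproduct of the cones, so the right-hand pieces must form a class with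
  coproducts, and an orthogonal has them once it is the orthogonal of objects that see only finitely
  many summands. This weak form of compactness, \<open>finitely_supported\<close>, passes to shifts
  and cones, hence to all Koszul objects. The two detecting sets differ. For \<open>Z(p)\<close>
  single cones on elements outside \<open>p\<close> suffice, because such an element can be chosen
  for each map separately. For \<open>V(p)\<close> one object has to encode all of \<open>p\<close>;
  the noetherian hypothesis allows this with finitely many cones. The description of the image of
  \<open>\<Gamma>\<^sub>p\<close> is not formal either: local cohomology of a
  \<open>Z(p)\<close>-local object must be shown to be \<open>Z(p)\<close>-local again. An element
  \<open>s\<close> outside \<open>p\<close> acts on such an object with a cone lying in both torsion
  classes, and these admit no nonzero maps to the object. Therefore \<open>s\<close> acts
  injectively on maps into it, and this injectivity for all \<open>s\<close> forces
  locality.\<close>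

lemma small_mono: "small \<kappa> B \<Longrightarrow> A \<subseteq> B \<Longrightarrow> small \<kappa> A"
  unfolding small_def using card_of_mono1 ordLeq_ordLess_trans by blast

lemma small_image: "small \<kappa> A \<Longrightarrow> small \<kappa> (f ` A)"
  unfolding small_def using card_of_image ordLeq_ordLess_trans by blast

lemma small_UNION:
  assumes "uncountable_regular \<kappa>" "small \<kappa> I" "\<And>i. i \<in> I \<Longrightarrow> small \<kappa> (A i)"
  shows "small \<kappa> (\<Union>i\<in>I. A i)"
proof -
  have k: "Card_order \<kappa>" "natLeq <o \<kappa>" "regularCard \<kappa>"
    using assms(1) by (auto simp: uncountable_regular_def)
  then have "Cinfinite \<kappa>"
    using cinfinite_mono natLeq_cinfinite ordLess_imp_ordLeq by blast
  then show ?thesis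
    using regularCard_UNION_bound[OF _ k(3)] assms(2,3) unfolding small_def by blast
qed

text \<open>Uncountability of \<open>\<kappa>\<close> enters here; it makes the countable towers
  behind homotopy colimits and the sets of all integer shifts of an object small.\<close>

lemma small_countable:
  assumes "uncountable_regular \<kappa>" "countable A"
  shows "small \<kappa> A"
proof -
  have "|A| \<le>o natLeq"
    using assms(2) by (metis countable_def card_of_nat card_of_ordLeqI ordLeq_ordIso_trans UNIV_I)
  then show ?thesis
    using assms(1) ordLeq_ordLess_trans unfolding small_def uncountable_regular_def by blast
qed

lemma small_Times:
  assumes "uncountable_regular \<kappa>" "small \<kappa> A" "small \<kappa> B"
  shows "small \<kappa> (A \<times> B)"
proof -
  have "A \<times> B = (\<Union>a\<in>A. Pair a ` B)"
    by auto
  then show ?thesis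
    using small_UNION[OF assms(1,2), of "\<lambda>a. Pair a ` B"] small_image[OF assms(3)] by metis
qed

text \<open>Coproducts are postulated for index sets inside \<open>'i\<close> only. As the field of
  \<open>\<kappa>\<close> has cardinality \<open>\<kappa>\<close>, every small set embeds into it,
  so families indexed by natural numbers or by morphisms become available.\<close>

lemma small_reindex:
  fixes \<kappa> :: "'i rel" and K :: "'k set"
  assumes "uncountable_regular \<kappa>" "small \<kappa> K"
  obtains e and I :: "'i set" where "bij_betw e K I" "small \<kappa> I"
proof -
  have "\<kappa> =o |Field \<kappa>|"
    using assms(1) card_of_Field_ordIso ordIso_symmetric unfolding uncountable_regular_def by blast
  then have "|K| \<le>o |Field \<kappa>|"
    using assms(2) ordLess_imp_ordLeq ordLeq_ordIso_trans unfolding small_def by blast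
  then obtain e :: "'k \<Rightarrow> 'i" where "inj_on e K"
    using card_of_ordLeq[of K "Field \<kappa>"] by blast
  then have "bij_betw e K (e ` K)"
    by (rule inj_on_imp_bij_betw)
  then show thesis
    using that small_image[OF assms(2), of e] by metis
qed

section \<open>Categories and coproducts\<close>

context category begin

lemma comp_arr [simp]:
  assumes "f \<in> Mor T" "g \<in> Mor T" "Cod T f = Dom T g"
  shows "g \<cdot> f \<in> Mor T" "Dom T (g \<cdot> f) = Dom T f" "Cod T (g \<cdot> f) = Cod T g"
  using comp_hom[of f "Dom T f" "Cod T f" g "Cod T g"] assms by (auto simp: Hom_def)

lemma id_arr [simp]:
  assumes "X \<in> Obj T"
  shows "Idn T X \<in> Mor T" "Dom T (Idn T X) = X" "Cod T (Idn T X) = X"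
  using id_hom[OF assms] by (auto simp: Hom_def)

lemma id_neutral [simp]:
  "f \<in> Mor T \<Longrightarrow> Dom T f = X \<Longrightarrow> f \<cdot> Idn T X = f"
  "f \<in> Mor T \<Longrightarrow> Cod T f = X \<Longrightarrow> Idn T X \<cdot> f = f"
  by (auto simp: Hom_def intro: comp_id id_comp)

lemma hom_obj:
  assumes "f \<in> Hom T X Y"
  shows "X \<in> Obj T" "Y \<in> Obj T"
  using assms dom_obj cod_obj by (auto simp: Hom_def)

declare dom_obj [simp] cod_obj [simp]

lemma iso_id: "X \<in> Obj T \<Longrightarrow> isomorphism T X X (Idn T X)"
  unfolding isomorphism_def by (auto simp: Hom_def intro!: bexI[of _ "Idn T X"])

lemma coproduct_hom: "coproduct T I X S \<iota> \<Longrightarrow> i \<in> I \<Longrightarrow> \<iota> i \<in> Hom T (X i) S"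
  by (auto simp: coproduct_def)

lemma coproduct_ext:
  assumes "coproduct T I X S \<iota>" "a \<in> Hom T S Y" "b \<in> Hom T S Y" "\<And>i. i \<in> I \<Longrightarrow> a \<cdot> \<iota> i = b \<cdot> \<iota> i"
  shows "a = b"
proof -
  have "\<forall>i\<in>I. b \<cdot> \<iota> i \<in> Hom T (X i) Y"
    using assms by (auto simp: coproduct_def intro: comp_hom)
  then have "\<exists>!h. h \<in> Hom T S Y \<and> (\<forall>i\<in>I. h \<cdot> \<iota> i = b \<cdot> \<iota> i)"
    using assms(1) hom_obj(2)[OF assms(2)] unfolding coproduct_def
    by (auto dest!: conjunct2 bspec[of _ _ Y] spec[of _ "\<lambda>i. b \<cdot> \<iota> i"])
  then show ?thesis
    using assms by blast
qed

lemma coproduct_desc: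
  assumes "coproduct T I X S \<iota>" "Y \<in> Obj T" "\<And>i. i \<in> I \<Longrightarrow> f i \<in> Hom T (X i) Y"
  obtains h where "h \<in> Hom T S Y" "\<And>i. i \<in> I \<Longrightarrow> h \<cdot> \<iota> i = f i"
  using assms unfolding coproduct_def by blast

lemma coproductI:
  assumes "S \<in> Obj T" "\<And>i. i \<in> I \<Longrightarrow> \<iota> i \<in> Hom T (X i) S"
    and "\<And>Y f. Y \<in> Obj T \<Longrightarrow> (\<And>i. i \<in> I \<Longrightarrow> f i \<in> Hom T (X i) Y) \<Longrightarrow>
      \<exists>h \<in> Hom T S Y. \<forall>i\<in>I. h \<cdot> \<iota> i = f i"
    and "\<And>Y a b. a \<in> Hom T S Y \<Longrightarrow> b \<in> Hom T S Y \<Longrightarrow> (\<And>i. i \<in> I \<Longrightarrow> a \<cdot> \<iota> i = b \<cdot> \<iota> i) \<Longrightarrow> a = b"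
  shows "coproduct T I X S \<iota>"
  unfolding coproduct_def
proof (intro conjI ballI allI impI)
  fix Y f assume "Y \<in> Obj T" "\<forall>i\<in>I. f i \<in> Hom T (X i) Y"
  then obtain h where h: "h \<in> Hom T S Y" "\<forall>i\<in>I. h \<cdot> \<iota> i = f i"
    using assms(3) by meson
  show "\<exists>!h. h \<in> Hom T S Y \<and> (\<forall>i\<in>I. h \<cdot> \<iota> i = f i)"
  proof (rule ex1I[of _ h])
    show "h \<in> Hom T S Y \<and> (\<forall>i\<in>I. h \<cdot> \<iota> i = f i)" using h by blast
    show "k = h" if "k \<in> Hom T S Y \<and> (\<forall>i\<in>I. k \<cdot> \<iota> i = f i)" for k
      using that h by (auto intro: assms(4)[of k Y h])
  qed
qed (use assms(1,2) in auto)

lemma coproduct_reindex: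
  assumes "bij_betw e K I" "coproduct T I X S \<iota>"
  shows "coproduct T K (X \<circ> e) S (\<iota> \<circ> e)"
proof (rule coproductI)
  have e: "e k \<in> I" if "k \<in> K" for k
    using assms(1) that by (auto simp: bij_betw_def)
  have inv: "inv_into K e i \<in> K" "e (inv_into K e i) = i" if "i \<in> I" for i
    using assms(1) that by (auto simp: bij_betw_def inv_into_into f_inv_into_f)
  show "S \<in> Obj T" using assms(2) by (simp add: coproduct_def)
  show "(\<iota> \<circ> e) k \<in> Hom T ((X \<circ> e) k) S" if "k \<in> K" for k
    using coproduct_hom[OF assms(2) e[OF that]] by simp
  show "a = b" if "a \<in> Hom T S Y" "b \<in> Hom T S Y"
    and eq: "\<And>k. k \<in> K \<Longrightarrow> a \<cdot> (\<iota> \<circ> e) k = b \<cdot> (\<iota> \<circ> e) k" for Y a b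
  proof (rule coproduct_ext[OF assms(2) that(1,2)])
    show "a \<cdot> \<iota> i = b \<cdot> \<iota> i" if "i \<in> I" for i
      using eq[of "inv_into K e i"] inv[OF that] by simp
  qed
  show "\<exists>h\<in>Hom T S Y. \<forall>k\<in>K. h \<cdot> (\<iota> \<circ> e) k = f k"
    if Y: "Y \<in> Obj T" and f: "\<And>k. k \<in> K \<Longrightarrow> f k \<in> Hom T ((X \<circ> e) k) Y" for Y f
  proof -
    have "f (inv_into K e i) \<in> Hom T (X i) Y" if "i \<in> I" for i
      using f[of "inv_into K e i"] inv[OF that] by simp
    then obtain h where "h \<in> Hom T S Y" "\<And>i. i \<in> I \<Longrightarrow> h \<cdot> \<iota> i = f (inv_into K e i)"
      using coproduct_desc[OF assms(2) Y, of "\<lambda>i. f (inv_into K e i)"] by blast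
    then show ?thesis
      using e assms(1) by (intro bexI[of _ h]) (auto simp: bij_betw_def)
  qed
qed

lemma coproduct_cong:
  assumes "coproduct T I X S \<iota>" "\<And>i. i \<in> I \<Longrightarrow> X i = X' i" "\<And>i. i \<in> I \<Longrightarrow> \<iota> i = \<iota>' i"
  shows "coproduct T I X' S \<iota>'"
proof (rule coproductI)
  show "\<exists>h\<in>Hom T S Y. \<forall>i\<in>I. h \<cdot> \<iota>' i = f i"
    if "Y \<in> Obj T" "\<And>i. i \<in> I \<Longrightarrow> f i \<in> Hom T (X' i) Y" for Y f
    using coproduct_desc[OF assms(1) that(1), of f] that(2) assms(2,3) by metis
  show "a = b" if "a \<in> Hom T S Y" "b \<in> Hom T S Y" "\<And>i. i \<in> I \<Longrightarrow> a \<cdot> \<iota>' i = b \<cdot> \<iota>' i" for Y a b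
    using coproduct_ext[OF assms(1) that(1,2)] that(3) assms(3) by simp
qed (use assms coproduct_hom[OF assms(1)] in \<open>auto simp: coproduct_def\<close>)

end

section \<open>Calculation with morphisms in additive categories\<close>

context additive_category begin

lemma hom_zer [simp]: "X \<in> Obj T \<Longrightarrow> Y \<in> Obj T \<Longrightarrow> Zer T X Y \<in> Hom T X Y"
  using comm_group.axioms(2)[OF Hom_comm_group] group.is_monoid monoid.one_closed
  by (fastforce simp: Hom_group_def)

lemma zer_arr [simp]:
  assumes "X \<in> Obj T" "Y \<in> Obj T"
  shows "Zer T X Y \<in> Mor T" "Dom T (Zer T X Y) = X" "Cod T (Zer T X Y) = Y"
  using hom_zer[OF assms] by (auto simp: Hom_def)

lemma hom_add:
  assumes "f \<in> Hom T X Y" "g \<in> Hom T X Y"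
  shows "Add T f g \<in> Hom T X Y"
proof -
  interpret comm_group "Hom_group T X Y"
    using hom_obj[OF assms(1)] by (rule Hom_comm_group)
  show ?thesis using m_closed[of f g] assms by (simp add: Hom_group_def)
qed

lemma add_arr [simp]:
  assumes "f \<in> Mor T" "g \<in> Mor T" "Dom T f = Dom T g" "Cod T f = Cod T g"
  shows "Add T f g \<in> Mor T" "Dom T (Add T f g) = Dom T g" "Cod T (Add T f g) = Cod T g"
  using hom_add[of f "Dom T g" "Cod T g" g] assms by (auto simp: Hom_def)

lemma hom_neg:
  assumes "f \<in> Hom T X Y"
  shows "Neg T f \<in> Hom T X Y" "Add T f (Neg T f) = Zer T X Y"
proof -
  interpret comm_group "Hom_group T X Y"
    using hom_obj[OF assms(1)] by (rule Hom_comm_group)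
  have f: "f \<in> carrier (Hom_group T X Y)" "Dom T f = X" "Cod T f = Y"
    using assms by (auto simp: Hom_group_def Hom_def)
  show "Neg T f \<in> Hom T X Y" "Add T f (Neg T f) = Zer T X Y"
    using inv_closed[OF f(1)] r_inv[OF f(1)] f(2,3) by (auto simp: Neg_def Hom_group_def)
qed

lemma neg_arr [simp]:
  assumes "f \<in> Mor T"
  shows "Neg T f \<in> Mor T" "Dom T (Neg T f) = Dom T f" "Cod T (Neg T f) = Cod T f"
  using hom_neg(1)[of f "Dom T f" "Cod T f"] assms by (auto simp: Hom_def)

lemma add_zer:
  assumes "f \<in> Hom T X Y"
  shows "Add T f (Zer T X Y) = f" "Add T (Zer T X Y) f = f"
proof -
  interpret comm_group "Hom_group T X Y"
    using hom_obj[OF assms(1)] by (rule Hom_comm_group)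
  show "Add T f (Zer T X Y) = f" "Add T (Zer T X Y) f = f"
    using l_one[of f] r_one[of f] assms by (auto simp: Hom_group_def)
qed

lemma add_assoc:
  assumes "f \<in> Hom T X Y" "g \<in> Hom T X Y" "h \<in> Hom T X Y"
  shows "Add T (Add T f g) h = Add T f (Add T g h)"
proof -
  interpret comm_group "Hom_group T X Y"
    using hom_obj[OF assms(1)] by (rule Hom_comm_group)
  show ?thesis
    using m_assoc[of f g h] assms by (auto simp: Hom_group_def)
qed

lemma add_comm:
  assumes "f \<in> Hom T X Y" "g \<in> Hom T X Y"
  shows "Add T f g = Add T g f"
proof -
  interpret comm_group "Hom_group T X Y"
    using hom_obj[OF assms(1)] by (rule Hom_comm_group)
  show ?thesis
    using m_comm[of f g] assms by (auto simp: Hom_group_def)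
qed

lemma neg_unique:
  assumes "f \<in> Hom T X Y" "g \<in> Hom T X Y" "Add T f g = Zer T X Y"
  shows "g = Neg T f"
proof -
  interpret comm_group "Hom_group T X Y"
    using hom_obj[OF assms(1)] by (rule Hom_comm_group)
  show ?thesis
    using inv_equality[of g f] m_comm[of f g] assms by (auto simp: Hom_group_def Neg_def Hom_def)
qed

text \<open>An additive operation sends zero to an idempotent of the addition. Composition,
  suspension, shifts and the ring action are all shown to preserve zero in this way.\<close>

lemma add_idem_zer:
  assumes "f \<in> Hom T X Y" "Add T f f = f"
  shows "f = Zer T X Y"
  using assms by (metis add_assoc add_zer(1) hom_neg)

lemma neg_zer:
  assumes "X \<in> Obj T" "Y \<in> Obj T"
  shows "Neg T (Zer T X Y) = Zer T X Y"
  using neg_unique[OF hom_zer hom_zer add_zer(1)[OF hom_zer], OF assms assms assms] by simp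

lemma neg_neg:
  assumes "f \<in> Hom T X Y"
  shows "Neg T (Neg T f) = f"
  using neg_unique[OF hom_neg(1) assms] hom_neg[OF assms] add_comm assms by metis

lemma neg_eq_zer:
  assumes "f \<in> Hom T X Y" "Neg T f = Zer T X Y"
  shows "f = Zer T X Y"
  using assms by (metis neg_neg neg_zer hom_obj)

lemma comp_zer [simp]:
  assumes "f \<in> Mor T"
  shows "Y = Cod T f \<Longrightarrow> X \<in> Obj T \<Longrightarrow> Dom T f = Z \<Longrightarrow> f \<cdot> Zer T X Z = Zer T X Y"
    and "X = Dom T f \<Longrightarrow> Y \<in> Obj T \<Longrightarrow> Cod T f = Z \<Longrightarrow> Zer T Z Y \<cdot> f = Zer T X Y"
proof -
  assume *: "X \<in> Obj T" "Y = Cod T f" "Dom T f = Z"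
  then have Z: "Z \<in> Obj T" "Zer T X Z \<in> Hom T X Z" and f: "f \<in> Hom T Z Y" using assms by (auto simp: Hom_def)
  show "f \<cdot> Zer T X Z = Zer T X Y"
  proof (rule add_idem_zer)
    show "f \<cdot> Zer T X Z \<in> Hom T X Y" by (rule comp_hom[OF Z(2) f])
    show "Add T (f \<cdot> Zer T X Z) (f \<cdot> Zer T X Z) = f \<cdot> Zer T X Z"
      using comp_add_right[OF Z(2,2) f] add_zer[OF Z(2)] by simp
  qed
next
  assume *: "X = Dom T f" "Y \<in> Obj T" "Cod T f = Z"
  then have Z: "Z \<in> Obj T" "Zer T Z Y \<in> Hom T Z Y" and f: "f \<in> Hom T X Z" using assms by (auto simp: Hom_def)
  show "Zer T Z Y \<cdot> f = Zer T X Y"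
  proof (rule add_idem_zer)
    show "Zer T Z Y \<cdot> f \<in> Hom T X Y" by (rule comp_hom[OF f Z(2)])
    show "Add T (Zer T Z Y \<cdot> f) (Zer T Z Y \<cdot> f) = Zer T Z Y \<cdot> f"
      using comp_add_left[OF f Z(2,2)] add_zer[OF Z(2)] by simp
  qed
qed

lemma comp_neg:
  assumes "f \<in> Hom T X Y" "g \<in> Hom T Y Z"
  shows "g \<cdot> Neg T f = Neg T (g \<cdot> f)" "Neg T g \<cdot> f = Neg T (g \<cdot> f)"
proof -
  have o: "X \<in> Obj T" "Z \<in> Obj T" using hom_obj assms by auto
  have "Add T (g \<cdot> f) (g \<cdot> Neg T f) = g \<cdot> Zer T X Y"
    using comp_add_right[OF assms(1) hom_neg(1)[OF assms(1)] assms(2)] hom_neg[OF assms(1)] by simp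
  then show "g \<cdot> Neg T f = Neg T (g \<cdot> f)"
    using assms o hom_neg(1)[OF assms(1)] comp_hom by (intro neg_unique[of _ X Z]) (auto simp: Hom_def)
  have "Add T (g \<cdot> f) (Neg T g \<cdot> f) = Zer T Y Z \<cdot> f"
    using comp_add_left[OF assms(1) assms(2) hom_neg(1)[OF assms(2)]] hom_neg[OF assms(2)] by simp
  then show "Neg T g \<cdot> f = Neg T (g \<cdot> f)"
    using assms o hom_neg(1)[OF assms(2)] comp_hom by (intro neg_unique[of _ X Z]) (auto simp: Hom_def)
qed

definition "diff f g = Add T f (Neg T g)"

lemma hom_diff: "f \<in> Hom T X Y \<Longrightarrow> g \<in> Hom T X Y \<Longrightarrow> diff f g \<in> Hom T X Y"
  unfolding diff_def by (intro hom_add hom_neg)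

lemma diff_self: "f \<in> Hom T X Y \<Longrightarrow> diff f f = Zer T X Y"
  unfolding diff_def by (rule hom_neg)

lemma diff_zer: "f \<in> Hom T X Y \<Longrightarrow> diff f (Zer T X Y) = f"
  unfolding diff_def by (metis neg_zer hom_obj add_zer(1))

lemma diff_eq_zer:
  assumes "f \<in> Hom T X Y" "g \<in> Hom T X Y" "diff f g = Zer T X Y"
  shows "f = g"
  using neg_unique[OF assms(1) hom_neg(1)[OF assms(2)]] assms neg_neg unfolding diff_def by metis

lemma add_diff:
  assumes "f \<in> Hom T X Y" "g \<in> Hom T X Y"
  shows "Add T g (diff f g) = f"
  using assms unfolding diff_def by (metis add_assoc add_comm add_zer(1) hom_neg)

lemma diff_diff:
  assumes "f \<in> Hom T X Y" "g \<in> Hom T X Y"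
  shows "diff f (diff f g) = g"
proof -
  interpret comm_group "Hom_group T X Y"
    using hom_obj[OF assms(1)] by (rule Hom_comm_group)
  note d = hom_diff[OF assms]
  have "Add T (diff f (diff f g)) (diff f g) = Add T g (diff f g)"
    using add_diff[OF assms(1) d] add_diff[OF assms] add_comm[OF hom_diff[OF assms(1) d] d] by simp
  then show ?thesis
    using right_cancel[of "diff f g" "diff f (diff f g)" g] d hom_diff[OF assms(1) d] assms
    by (simp add: Hom_group_def)
qed

lemma comp_diff:
  assumes "f \<in> Hom T X Y" "g \<in> Hom T X Y"
  shows "h \<in> Hom T Y Z \<Longrightarrow> h \<cdot> diff f g = diff (h \<cdot> f) (h \<cdot> g)"
    and "h \<in> Hom T W X \<Longrightarrow> diff f g \<cdot> h = diff (f \<cdot> h) (g \<cdot> h)"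
  using assms hom_neg(1)[OF assms(2)] unfolding diff_def
  by (simp_all add: comp_add_right comp_neg comp_add_left)

lemma zero_obj: "zero_object T Z \<Longrightarrow> Z \<in> Obj T"
  by (simp add: zero_object_def)

lemma hom_zero_object:
  assumes "zero_object T Z"
  shows "f \<in> Hom T X Z \<Longrightarrow> f = Zer T X Z" "f \<in> Hom T Z X \<Longrightarrow> f = Zer T Z X"
proof -
  have Z: "Z \<in> Obj T" and u: "\<And>X. X \<in> Obj T \<Longrightarrow> (\<exists>!f. f \<in> Hom T X Z) \<and> (\<exists>!f. f \<in> Hom T Z X)"
    using assms by (auto simp: zero_object_def)
  show "f = Zer T X Z" if f: "f \<in> Hom T X Z"
    using u[OF hom_obj(1)[OF f]] f hom_zer[OF hom_obj(1)[OF f] Z] by auto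
  show "f = Zer T Z X" if f: "f \<in> Hom T Z X"
    using u[OF hom_obj(2)[OF f]] f hom_zer[OF Z hom_obj(2)[OF f]] by auto
qed

lemma zero_objectI:
  assumes "Z \<in> Obj T" "Idn T Z = Zer T Z Z"
  shows "zero_object T Z"
proof -
  have "f = Zer T X Z" if "f \<in> Hom T X Z" for f X
    using that assms(1) id_neutral(2)[of f Z] comp_zer(2)[of f X Z Z] unfolding assms(2) by (auto simp: Hom_def)
  moreover have "f = Zer T Z X" if "f \<in> Hom T Z X" for f X
    using that assms(1) id_neutral(1)[of f Z] comp_zer(1)[of f X Z Z] unfolding assms(2) by (auto simp: Hom_def)
  ultimately show ?thesis
    unfolding zero_object_def using assms(1) by (metis hom_zer)
qed

end

section \<open>Shifts, exact triangles and localizing subcategories\<close>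

text \<open>Iterates with negative exponent use the inverse function, so statements can only be
  compared at \<open>n\<close> and \<open>n + 1\<close>. Injectivity of the suspension makes the
  comparison an equivalence, and one step serves both directions.\<close>

lemma int_bi_induct:
  fixes n :: int
  assumes "P 0" "\<And>n. P n \<longleftrightarrow> P (n + 1)"
  shows "P n"
proof (induction n rule: int_induct[where k = 0])
  case (step2 i)
  then show ?case using assms(2)[of "i - 1"] by simp
qed (use assms in auto)

text \<open>\<open>s\<close> has the common shape of \<open>shiftO\<close> and
  \<open>shiftM\<close>; both get their recursion from this proof.\<close>

lemma bij_int_funpow_step:
  fixes n :: int
  assumes "bij_betw f A A" "x \<in> A"
  defines "s \<equiv> \<lambda>n :: int. if 0 \<le> n then f ^^ nat n else inv_into A f ^^ nat (- n)"
  shows "s (n + 1) x = f (s n x)" "s n x \<in> A"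
proof -
  have g: "inv_into A f y \<in> A" "f (inv_into A f y) = y" "f y \<in> A" if "y \<in> A" for y
    using that assms(1) bij_betw_apply[OF bij_betw_inv_into[OF assms(1)]]
    by (auto simp: bij_betw_def f_inv_into_f)
  have "(f ^^ k) x \<in> A" "(inv_into A f ^^ k) x \<in> A" for k
    using g assms(2) by (induction k) auto
  note A = this
  then show "s n x \<in> A" by (simp add: s_def)
  show "s (n + 1) x = f (s n x)"
  proof (cases "0 \<le> n")
    case True
    then have "nat (n + 1) = Suc (nat n)" by simp
    then show ?thesis using True by (simp add: s_def)
  next
    case False
    \<comment> \<open>This covers \<open>n = - 1\<close> too, where \<open>s (n + 1)\<close>
      switches to the other branch with zero iterations.\<close>
    then have "nat (- n) = Suc (nat (- (n + 1)))" by simp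
    then show ?thesis using False A g by (auto simp: s_def)
  qed
qed

section \<open>Iterated suspensions\<close>

context suspended_category begin

lemma susp_obj [simp]: "X \<in> Obj T \<Longrightarrow> SuspO T X \<in> Obj T"
  using susp_bij_obj by (auto simp: bij_betw_def)

lemma susp_arr [simp]:
  assumes "f \<in> Mor T"
  shows "SuspM T f \<in> Mor T" "Dom T (SuspM T f) = SuspO T (Dom T f)"
    "Cod T (SuspM T f) = SuspO T (Cod T f)"
  using susp_hom[of f "Dom T f" "Cod T f"] assms by (auto simp: Hom_def)

lemma susp_obj_inj: "X \<in> Obj T \<Longrightarrow> Y \<in> Obj T \<Longrightarrow> SuspO T X = SuspO T Y \<longleftrightarrow> X = Y"
  using susp_bij_obj by (auto simp: bij_betw_def inj_on_def)

lemma susp_inj: "f \<in> Mor T \<Longrightarrow> g \<in> Mor T \<Longrightarrow> SuspM T f = SuspM T g \<longleftrightarrow> f = g"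
  using susp_bij_mor by (auto simp: bij_betw_def inj_on_def)

lemma susp_obj_surj:
  assumes "Y \<in> Obj T"
  obtains X where "X \<in> Obj T" "Y = SuspO T X"
  using susp_bij_obj assms by (auto simp: bij_betw_def)

lemma susp_full:
  assumes "F \<in> Hom T (SuspO T X) (SuspO T Y)" "X \<in> Obj T" "Y \<in> Obj T"
  obtains f where "f \<in> Hom T X Y" "F = SuspM T f"
proof -
  have "F \<in> SuspM T ` Mor T"
    using susp_bij_mor assms(1) by (auto simp: bij_betw_def Hom_def)
  then obtain f where f: "f \<in> Mor T" "F = SuspM T f"
    by blast
  then have "f \<in> Hom T X Y"
    using assms by (auto simp: Hom_def susp_obj_inj)
  then show thesis using that f by blast
qed

lemma susp_zer [simp]:
  assumes "X \<in> Obj T" "Y \<in> Obj T"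
  shows "SuspM T (Zer T X Y) = Zer T (SuspO T X) (SuspO T Y)"
proof (rule add_idem_zer)
  show "SuspM T (Zer T X Y) \<in> Hom T (SuspO T X) (SuspO T Y)"
    using assms by (simp add: susp_hom)
  show "Add T (SuspM T (Zer T X Y)) (SuspM T (Zer T X Y)) = SuspM T (Zer T X Y)"
    using susp_add[OF hom_zer hom_zer, OF assms assms] add_zer[OF hom_zer, OF assms] by simp
qed

lemma susp_neg:
  assumes "f \<in> Hom T X Y"
  shows "SuspM T (Neg T f) = Neg T (SuspM T f)"
proof (rule neg_unique)
  show "SuspM T f \<in> Hom T (SuspO T X) (SuspO T Y)" "SuspM T (Neg T f) \<in> Hom T (SuspO T X) (SuspO T Y)"
    using assms hom_neg(1) susp_hom by auto
  show "Add T (SuspM T f) (SuspM T (Neg T f)) = Zer T (SuspO T X) (SuspO T Y)"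
    using susp_add[OF assms hom_neg(1)[OF assms]] hom_neg(2)[OF assms] hom_obj[OF assms] by simp
qed

lemma shift_0 [simp]: "shiftO T 0 X = X" "shiftM T 0 f = f"
  by (auto simp: shiftO_def shiftM_def)

lemma shift_obj [simp]: "X \<in> Obj T \<Longrightarrow> shiftO T n X \<in> Obj T"
  and shiftO_step: "X \<in> Obj T \<Longrightarrow> shiftO T (n + 1) X = SuspO T (shiftO T n X)"
  using bij_int_funpow_step[OF susp_bij_obj] by (auto simp: shiftO_def)

lemma shift_mor: "f \<in> Mor T \<Longrightarrow> shiftM T n f \<in> Mor T"
  and shiftM_step: "f \<in> Mor T \<Longrightarrow> shiftM T (n + 1) f = SuspM T (shiftM T n f)"
  using bij_int_funpow_step[OF susp_bij_mor] by (auto simp: shiftM_def)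

lemma shift_arr [simp]:
  assumes "f \<in> Mor T"
  shows "shiftM T n f \<in> Mor T" "Dom T (shiftM T n f) = shiftO T n (Dom T f)"
    "Cod T (shiftM T n f) = shiftO T n (Cod T f)"
proof -
  show "shiftM T n f \<in> Mor T" using assms by (rule shift_mor)
  show "Dom T (shiftM T n f) = shiftO T n (Dom T f)"
    by (rule int_bi_induct[of _ n]) (use assms in \<open>simp_all add: shiftO_step shiftM_step shift_mor susp_obj_inj\<close>)
  show "Cod T (shiftM T n f) = shiftO T n (Cod T f)"
    by (rule int_bi_induct[of _ n]) (use assms in \<open>simp_all add: shiftO_step shiftM_step shift_mor susp_obj_inj\<close>)
qed

lemma shift_hom: "f \<in> Hom T X Y \<Longrightarrow> shiftM T n f \<in> Hom T (shiftO T n X) (shiftO T n Y)"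
  by (auto simp: Hom_def)

lemma shift_comp:
  assumes "f \<in> Hom T X Y" "g \<in> Hom T Y Z"
  shows "shiftM T n (g \<cdot> f) = shiftM T n g \<cdot> shiftM T n f"
proof (rule int_bi_induct[of _ n])
  show "shiftM T n (g \<cdot> f) = shiftM T n g \<cdot> shiftM T n f \<longleftrightarrow>
    shiftM T (n + 1) (g \<cdot> f) = shiftM T (n + 1) g \<cdot> shiftM T (n + 1) f" for n
    using assms susp_inj[of "shiftM T n (g \<cdot> f)" "shiftM T n g \<cdot> shiftM T n f"]
      susp_comp[OF shift_hom[OF assms(1), of n] shift_hom[OF assms(2), of n]]
    by (auto simp: Hom_def shiftM_step)
qed simp

lemma shift_add:
  assumes "f \<in> Hom T X Y" "g \<in> Hom T X Y"
  shows "shiftM T n (Add T f g) = Add T (shiftM T n f) (shiftM T n g)"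
proof (rule int_bi_induct[of _ n])
  show "shiftM T n (Add T f g) = Add T (shiftM T n f) (shiftM T n g) \<longleftrightarrow>
    shiftM T (n + 1) (Add T f g) = Add T (shiftM T (n + 1) f) (shiftM T (n + 1) g)" for n
    using assms susp_inj[of "shiftM T n (Add T f g)" "Add T (shiftM T n f) (shiftM T n g)"]
      susp_add[OF shift_hom[OF assms(1), of n] shift_hom[OF assms(2), of n]]
    by (auto simp: Hom_def shiftM_step)
qed simp

lemma shift_zer [simp]:
  assumes "X \<in> Obj T" "Y \<in> Obj T"
  shows "shiftM T n (Zer T X Y) = Zer T (shiftO T n X) (shiftO T n Y)"
proof (rule add_idem_zer)
  show "shiftM T n (Zer T X Y) \<in> Hom T (shiftO T n X) (shiftO T n Y)"
    using assms by (simp add: shift_hom)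
  show "Add T (shiftM T n (Zer T X Y)) (shiftM T n (Zer T X Y)) = shiftM T n (Zer T X Y)"
    using shift_add[OF hom_zer hom_zer, OF assms assms] add_zer[OF hom_zer, OF assms] by simp
qed

lemma shiftO_shiftO:
  assumes "X \<in> Obj T"
  shows "shiftO T m (shiftO T n X) = shiftO T (m + n) X"
proof (rule int_bi_induct[of _ m])
  show "shiftO T m (shiftO T n X) = shiftO T (m + n) X \<longleftrightarrow>
    shiftO T (m + 1) (shiftO T n X) = shiftO T (m + 1 + n) X" for m
    using assms shiftO_step[of X "m + n"] shiftO_step[of "shiftO T n X" m]
    by (simp add: susp_obj_inj add_ac)
qed simp

lemma shiftM_shiftM:
  assumes "f \<in> Mor T"
  shows "shiftM T m (shiftM T n f) = shiftM T (m + n) f"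
proof (rule int_bi_induct[of _ m])
  show "shiftM T m (shiftM T n f) = shiftM T (m + n) f \<longleftrightarrow>
    shiftM T (m + 1) (shiftM T n f) = shiftM T (m + 1 + n) f" for m
    using assms shiftM_step[of f "m + n"] shiftM_step[of "shiftM T n f" m]
    by (simp add: susp_inj add_ac)
qed simp

lemma susp_eq_shift: "X \<in> Obj T \<Longrightarrow> SuspO T X = shiftO T 1 X" "f \<in> Mor T \<Longrightarrow> SuspM T f = shiftM T 1 f"
  using shiftO_step[of X 0] shiftM_step[of f 0] by auto

text \<open>This trades a shift of the target for a shift of the source, so that graded maps of any
  degree reduce to maps of degree zero.\<close>

lemma shift_adjunct:
  assumes "F \<in> Hom T A (shiftO T n X)" "X \<in> Obj T"
  obtains f where "f \<in> Hom T (shiftO T (- n) A) X" "F = shiftM T n f"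
proof
  have A: "A \<in> Obj T" "F \<in> Mor T" using assms hom_obj by (auto simp: Hom_def)
  show "shiftM T (- n) F \<in> Hom T (shiftO T (- n) A) X"
    using shift_hom[OF assms(1), of "- n"] assms(2) by (simp add: shiftO_shiftO)
  show "F = shiftM T n (shiftM T (- n) F)"
    using A by (simp add: shiftM_shiftM)
qed

lemma shift_inj:
  assumes "f \<in> Mor T" "g \<in> Mor T" "shiftM T n f = shiftM T n g"
  shows "f = g"
  using arg_cong[OF assms(3), of "shiftM T (- n)"] assms(1,2) by (simp add: shiftM_shiftM)

lemma hom_shift_zer:
  assumes "f \<in> Hom T A (shiftO T n X)" "X \<in> Obj T"
    and "\<And>g. g \<in> Hom T (shiftO T (- n) A) X \<Longrightarrow> g = Zer T (shiftO T (- n) A) X"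
  shows "f = Zer T A (shiftO T n X)"
proof -
  obtain g where g: "g \<in> Hom T (shiftO T (- n) A) X" "f = shiftM T n g"
    using shift_adjunct[OF assms(1,2)] by blast
  then show ?thesis
    using assms(3)[OF g(1)] hom_obj(1)[OF assms(1)] assms(2) by (simp add: shiftO_shiftO)
qed

lemma zero_object_susp:
  assumes "X \<in> Obj T"
  shows "zero_object T (SuspO T X) \<longleftrightarrow> zero_object T X"
proof
  assume "zero_object T X"
  then have "Idn T X = Zer T X X"
    using hom_zero_object(1) id_hom[OF assms] by blast
  then show "zero_object T (SuspO T X)"
    using assms susp_id[OF assms] by (intro zero_objectI) auto
next
  assume "zero_object T (SuspO T X)"
  then have "Idn T (SuspO T X) = Zer T (SuspO T X) (SuspO T X)"
    using hom_zero_object(1) id_hom assms by (metis susp_obj)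
  then have "SuspM T (Idn T X) = SuspM T (Zer T X X)"
    using assms susp_id by simp
  then show "zero_object T X"
    using assms susp_inj[of "Idn T X" "Zer T X X"] by (intro zero_objectI) auto
qed

lemma coproduct_shift:
  assumes "coproduct T I X S \<iota>"
  shows "coproduct T I (\<lambda>i. shiftO T n (X i)) (shiftO T n S) (\<lambda>i. shiftM T n (\<iota> i))"
proof (rule coproductI)
  have S: "S \<in> Obj T" and \<iota>: "\<And>i. i \<in> I \<Longrightarrow> \<iota> i \<in> Hom T (X i) S"
    using assms by (auto simp: coproduct_def)
  then show "shiftO T n S \<in> Obj T"
    "\<And>i. i \<in> I \<Longrightarrow> shiftM T n (\<iota> i) \<in> Hom T (shiftO T n (X i)) (shiftO T n S)"
    by (auto intro: shift_hom)
  have adj: "shiftM T (- n) F \<in> Hom T W (shiftO T (- n) Y)" "shiftM T n (shiftM T (- n) F) = F"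
    if "F \<in> Hom T (shiftO T n W) Y" "W \<in> Obj T" for F W Y
    using shift_hom[OF that(1), of "- n"] that by (auto simp: shiftO_shiftO shiftM_shiftM Hom_def)
  show "\<exists>h\<in>Hom T (shiftO T n S) Y. \<forall>i\<in>I. h \<cdot> shiftM T n (\<iota> i) = f i"
    if Y: "Y \<in> Obj T" and f: "\<And>i. i \<in> I \<Longrightarrow> f i \<in> Hom T (shiftO T n (X i)) Y" for Y f
  proof -
    have X: "X i \<in> Obj T" if "i \<in> I" for i using \<iota>[OF that] hom_obj by blast
    obtain h where h: "h \<in> Hom T S (shiftO T (- n) Y)" "\<And>i. i \<in> I \<Longrightarrow> h \<cdot> \<iota> i = shiftM T (- n) (f i)"
      using coproduct_desc[OF assms, of "shiftO T (- n) Y" "\<lambda>i. shiftM T (- n) (f i)"] Y adj(1)[OF f X] by auto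
    have "shiftM T n h \<cdot> shiftM T n (\<iota> i) = f i" if "i \<in> I" for i
      using shift_comp[OF \<iota>[OF that] h(1), of n] h(2)[OF that] adj(2)[OF f[OF that] X[OF that]] by simp
    then show ?thesis
      using shift_hom[OF h(1), of n] Y by (intro bexI[of _ "shiftM T n h"]) (auto simp: shiftO_shiftO)
  qed
  show "a = b" if a: "a \<in> Hom T (shiftO T n S) Y" and b: "b \<in> Hom T (shiftO T n S) Y"
    and eq: "\<And>i. i \<in> I \<Longrightarrow> a \<cdot> shiftM T n (\<iota> i) = b \<cdot> shiftM T n (\<iota> i)" for Y a b
  proof -
    have key: "shiftM T (- n) c \<cdot> \<iota> i = shiftM T (- n) (c \<cdot> shiftM T n (\<iota> i))"
      if "i \<in> I" "c \<in> Hom T (shiftO T n S) Y" for i c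
      using shift_comp[OF shift_hom[OF \<iota>[OF that(1)]] that(2), of "- n"] \<iota>[OF that(1)]
      by (auto simp: shiftM_shiftM Hom_def)
    have "shiftM T (- n) a = shiftM T (- n) b"
    proof (rule coproduct_ext[OF assms adj(1)[OF a S] adj(1)[OF b S]])
      fix i assume "i \<in> I"
      then show "shiftM T (- n) a \<cdot> \<iota> i = shiftM T (- n) b \<cdot> \<iota> i"
        using key[OF _ a] key[OF _ b] eq by metis
    qed
    then show ?thesis
      using adj(2)[OF a S] adj(2)[OF b S] by metis
  qed
qed

lemma coproduct_susp:
  assumes "coproduct T I X S \<iota>"
  shows "coproduct T I (\<lambda>i. SuspO T (X i)) (SuspO T S) (\<lambda>i. SuspM T (\<iota> i))"
proof -
  have "S \<in> Obj T" "\<And>i. i \<in> I \<Longrightarrow> X i \<in> Obj T" "\<And>i. i \<in> I \<Longrightarrow> \<iota> i \<in> Mor T"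
    using assms coproduct_hom[OF assms] hom_obj(1)[OF coproduct_hom[OF assms]]
    by (auto simp: coproduct_def Hom_def)
  then show ?thesis
    using coproduct_cong[OF coproduct_shift[OF assms, of 1]] by (simp add: susp_eq_shift)
qed

end

section \<open>Exact triangles\<close>

context triangulated_category begin

lemma exactD:
  assumes "exact_triangle T X Y Z f g h"
  shows "X \<in> Obj T" "Y \<in> Obj T" "Z \<in> Obj T"
    "f \<in> Hom T X Y" "g \<in> Hom T Y Z" "h \<in> Hom T Z (SuspO T X)"
  using assms by (auto simp: exact_triangle_def)

lemma rotate:
  assumes "exact_triangle T X Y Z f g h"
  shows "exact_triangle T Y Z (SuspO T X) g h (Neg T (SuspM T f))"
  using tri_rotate[of f X Y g Z h] exactD[OF assms] assms by blast

text \<open>The rotation axiom goes backwards only for a given first map; fullness of the suspension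
  produces this map from \<open>Neg T k\<close>.\<close>

lemma unrotate:
  assumes "exact_triangle T Y Z (SuspO T X) g h k" "X \<in> Obj T"
  obtains f where "f \<in> Hom T X Y" "exact_triangle T X Y Z f g h" "k = Neg T (SuspM T f)"
proof -
  note E = exactD[OF assms(1)]
  obtain f where f: "f \<in> Hom T X Y" "Neg T k = SuspM T f"
    using susp_full[OF hom_neg(1)[OF E(6)] assms(2) E(1)] by blast
  then have "k = Neg T (SuspM T f)"
    using neg_neg[OF E(6)] by simp
  then show thesis
    using that f tri_rotate[OF f(1) E(4,5)] assms(1) by blast
qed

text \<open>Map the triangle on \<open>Idn T X\<close> to the given one: the composite then factors
  through a zero object.\<close>

lemma tri_comp_zer:
  assumes "exact_triangle T X Y Z f g h"
  shows "g \<cdot> f = Zer T X Z"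
proof -
  note E = exactD[OF assms]
  obtain N where N: "zero_object T N" using zero_object_exists by blast
  have "f \<cdot> Idn T X = f \<cdot> Idn T X" by simp
  then obtain c where "c \<in> Hom T N Z" "c \<cdot> Zer T X N = g \<cdot> f"
    using tri_morphism[OF tri_id[OF E(1) N] assms id_hom[OF E(1)] E(4)] by blast
  then show ?thesis
    using E(1) zero_obj[OF N] by (auto simp: Hom_def)
qed

text \<open>The weak cokernel property, obtained as a fill-in to the trivial triangle
  \<open>N \<rightarrow> B \<rightarrow> B\<close>.\<close>

lemma tri_ext:
  assumes "exact_triangle T X Y Z f g h" "a \<in> Hom T Y B" "a \<cdot> f = Zer T X B"
  obtains b where "b \<in> Hom T Z B" "a = b \<cdot> g"
proof -
  note E = exactD[OF assms(1)] and B = hom_obj(2)[OF assms(2)]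
  obtain N where N: "zero_object T N" using zero_object_exists by blast
  then have N': "N \<in> Obj T" "zero_object T (SuspO T N)"
    using zero_obj zero_object_susp by auto
  obtain u where u: "u \<in> Hom T N B" "exact_triangle T N B B u (Idn T B) (Zer T B (SuspO T N))"
    using unrotate[OF tri_id[OF B N'(2)] N'(1)] by metis
  have "u = Zer T N B"
    using hom_zero_object(2)[OF N u(1)] .
  then have "a \<cdot> f = u \<cdot> Zer T X N"
    using assms(3) E(1) B N' by simp
  then obtain c where "c \<in> Hom T Z B" "c \<cdot> g = Idn T B \<cdot> a"
    using tri_morphism[OF assms(1) u(2), of "Zer T X N" a] E(1) N'(1) assms(2) by auto
  then show thesis
    using that assms(2) by (auto simp: Hom_def)
qed

text \<open>The weak kernel property. The axiom fills in at the third vertex only, so both triangles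
  are rotated first and the resulting map is desuspended.\<close>

lemma tri_lift:
  assumes "exact_triangle T X Y Z f g h" "a \<in> Hom T A Y" "g \<cdot> a = Zer T A Z"
  obtains b where "b \<in> Hom T A X" "a = f \<cdot> b"
proof -
  note E = exactD[OF assms(1)] and A = hom_obj(1)[OF assms(2)]
  obtain N where N: "zero_object T N" using zero_object_exists by blast
  then have N': "N \<in> Obj T" using zero_obj by auto
  have "\<exists>c\<in>Hom T (SuspO T A) (SuspO T X). c \<cdot> Zer T N (SuspO T A) = h \<cdot> Zer T N Z \<and>
      SuspM T a \<cdot> Neg T (SuspM T (Idn T A)) = Neg T (SuspM T f) \<cdot> c"
    using tri_morphism[OF rotate[OF tri_id[OF A N]] rotate[OF assms(1)], of a "Zer T N Z"] assms(2,3) E N'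
    by (auto simp: Hom_def)
  then obtain c where c: "c \<in> Hom T (SuspO T A) (SuspO T X)"
    "SuspM T a \<cdot> Neg T (SuspM T (Idn T A)) = Neg T (SuspM T f) \<cdot> c"
    by blast
  obtain b where b: "b \<in> Hom T A X" "c = SuspM T b"
    using susp_full[OF c(1) A E(1)] by blast
  have "Neg T (SuspM T a) = Neg T (SuspM T (f \<cdot> b))"
    using c(2) comp_neg(1)[OF _ susp_hom[OF assms(2)], of "SuspM T (Idn T A)" "SuspO T A"]
      comp_neg(2)[OF c(1) susp_hom[OF E(4)]] susp_comp[OF b(1) E(4)] A assms(2) b(2) susp_id[OF A]
    by (auto simp: Hom_def)
  then have "SuspM T a = SuspM T (f \<cdot> b)"
    by (metis neg_neg susp_hom assms(2) b(1) E(4) comp_hom)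
  then have "a = f \<cdot> b"
    using assms(2) b(1) E(4) by (auto simp: Hom_def susp_inj)
  then show thesis using that b(1) by blast
qed

lemma shift_lift:
  assumes "exact_triangle T X Y Z f g h" "a \<in> Hom T A (shiftO T d Y)"
    "shiftM T d g \<cdot> a = Zer T A (shiftO T d Z)"
  obtains b where "b \<in> Hom T A (shiftO T d X)" "a = shiftM T d f \<cdot> b"
proof -
  note E = exactD[OF assms(1)] and A = hom_obj(1)[OF assms(2)]
  obtain a' where a': "a' \<in> Hom T (shiftO T (- d) A) Y" "a = shiftM T d a'"
    using shift_adjunct[OF assms(2) E(2)] by blast
  have "shiftM T d (g \<cdot> a') = shiftM T d (Zer T (shiftO T (- d) A) Z)"
    using assms(3) A E by (simp add: shift_comp[OF a'(1) E(5)] a'(2) shiftO_shiftO)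
  then have "g \<cdot> a' = Zer T (shiftO T (- d) A) Z"
    by (rule shift_inj[rotated 2]) (use E A a'(1) in \<open>auto simp: Hom_def\<close>)
  then obtain b' where b': "b' \<in> Hom T (shiftO T (- d) A) X" "a' = f \<cdot> b'"
    using tri_lift[OF assms(1) a'(1)] by blast
  show thesis
  proof
    show "shiftM T d b' \<in> Hom T A (shiftO T d X)"
      using shift_hom[OF b'(1), of d] A by (simp add: shiftO_shiftO)
    show "a = shiftM T d f \<cdot> shiftM T d b'"
      using a'(2) b' shift_comp[OF b'(1) E(4)] by simp
  qed
qed

lemma tri_susp:
  assumes "exact_triangle T X Y Z f g h"
  obtains f' g' h' where "exact_triangle T (SuspO T X) (SuspO T Y) (SuspO T Z) f' g' h'"
  using rotate[OF rotate[OF rotate[OF assms]]] by blast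

lemma tri_desusp:
  assumes "exact_triangle T (SuspO T X) (SuspO T Y) (SuspO T Z) f g h"
    and o: "X \<in> Obj T" "Y \<in> Obj T" "Z \<in> Obj T"
  obtains f' g' h' where "exact_triangle T X Y Z f' g' h'"
proof -
  obtain h' where "exact_triangle T Z (SuspO T X) (SuspO T Y) h' f g"
    using unrotate[OF assms(1) o(3)] by metis
  then obtain g' where "exact_triangle T Y Z (SuspO T X) g' h' f"
    using unrotate o(2) by metis
  then show thesis
    using that unrotate o(1) by metis
qed

text \<open>With this triangle, closure under isomorphism becomes a special case of closure under
  extensions.\<close>

lemma iso_triangle:
  assumes "isomorphism T X Y f" "zero_object T N"
  shows "exact_triangle T X Y N f (Zer T Y N) (Zer T N (SuspO T X))"
proof -
  have f: "f \<in> Hom T X Y" using assms(1) by (simp add: isomorphism_def)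
  have o: "X \<in> Obj T" "Y \<in> Obj T" "N \<in> Obj T" using hom_obj[OF f] zero_obj[OF assms(2)] by auto
  show ?thesis
    by (rule tri_iso[OF tri_id[OF o(1) assms(2)] _ _ _ iso_id[OF o(1)] assms(1) iso_id[OF o(3)]])
      (use f o in \<open>auto simp: Hom_def susp_id\<close>)
qed

lemma zero_triangle:
  assumes "zero_object T N" "X \<in> Obj T"
  obtains f g h where "exact_triangle T N X X f g h"
proof -
  have "N \<in> Obj T" "zero_object T (SuspO T N)"
    using assms(1) zero_obj zero_object_susp by auto
  then show thesis
    using that unrotate[OF tri_id[OF assms(2)]] by metis
qed

end

section \<open>Localizing subcategories\<close>

lemma localizingD:
  assumes "localizing \<kappa> T S"
  shows "S \<subseteq> Obj T"
    and "zero_object T Z \<Longrightarrow> Z \<in> S"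
    and "isomorphism T X Y f \<Longrightarrow> X \<in> S \<Longrightarrow> Y \<in> Obj T \<Longrightarrow> Y \<in> S"
    and "X \<in> Obj T \<Longrightarrow> SuspO T X \<in> S \<longleftrightarrow> X \<in> S"
    and "exact_triangle T X Y Z f g h \<Longrightarrow> X \<in> S \<Longrightarrow> Y \<in> S \<Longrightarrow> Z \<in> S"
  using assms unfolding localizing_def by blast+

lemma localizing_coproduct':
  fixes \<kappa> :: "'i rel" and I :: "'i set"
  assumes "localizing \<kappa> T S" "small \<kappa> I" "\<And>i. i \<in> I \<Longrightarrow> X i \<in> S" "coproduct T I X C \<iota>"
  shows "C \<in> S"
proof -
  have "\<forall>(I :: 'i set) X C \<iota>. small \<kappa> I \<longrightarrow> (\<forall>i \<in> I. X i \<in> S) \<longrightarrow> coproduct T I X C \<iota> \<longrightarrow> C \<in> S"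
    using assms(1) unfolding localizing_def by (elim conjE)
  then show ?thesis
    by (rule allE[of _ I]) (use assms(2-4) in fast)
qed

lemma localizing_Inter:
  fixes \<kappa> :: "'i rel"
  assumes "\<And>S. S \<in> F \<Longrightarrow> localizing \<kappa> T S" "F \<noteq> {}"
  shows "localizing \<kappa> T (\<Inter>F)"
  unfolding localizing_def
proof (intro conjI ballI allI impI)
  show "\<Inter>F \<subseteq> Obj T" using assms localizingD(1) by blast
next
  fix I :: "'i set" and X C \<iota>
  assume *: "small \<kappa> I" "\<forall>i\<in>I. X i \<in> \<Inter>F" "coproduct T I X C \<iota>"
  show "C \<in> \<Inter>F"
  proof
    fix S assume "S \<in> F"
    then show "C \<in> S" using localizing_coproduct'[OF assms(1) *(1) _ *(3)] *(2) by blast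
  qed
next
  fix X assume "X \<in> Obj T"
  then have "SuspO T X \<in> S \<longleftrightarrow> X \<in> S" if "S \<in> F" for S
    using localizingD(4)[OF assms(1)[OF that]] by simp
  then show "SuspO T X \<in> \<Inter>F \<longleftrightarrow> X \<in> \<Inter>F" by blast
next
  fix Z assume "zero_object T Z"
  then show "Z \<in> \<Inter>F" using localizingD(2)[OF assms(1)] by blast
next
  fix X Y f assume "X \<in> \<Inter>F" "Y \<in> Obj T" "isomorphism T X Y f"
  then show "Y \<in> \<Inter>F" using localizingD(3)[OF assms(1)] by blast
next
  fix X Y Z f g h assume "exact_triangle T X Y Z f g h" "X \<in> \<Inter>F" "Y \<in> \<Inter>F"
  then show "Z \<in> \<Inter>F" using localizingD(5)[OF assms(1)] by blast
qed

lemma localizing_Int: "localizing \<kappa> T A \<Longrightarrow> localizing \<kappa> T B \<Longrightarrow> localizing \<kappa> T (A \<inter> B)"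
  using localizing_Inter[of "{A, B}" \<kappa> T] by auto

lemma Loc_subset: "C \<subseteq> Loc \<kappa> T C"
  by (auto simp: Loc_def)

lemma Loc_least: "localizing \<kappa> T S \<Longrightarrow> C \<subseteq> S \<Longrightarrow> Loc \<kappa> T C \<subseteq> S"
  by (auto simp: Loc_def)

context triangulated_category begin

lemma localizing_rev:
  assumes "localizing \<kappa> T S" "exact_triangle T X Y Z f g h"
  shows "Y \<in> S \<Longrightarrow> Z \<in> S \<Longrightarrow> X \<in> S" "X \<in> S \<Longrightarrow> Z \<in> S \<Longrightarrow> Y \<in> S"
proof -
  note E = exactD[OF assms(2)]
  show "X \<in> S" if "Y \<in> S" "Z \<in> S"
    using localizingD(5)[OF assms(1) rotate[OF assms(2)]] localizingD(4)[OF assms(1) E(1)] that by blast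
  obtain Z' where Z': "Z' \<in> Obj T" "Z = SuspO T Z'"
    using susp_obj_surj[OF E(3)] by blast
  then obtain f' where "exact_triangle T Z' X Y f' f g"
    using unrotate[of X Y Z' f g h] assms(2) by blast
  then show "Y \<in> S" if "X \<in> S" "Z \<in> S"
    using localizingD(5)[OF assms(1), of Z' X Y] localizingD(4)[OF assms(1) Z'(1)] that Z'(2) by blast
qed

text \<open>Extension closure together with two-sided closure under suspension gives cones by
  rotation and isomorphisms by \<open>iso_triangle\<close>. For classes given by vanishing or
  annihilation conditions, extensions are the convenient case.\<close>

lemma localizingI:
  fixes \<kappa> :: "'i rel"
  assumes "S \<subseteq> Obj T"
    and zero: "\<And>Z. zero_object T Z \<Longrightarrow> Z \<in> S"
    and susp: "\<And>X. X \<in> Obj T \<Longrightarrow> SuspO T X \<in> S \<longleftrightarrow> X \<in> S"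
    and ext: "\<And>X Y Z f g h. exact_triangle T X Y Z f g h \<Longrightarrow> X \<in> S \<Longrightarrow> Z \<in> S \<Longrightarrow> Y \<in> S"
    and coprod: "\<And>(I :: 'i set) X C \<iota>. small \<kappa> I \<Longrightarrow> (\<And>i. i \<in> I \<Longrightarrow> X i \<in> S) \<Longrightarrow> coproduct T I X C \<iota> \<Longrightarrow> C \<in> S"
  shows "localizing \<kappa> T S"
  unfolding localizing_def
proof (intro conjI ballI allI impI)
  show "Y \<in> S" if "X \<in> S" "Y \<in> Obj T" "isomorphism T X Y f" for X Y f
    using zero_object_exists ext[OF iso_triangle[OF that(3)] that(1)] zero by blast
  show "Z \<in> S" if "exact_triangle T X Y Z f g h" "X \<in> S" "Y \<in> S" for X Y Z f g h
    using ext[OF rotate[OF that(1)] that(3)] susp[OF exactD(1)[OF that(1)]] that(2) by blast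
  show "C \<in> S" if "small \<kappa> I" "\<forall>i\<in>I. X i \<in> S" "coproduct T I X C \<iota>" for I :: "'i set" and X C \<iota>
    by (rule coprod[OF that(1) _ that(3)]) (use that(2) in auto)
qed (use assms(1) zero susp in auto)

lemma localizing_Obj: "localizing \<kappa> T (Obj T)"
  by (rule localizingI) (auto simp: zero_obj coproduct_def dest: exactD)

lemma localizing_Loc: "C \<subseteq> Obj T \<Longrightarrow> localizing \<kappa> T (Loc \<kappa> T C)"
  unfolding Loc_def using localizing_Obj by (intro localizing_Inter) auto

lemma localizing_shift:
  assumes "localizing \<kappa> T S" "X \<in> Obj T"
  shows "shiftO T n X \<in> S \<longleftrightarrow> X \<in> S"
  by (rule int_bi_induct[of _ n]) (use assms localizingD(4)[OF assms(1)] in \<open>auto simp: shiftO_step\<close>)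

lemma localizing_coproduct:
  fixes \<kappa> :: "'i rel" and K :: "'k set"
  assumes "uncountable_regular \<kappa>" "localizing \<kappa> T S" "small \<kappa> K"
    "\<And>k. k \<in> K \<Longrightarrow> X k \<in> S" "coproduct T K X C \<iota>"
  shows "C \<in> S"
proof -
  obtain e and I :: "'i set" where e: "bij_betw e K I" "small \<kappa> I"
    using small_reindex assms(1,3) by blast
  have "coproduct T I (X \<circ> inv_into K e) C (\<iota> \<circ> inv_into K e)"
    using coproduct_reindex[OF bij_betw_inv_into[OF e(1)] assms(5)] .
  then show ?thesis
    using localizing_coproduct'[OF assms(2) e(2), of "X \<circ> inv_into K e"] assms(4)
      bij_betw_apply[OF bij_betw_inv_into[OF e(1)]]
    by auto
qed

lemma coproducts_exist:
  fixes \<kappa> :: "'i rel" and K :: "'k set"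
  assumes "uncountable_regular \<kappa>" "has_small_coproducts \<kappa> T" "small \<kappa> K" "\<And>k. k \<in> K \<Longrightarrow> X k \<in> Obj T"
  obtains S \<iota> where "coproduct T K X S \<iota>"
proof -
  obtain e and I :: "'i set" where e: "bij_betw e K I" "small \<kappa> I"
    using small_reindex assms(1,3) by blast
  have "\<forall>i\<in>I. X (inv_into K e i) \<in> Obj T"
    using assms(4) bij_betw_apply[OF bij_betw_inv_into[OF e(1)]] by blast
  then obtain S \<iota> where "coproduct T I (\<lambda>i. X (inv_into K e i)) S \<iota>"
    using assms(2) e(2) unfolding has_small_coproducts_def by meson
  then have "coproduct T K ((\<lambda>i. X (inv_into K e i)) \<circ> e) S (\<iota> \<circ> e)"
    by (rule coproduct_reindex[OF e(1)])
  then have "coproduct T K X S (\<iota> \<circ> e)"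
    using bij_betw_inv_into_left[OF e(1)] by (elim coproduct_cong) auto
  then show thesis
    by (rule that)
qed

end

section \<open>Extensions of localizing subcategories\<close>

text \<open>The product of classes of objects known from Beilinson, Bernstein and Deligne.\<close>

definition star :: "('o, 'm) tricat \<Rightarrow> 'o set \<Rightarrow> 'o set \<Rightarrow> 'o set" where
  "star T A B = {X. \<exists>G\<in>A. \<exists>M\<in>B. \<exists>f g h. exact_triangle T G X M f g h}"

definition perp :: "('o, 'm) tricat \<Rightarrow> 'o set \<Rightarrow> 'o set" where
  "perp T A = {X \<in> Obj T. \<forall>D\<in>A. \<forall>f\<in>Hom T D X. f = Zer T D X}"

text \<open>\<open>f\<close> is supported on \<open>F\<close> if it factors through the coproduct of the summands in \<open>F\<close>.  Phrased by
  annihilation, the condition makes sense without projections and passes easily to cones.\<close>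

definition supported :: "('o, 'm) tricat \<Rightarrow> 'k set \<Rightarrow> ('k \<Rightarrow> 'm) \<Rightarrow> 'm \<Rightarrow> bool" where
  "supported T F \<iota> f \<longleftrightarrow> (\<forall>Y\<in>Obj T. \<forall>a\<in>Hom T (Cod T f) Y.
     (\<forall>i\<in>F. a \<cdot>\<^bsub>T\<^esub> \<iota> i = Zer T (Dom T (\<iota> i)) Y) \<longrightarrow> a \<cdot>\<^bsub>T\<^esub> f = Zer T (Dom T f) Y)"

text \<open>The consequence of compactness that the proof works with. It is stable under shifts and
  cones, so Koszul objects inherit it from the generators.\<close>

definition finitely_supported :: "'i rel \<Rightarrow> ('o, 'm) tricat \<Rightarrow> 'o \<Rightarrow> bool" where
  "finitely_supported \<kappa> T C \<longleftrightarrow> C \<in> Obj T \<and>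
     (\<forall>(I :: 'i set) X S \<iota> f. small \<kappa> I \<longrightarrow> coproduct T I X S \<iota> \<longrightarrow> f \<in> Hom T C S \<longrightarrow>
        (\<exists>F\<subseteq>I. finite F \<and> supported T F \<iota> f))"

context triangulated_category begin

text \<open>The fill-ins \<open>w i\<close> from \<open>tri_morphism\<close> are not canonical, but any choice makes \<open>W\<close> a coproduct; this
  is the five lemma, spelled out for existence and uniqueness.\<close>

lemma coproduct_cone:
  assumes t: "\<And>i. i \<in> I \<Longrightarrow> exact_triangle T (X i) (Y i) (Z i) (f i) (g i) (h i)"
    and S: "coproduct T I X S \<iota>" and S': "coproduct T I Y S' \<iota>'"
    and F: "\<And>i. i \<in> I \<Longrightarrow> F \<cdot> \<iota> i = \<iota>' i \<cdot> f i"
    and e: "exact_triangle T S S' W F G H"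
  obtains w where "coproduct T I Z W w"
proof -
  note E = exactD[OF e] and t' = exactD[OF t]
  have \<iota>: "\<iota> i \<in> Hom T (X i) S" "\<iota>' i \<in> Hom T (Y i) S'" if "i \<in> I" for i
    using coproduct_hom[OF S that] coproduct_hom[OF S' that] by auto
  have "\<exists>c\<in>Hom T (Z i) W. c \<cdot> g i = G \<cdot> \<iota>' i \<and> SuspM T (\<iota> i) \<cdot> h i = H \<cdot> c" if "i \<in> I" for i
    using tri_morphism[OF t[OF that] e \<iota>[OF that]] F[OF that] by simp
  then obtain w where w: "\<And>i. i \<in> I \<Longrightarrow> w i \<in> Hom T (Z i) W" "\<And>i. i \<in> I \<Longrightarrow> w i \<cdot> g i = G \<cdot> \<iota>' i"
    "\<And>i. i \<in> I \<Longrightarrow> SuspM T (\<iota> i) \<cdot> h i = H \<cdot> w i"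
    by metis
  note SS = coproduct_susp[OF S] and SS' = coproduct_susp[OF S']
  have "coproduct T I Z W w"
  proof (rule coproductI)
    fix B k assume B: "B \<in> Obj T" and k: "\<And>i. i \<in> I \<Longrightarrow> k i \<in> Hom T (Z i) B"
    obtain k1 where k1: "k1 \<in> Hom T S' B" "\<And>i. i \<in> I \<Longrightarrow> k1 \<cdot> \<iota>' i = k i \<cdot> g i"
      using coproduct_desc[OF S' B, of "\<lambda>i. k i \<cdot> g i"] k t'(5) comp_hom by metis
    have "k1 \<cdot> F = Zer T S B"
    proof (rule coproduct_ext[OF S comp_hom[OF E(4) k1(1)] hom_zer[OF E(1) B]])
      fix i assume i: "i \<in> I"
      have "(k1 \<cdot> F) \<cdot> \<iota> i = k1 \<cdot> (\<iota>' i \<cdot> f i)"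
        using comp_assoc[OF \<iota>(1)[OF i] E(4) k1(1)] F[OF i] by simp
      also have "\<dots> = (k i \<cdot> g i) \<cdot> f i"
        using comp_assoc[OF t'(4)[OF i] \<iota>(2)[OF i] k1(1)] k1(2)[OF i] by simp
      also have "\<dots> = k i \<cdot> (g i \<cdot> f i)"
        using comp_assoc[OF t'(4)[OF i] t'(5)[OF i] k[OF i]] .
      also have "\<dots> = Zer T (X i) B"
        using tri_comp_zer[OF t[OF i]] k[OF i] t'(1)[OF i] by (auto simp: Hom_def)
      finally show "(k1 \<cdot> F) \<cdot> \<iota> i = Zer T S B \<cdot> \<iota> i"
        using \<iota>(1)[OF i] E B by (auto simp: Hom_def)
    qed
    then obtain k2 where k2: "k2 \<in> Hom T W B" "k1 = k2 \<cdot> G"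
      using tri_ext[OF e k1(1)] by blast
    \<comment> \<open>\<open>k2\<close> has the right restriction along \<open>G\<close> but need
      not satisfy \<open>k2 \<cdot> w i = k i\<close>. The errors \<open>?d i\<close> vanish on
      \<open>g i\<close>, hence come from maps on the suspended \<open>X i\<close>; these glue to
      \<open>b'\<close>, and subtracting \<open>b' \<cdot> H\<close> repairs all indices at
      once.\<close>
    let ?d = "\<lambda>i. diff (k2 \<cdot> w i) (k i)"
    have "\<exists>b. b \<in> Hom T (SuspO T (X i)) B \<and> ?d i = b \<cdot> h i" if i: "i \<in> I" for i
    proof -
      have "?d i \<cdot> g i = diff ((k2 \<cdot> w i) \<cdot> g i) (k i \<cdot> g i)"
        by (rule comp_diff(2)[OF comp_hom[OF w(1)[OF i] k2(1)] k[OF i] t'(5)[OF i]])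
      also have "(k2 \<cdot> w i) \<cdot> g i = k i \<cdot> g i"
        using comp_assoc[OF t'(5)[OF i] w(1)[OF i] k2(1)] w(2)[OF i] comp_assoc[OF \<iota>(2)[OF i] E(5) k2(1)]
          k1(2)[OF i] k2(2) by simp
      finally have "?d i \<cdot> g i = Zer T (Y i) B"
        using diff_self[OF comp_hom[OF t'(5)[OF i] k[OF i]]] by simp
      then show ?thesis
        using tri_ext[OF rotate[OF t[OF i]] hom_diff[OF comp_hom[OF w(1)[OF i] k2(1)] k[OF i]]] by metis
    qed
    then obtain b where b: "\<And>i. i \<in> I \<Longrightarrow> b i \<in> Hom T (SuspO T (X i)) B" "\<And>i. i \<in> I \<Longrightarrow> ?d i = b i \<cdot> h i"
      by metis
    obtain b' where b': "b' \<in> Hom T (SuspO T S) B" "\<And>i. i \<in> I \<Longrightarrow> b' \<cdot> SuspM T (\<iota> i) = b i"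
      using coproduct_desc[OF SS B, of b] b(1) by blast
    have "diff k2 (b' \<cdot> H) \<cdot> w i = k i" if i: "i \<in> I" for i
    proof -
      have "(b' \<cdot> H) \<cdot> w i = (b' \<cdot> SuspM T (\<iota> i)) \<cdot> h i"
        using comp_assoc[OF w(1)[OF i] E(6) b'(1)] w(3)[OF i]
          comp_assoc[OF t'(6)[OF i] susp_hom[OF \<iota>(1)[OF i]] b'(1)] by simp
      then have "(b' \<cdot> H) \<cdot> w i = ?d i"
        using b'(2)[OF i] b(2)[OF i] by simp
      then have eq: "diff k2 (b' \<cdot> H) \<cdot> w i = diff (k2 \<cdot> w i) (?d i)"
        using comp_diff(2)[OF k2(1) comp_hom[OF E(6) b'(1)] w(1)[OF i]] by simp
      have k2w: "k2 \<cdot> w i \<in> Hom T (Z i) B" using w(1)[OF i] k2(1) comp_hom by blast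
      show ?thesis using eq diff_diff[OF k2w k[OF i]] by simp
    qed
    then show "\<exists>h\<in>Hom T W B. \<forall>i\<in>I. h \<cdot> w i = k i"
      using hom_diff[OF k2(1) comp_hom[OF E(6) b'(1)]] by blast
  next
    fix B a a' assume a: "a \<in> Hom T W B" "a' \<in> Hom T W B" and eq: "\<And>i. i \<in> I \<Longrightarrow> a \<cdot> w i = a' \<cdot> w i"
    define k where "k = diff a a'"
    have B: "B \<in> Obj T" using hom_obj a by blast
    have k: "k \<in> Hom T W B" unfolding k_def using a by (rule hom_diff)
    have kw: "k \<cdot> w i = Zer T (Z i) B" if i: "i \<in> I" for i
      unfolding k_def using comp_diff(2)[OF a w(1)[OF i]] eq[OF i] diff_self comp_hom[OF w(1)[OF i] a(2)] by simp
    have "k \<cdot> G = Zer T S' B"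
    proof (rule coproduct_ext[OF S' comp_hom[OF E(5) k] hom_zer[OF E(2) B]])
      fix i assume i: "i \<in> I"
      have "(k \<cdot> G) \<cdot> \<iota>' i = (k \<cdot> w i) \<cdot> g i"
        using comp_assoc[OF \<iota>(2)[OF i] E(5) k] comp_assoc[OF t'(5)[OF i] w(1)[OF i] k] w(2)[OF i] by simp
      then show "(k \<cdot> G) \<cdot> \<iota>' i = Zer T S' B \<cdot> \<iota>' i"
        using kw[OF i] t'[OF i] \<iota>[OF i] E B by (auto simp: Hom_def)
    qed
    then obtain b where b: "b \<in> Hom T (SuspO T S) B" "k = b \<cdot> H"
      using tri_ext[OF rotate[OF e] k] by blast
    \<comment> \<open>The components of \<open>b\<close> vanish on \<open>h i\<close>, so they
      extend over the suspended \<open>f i\<close>. Gluing the extensions shows that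
      \<open>b\<close> factors through the suspended \<open>F\<close>, whose composite with
      \<open>H\<close> is zero.\<close>
    have "\<exists>l. l \<in> Hom T (SuspO T (Y i)) B \<and> b \<cdot> SuspM T (\<iota> i) = l \<cdot> Neg T (SuspM T (f i))"
      if i: "i \<in> I" for i
    proof -
      have "(b \<cdot> SuspM T (\<iota> i)) \<cdot> h i = k \<cdot> w i"
        using comp_assoc[OF t'(6)[OF i] susp_hom[OF \<iota>(1)[OF i]] b(1)] w(3)[OF i]
          comp_assoc[OF w(1)[OF i] E(6) b(1)] b(2) by simp
      then have "(b \<cdot> SuspM T (\<iota> i)) \<cdot> h i = Zer T (Z i) B"
        using kw[OF i] by simp
      then show ?thesis
        using tri_ext[OF rotate[OF rotate[OF t[OF i]]] comp_hom[OF susp_hom[OF \<iota>(1)[OF i]] b(1)]] by metis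
    qed
    then obtain l where l: "\<And>i. i \<in> I \<Longrightarrow> l i \<in> Hom T (SuspO T (Y i)) B"
      "\<And>i. i \<in> I \<Longrightarrow> b \<cdot> SuspM T (\<iota> i) = l i \<cdot> Neg T (SuspM T (f i))"
      by metis
    obtain l' where l': "l' \<in> Hom T (SuspO T S') B" "\<And>i. i \<in> I \<Longrightarrow> l' \<cdot> SuspM T (\<iota>' i) = l i"
      using coproduct_desc[OF SS' B, of l] l(1) by blast
    note nF = hom_neg(1)[OF susp_hom[OF E(4)]]
    have "b = l' \<cdot> Neg T (SuspM T F)"
    proof (rule coproduct_ext[OF SS b(1) comp_hom[OF nF l'(1)]])
      fix i assume i: "i \<in> I"
      have "Neg T (SuspM T F) \<cdot> SuspM T (\<iota> i) = Neg T (SuspM T (F \<cdot> \<iota> i))"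
        using comp_neg(2)[OF susp_hom[OF \<iota>(1)[OF i]] susp_hom[OF E(4)]] susp_comp[OF \<iota>(1)[OF i] E(4)] by simp
      also have "\<dots> = SuspM T (\<iota>' i) \<cdot> Neg T (SuspM T (f i))"
        using comp_neg(1)[OF susp_hom[OF t'(4)[OF i]] susp_hom[OF \<iota>(2)[OF i]]]
          susp_comp[OF t'(4)[OF i] \<iota>(2)[OF i]] F[OF i] by simp
      finally have "(l' \<cdot> Neg T (SuspM T F)) \<cdot> SuspM T (\<iota> i) = l' \<cdot> (SuspM T (\<iota>' i) \<cdot> Neg T (SuspM T (f i)))"
        using comp_assoc[OF susp_hom[OF \<iota>(1)[OF i]] nF l'(1)] by simp
      also have "\<dots> = l i \<cdot> Neg T (SuspM T (f i))"
        using comp_assoc[OF hom_neg(1)[OF susp_hom[OF t'(4)[OF i]]] susp_hom[OF \<iota>(2)[OF i]] l'(1)]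
          l'(2)[OF i] by simp
      finally show "b \<cdot> SuspM T (\<iota> i) = (l' \<cdot> Neg T (SuspM T F)) \<cdot> SuspM T (\<iota> i)"
        using l(2)[OF i] by simp
    qed
    then have "k = l' \<cdot> (Neg T (SuspM T F) \<cdot> H)"
      using comp_assoc[OF E(6) nF l'(1)] b(2) by simp
    then have "k = Zer T W B"
      using tri_comp_zer[OF rotate[OF rotate[OF e]]] E l'(1) by (auto simp: Hom_def)
    then show "a = a'"
      unfolding k_def using diff_eq_zer[OF a] by blast
  qed (use E w in auto)
  then show thesis by (rule that)
qed

lemma starI: "exact_triangle T X Y Z f g h \<Longrightarrow> X \<in> A \<Longrightarrow> Z \<in> B \<Longrightarrow> Y \<in> star T A B"
  unfolding star_def by blast

lemma star_mono: "A \<subseteq> A' \<Longrightarrow> B \<subseteq> B' \<Longrightarrow> star T A B \<subseteq> star T A' B'"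
  unfolding star_def by blast

text \<open>The octahedron on the composite \<open>g \<cdot> f\<close> of the two inclusions: its
  cone \<open>D\<close> is the extension of \<open>c\<close> by \<open>b\<close> that the other
  bracketing asks for.\<close>

lemma star_assoc1: "star T (star T A B) C \<subseteq> star T A (star T B C)"
proof
  fix X assume "X \<in> star T (star T A B) C"
  then obtain P c a b f u u' g v v' where
    t: "exact_triangle T P X c g v v'" "exact_triangle T a P b f u u'" and in': "a \<in> A" "b \<in> B" "c \<in> C"
    by (auto simp: star_def)
  obtain D w w' where w: "exact_triangle T a X D (g \<cdot> f) w w'"
    using tri_complete[OF comp_hom[OF exactD(4)[OF t(2)] exactD(4)[OF t(1)]]] by blast
  obtain p q where D: "exact_triangle T b D c p q (SuspM T u \<cdot> v')"
    using tri_octahedral[OF t(2,1) w] by blast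
  show "X \<in> star T A (star T B C)"
    by (rule starI[OF w in'(1) starI[OF D in'(2,3)]])
qed

text \<open>Here the octahedron is taken on the composite \<open>k \<cdot> g\<close> of the two
  projections. It yields the suspension of the wanted triangle, which is then desuspended.\<close>

lemma star_assoc2: "star T A (star T B C) \<subseteq> star T (star T A B) C"
proof
  fix X assume "X \<in> star T A (star T B C)"
  then obtain Q c a b i g h j k l where
    t: "exact_triangle T a X Q i g h" "exact_triangle T b Q c j k l" and in': "a \<in> A" "b \<in> B" "c \<in> C"
    by (auto simp: star_def)
  obtain D w w' where w: "exact_triangle T X c D (k \<cdot> g) w w'"
    using tri_complete[OF comp_hom[OF exactD(5)[OF t(1)] exactD(5)[OF t(2)]]] by blast
  obtain p q r where p: "exact_triangle T (SuspO T a) D (SuspO T b) p q r"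
    using tri_octahedral[OF rotate[OF t(1)] rotate[OF t(2)] w] by blast
  obtain P where P: "P \<in> Obj T" "D = SuspO T P"
    using susp_obj_surj exactD(3)[OF w] by blast
  obtain f where f: "exact_triangle T P X c f (k \<cdot> g) w"
    using unrotate w P by metis
  obtain f' g' h' where P': "exact_triangle T a P b f' g' h'"
    using tri_desusp[of a P b p q r] p P exactD(1)[OF t(1)] exactD(1)[OF t(2)] by blast
  show "X \<in> star T (star T A B) C"
    by (rule starI[OF f starI[OF P' in'(1,2)] in'(3)])
qed

text \<open>A triangle \<open>l \<rightarrow> X \<rightarrow> u \<rightarrow> \<Sigma>l\<close> splits because its last map is zero.\<close>

lemma star_swap:
  assumes "localizing \<kappa> T L" "L \<subseteq> perp T U"
  shows "star T L U \<subseteq> star T U L"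
proof
  fix X assume "X \<in> star T L U"
  then obtain l u f g h where t: "exact_triangle T l X u f g h" and in': "l \<in> L" "u \<in> U"
    by (auto simp: star_def)
  note E = exactD[OF t]
  obtain N where N: "zero_object T N" using zero_object_exists by blast
  have Sl: "SuspO T l \<in> L" using localizingD(4)[OF assms(1) E(1)] in'(1) by simp
  then have "h = Zer T u (SuspO T l)"
    using assms(2) in'(2) E(6) by (auto simp: perp_def)
  then have "h \<cdot> Idn T u = Zer T u (SuspO T l)"
    using E by (auto simp: Hom_def)
  then obtain s where s: "s \<in> Hom T u X" "Idn T u = g \<cdot> s"
    using tri_lift[OF rotate[OF t] id_hom[OF E(3)]] by blast
  obtain A p p' where A: "exact_triangle T u X A s p p'"
    using tri_complete[OF s(1)] by blast
  \<comment> \<open>Octahedron for \<open>g \<cdot> s = Idn T u\<close>: the cone of the identity is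
    the zero object \<open>N\<close>, which puts the cone \<open>A\<close> of the section into
    \<open>L\<close>.\<close>
  obtain a b c where "exact_triangle T A N (SuspO T l) a b c"
    using tri_octahedral[OF A rotate[OF t]] tri_id[OF E(3) N] s(2) by metis
  then have "A \<in> L"
    using localizing_rev(1)[OF assms(1)] localizingD(2)[OF assms(1) N] Sl by blast
  then show "X \<in> star T U L"
    using starI[OF A in'(2)] by blast
qed

lemma star_self:
  assumes "localizing \<kappa> T L"
  shows "star T L L \<subseteq> L"
  using localizing_rev(2)[OF assms] by (auto simp: star_def)

text \<open>Read the left-hand side as a word \<open>U L U L\<close>. Swapping the inner
  \<open>L U\<close> by \<open>star_swap\<close> and collapsing repeated letters leaves
  \<open>U L\<close>.\<close>

lemma star_star:
  assumes "localizing \<kappa> T U" "localizing \<kappa> T L" "L \<subseteq> perp T U"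
  shows "star T (star T U L) (star T U L) \<subseteq> star T U L"
proof -
  have "star T L (star T U L) \<subseteq> star T (star T L U) L"
    by (rule star_assoc2)
  also have "\<dots> \<subseteq> star T (star T U L) L"
    by (intro star_mono star_swap[OF assms(2,3)] order_refl)
  also have "\<dots> \<subseteq> star T U (star T L L)"
    by (rule star_assoc1)
  also have "\<dots> \<subseteq> star T U L"
    by (intro star_mono star_self[OF assms(2)] order_refl)
  finally have *: "star T L (star T U L) \<subseteq> star T U L" .
  have "star T (star T U L) (star T U L) \<subseteq> star T U (star T L (star T U L))"
    by (rule star_assoc1)
  also have "\<dots> \<subseteq> star T U (star T U L)"
    by (intro star_mono * order_refl)
  also have "\<dots> \<subseteq> star T (star T U U) L"
    by (rule star_assoc2)
  also have "\<dots> \<subseteq> star T U L"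
    by (intro star_mono star_self[OF assms(1)] order_refl)
  finally show ?thesis .
qed

text \<open>Extensions are handled by \<open>star_star\<close>. For coproducts, the left pieces have
  a coproduct mapping to \<open>C\<close>, and its cone is a coproduct of the right pieces by
  \<open>coproduct_cone\<close>.\<close>

lemma localizing_star:
  fixes \<kappa> :: "'i rel"
  assumes \<kappa>: "uncountable_regular \<kappa>" "has_small_coproducts \<kappa> T"
    and U: "localizing \<kappa> T U" and L: "localizing \<kappa> T L" and UL: "L \<subseteq> perp T U"
  shows "localizing \<kappa> T (star T U L)"
proof (rule localizingI)
  show "star T U L \<subseteq> Obj T"
    by (auto simp: star_def dest: exactD)
  show "Z \<in> star T U L" if "zero_object T Z" for Z
    using starI[OF tri_id[OF zero_obj[OF that] that]] localizingD(2)[OF U that] localizingD(2)[OF L that] by blast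
  show "SuspO T X \<in> star T U L \<longleftrightarrow> X \<in> star T U L" if X: "X \<in> Obj T" for X
  proof
    assume "X \<in> star T U L"
    then obtain G M f g h where t: "exact_triangle T G X M f g h" "G \<in> U" "M \<in> L"
      by (auto simp: star_def)
    then have SGM: "SuspO T G \<in> U" "SuspO T M \<in> L"
      using localizingD(4)[OF U] localizingD(4)[OF L] exactD(1,3)[OF t(1)] by auto
    obtain f' g' h' where S: "exact_triangle T (SuspO T G) (SuspO T X) (SuspO T M) f' g' h'"
      using tri_susp[OF t(1)] by blast
    show "SuspO T X \<in> star T U L"
      by (rule starI[OF S SGM])
  next
    assume "SuspO T X \<in> star T U L"
    then obtain G M f g h where t: "exact_triangle T G (SuspO T X) M f g h" "G \<in> U" "M \<in> L"
      by (auto simp: star_def)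
    obtain G' M' where GM: "G' \<in> Obj T" "G = SuspO T G'" "M' \<in> Obj T" "M = SuspO T M'"
      using susp_obj_surj exactD(1,3)[OF t(1)] by metis
    then have GM': "G' \<in> U" "M' \<in> L"
      using localizingD(4)[OF U] localizingD(4)[OF L] t by auto
    obtain f' g' h' where S: "exact_triangle T G' X M' f' g' h'"
      using tri_desusp[of G' X M' f g h] t(1) GM X by blast
    show "X \<in> star T U L"
      by (rule starI[OF S GM'])
  qed
  show "Y \<in> star T U L" if "exact_triangle T X Y Z f g h" "X \<in> star T U L" "Z \<in> star T U L" for X Y Z f g h
    using starI[OF that] star_star[OF U L UL] by blast
  fix I :: "'i set" and X C \<iota>
  assume I: "small \<kappa> I" "\<And>i. i \<in> I \<Longrightarrow> X i \<in> star T U L" and C: "coproduct T I X C \<iota>"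
  have "\<forall>i\<in>I. \<exists>G M f g h. exact_triangle T G (X i) M f g h \<and> G \<in> U \<and> M \<in> L"
    using I(2) unfolding star_def by blast
  then obtain G M f g h where t: "\<And>i. i \<in> I \<Longrightarrow> exact_triangle T (G i) (X i) (M i) (f i) (g i) (h i)"
    and GM: "\<And>i. i \<in> I \<Longrightarrow> G i \<in> U" "\<And>i. i \<in> I \<Longrightarrow> M i \<in> L"
    by metis
  obtain S \<iota>' where S: "coproduct T I G S \<iota>'"
    using coproducts_exist[OF \<kappa> I(1), of G] exactD(1)[OF t] by metis
  have "\<iota> i \<cdot> f i \<in> Hom T (G i) C" if "i \<in> I" for i
    using comp_hom[OF exactD(4)[OF t[OF that]] coproduct_hom[OF C that]] .
  then obtain F where F: "F \<in> Hom T S C" "\<And>i. i \<in> I \<Longrightarrow> F \<cdot> \<iota>' i = \<iota> i \<cdot> f i"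
    using coproduct_desc[OF S, of C "\<lambda>i. \<iota> i \<cdot> f i"] C by (auto simp: coproduct_def)
  obtain W G' H' where W: "exact_triangle T S C W F G' H'"
    using tri_complete[OF F(1)] by blast
  obtain w where "coproduct T I M W w"
    using coproduct_cone[OF t S C F(2) W] by metis
  then have "W \<in> L" using localizing_coproduct'[OF L I(1), of M W w] GM(2) by blast
  moreover have "S \<in> U" using localizing_coproduct'[OF U I(1) _ S] GM(1) by blast
  ultimately show "C \<in> star T U L"
    using starI[OF W] by blast
qed

end

section \<open>Orthogonals and finitely supported objects\<close>

context triangulated_category begin

lemma perpI: "X \<in> Obj T \<Longrightarrow> (\<And>D f. D \<in> A \<Longrightarrow> f \<in> Hom T D X \<Longrightarrow> f = Zer T D X) \<Longrightarrow> X \<in> perp T A"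
  by (auto simp: perp_def)

lemma perpD: "X \<in> perp T A \<Longrightarrow> D \<in> A \<Longrightarrow> f \<in> Hom T D X \<Longrightarrow> f = Zer T D X"
  by (auto simp: perp_def)

lemma perp_obj: "X \<in> perp T A \<Longrightarrow> X \<in> Obj T"
  by (simp add: perp_def)

lemma perp_antimono: "A \<subseteq> B \<Longrightarrow> perp T B \<subseteq> perp T A"
  by (auto simp: perp_def)

lemma perp_shift:
  assumes "\<And>D n. D \<in> A \<Longrightarrow> shiftO T n D \<in> A" "A \<subseteq> Obj T" "X \<in> Obj T"
  shows "shiftO T n X \<in> perp T A \<longleftrightarrow> X \<in> perp T A"
proof -
  have *: "shiftO T n X \<in> perp T A" if X: "X \<in> perp T A" for n X
  proof (rule perpI)
    note X' = perp_obj[OF X]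
    show "shiftO T n X \<in> Obj T" using X' by simp
    fix D f assume D: "D \<in> A" and f: "f \<in> Hom T D (shiftO T n X)"
    show "f = Zer T D (shiftO T n X)"
      by (rule hom_shift_zer[OF f X']) (rule perpD[OF X assms(1)[OF D]])
  qed
  show ?thesis
    using *[of X n] *[of "shiftO T n X" "- n"] assms(3) by (auto simp: shiftO_shiftO)
qed

lemma perp_ext:
  assumes "exact_triangle T X Y Z f g h" "X \<in> perp T A" "Z \<in> perp T A"
  shows "Y \<in> perp T A"
proof (rule perpI)
  note E = exactD[OF assms(1)]
  show "Y \<in> Obj T" by (rule E(2))
  fix D a assume D: "D \<in> A" and a: "a \<in> Hom T D Y"
  have "g \<cdot> a = Zer T D Z"
    using perpD[OF assms(3) D comp_hom[OF a E(5)]] .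
  then obtain b where b: "b \<in> Hom T D X" "a = f \<cdot> b"
    using tri_lift[OF assms(1) a] by blast
  then show "a = Zer T D Y"
    using perpD[OF assms(2) D b(1)] E(4) hom_obj[OF a] by (auto simp: Hom_def)
qed

lemma perp_zero: "zero_object T Z \<Longrightarrow> Z \<in> perp T A"
  using hom_zero_object(1) zero_obj by (auto intro: perpI)

lemma perp_self_zero: "X \<in> A \<Longrightarrow> X \<in> perp T A \<Longrightarrow> zero_object T X"
  using perpD[of X A X "Idn T X"] perp_obj id_hom by (intro zero_objectI) auto

lemma finitely_supportedD:
  fixes \<kappa> :: "'i rel" and K :: "'k set"
  assumes "uncountable_regular \<kappa>" "finitely_supported \<kappa> T C" "small \<kappa> K" "coproduct T K X S \<iota>" "f \<in> Hom T C S"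
  obtains F where "F \<subseteq> K" "finite F" "supported T F \<iota> f"
proof -
  obtain e and I :: "'i set" where e: "bij_betw e K I" "small \<kappa> I"
    using small_reindex assms(1,3) by blast
  let ?e = "inv_into K e"
  have e': "bij_betw ?e I K" by (rule bij_betw_inv_into[OF e(1)])
  have "coproduct T I (X \<circ> ?e) S (\<iota> \<circ> ?e)"
    using coproduct_reindex[OF e' assms(4)] .
  then obtain F where F: "F \<subseteq> I" "finite F" "supported T F (\<iota> \<circ> ?e) f"
    using assms(2,5) e(2) unfolding finitely_supported_def by metis
  have "supported T (?e ` F) \<iota> f"
    using F(3) unfolding supported_def by simp
  then show thesis
    using that[of "?e ` F"] F(1,2) e' by (auto simp: bij_betw_def)
qed

lemma coproduct_proj:
  assumes S: "coproduct T I X S \<iota>" and j: "j \<in> I"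
  obtains \<pi> where "\<pi> \<in> Hom T S (X j)" "\<pi> \<cdot> \<iota> j = Idn T (X j)"
    "\<And>i. i \<in> I \<Longrightarrow> i \<noteq> j \<Longrightarrow> \<pi> \<cdot> \<iota> i = Zer T (X i) (X j)"
proof -
  have X: "X i \<in> Obj T" if "i \<in> I" for i
    using coproduct_hom[OF S that] hom_obj by blast
  let ?f = "\<lambda>i. if i = j then Idn T (X j) else Zer T (X i) (X j)"
  have "?f i \<in> Hom T (X i) (X j)" if "i \<in> I" for i
    using X[OF that] X[OF j] by (simp add: id_hom)
  then obtain \<pi> where \<pi>: "\<pi> \<in> Hom T S (X j)" "\<And>i. i \<in> I \<Longrightarrow> \<pi> \<cdot> \<iota> i = ?f i"
    using coproduct_desc[OF S X[OF j], of ?f] by blast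
  show thesis
    by (rule that[OF \<pi>(1)]) (simp_all add: \<pi>(2) j)
qed

text \<open>A map with finite support is a finite sum of maps through single summands. Stating this
  as an induction principle avoids forming sums of morphisms: each step splits off the component
  \<open>\<iota> j \<cdot> (\<pi> \<cdot> f)\<close>.\<close>

lemma supported_induct:
  assumes S: "coproduct T I X S \<iota>"
    and zero: "P (Zer T C S)"
    and add: "\<And>a b. a \<in> Hom T C S \<Longrightarrow> b \<in> Hom T C S \<Longrightarrow> P a \<Longrightarrow> P b \<Longrightarrow> P (Add T a b)"
    and inc: "\<And>i c. i \<in> I \<Longrightarrow> c \<in> Hom T C (X i) \<Longrightarrow> P (\<iota> i \<cdot> c)"
  shows "finite F \<Longrightarrow> F \<subseteq> I \<Longrightarrow> supported T F \<iota> f \<Longrightarrow> f \<in> Hom T C S \<Longrightarrow> P f"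
proof (induction F arbitrary: f rule: finite_induct)
  case empty
  then have "Idn T S \<cdot> f = Zer T C S"
    using hom_obj[OF empty(3)] id_hom[of S] by (auto simp: supported_def Hom_def)
  then show ?case
    using zero empty(3) by (auto simp: Hom_def)
next
  case (insert j F)
  have j: "j \<in> I" and FI: "F \<subseteq> I" using insert.prems by auto
  have \<iota>: "\<iota> i \<in> Hom T (X i) S" if "i \<in> I" for i
    using coproduct_hom[OF S that] .
  obtain \<pi> where \<pi>: "\<pi> \<in> Hom T S (X j)" "\<pi> \<cdot> \<iota> j = Idn T (X j)"
    "\<And>i. i \<in> I \<Longrightarrow> i \<noteq> j \<Longrightarrow> \<pi> \<cdot> \<iota> i = Zer T (X i) (X j)"
    using coproduct_proj[OF S j] by blast
  have f: "f \<in> Hom T C S" by fact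
  let ?f1 = "\<iota> j \<cdot> (\<pi> \<cdot> f)"
  have \<pi>f: "\<pi> \<cdot> f \<in> Hom T C (X j)" using comp_hom[OF f \<pi>(1)] .
  have f1: "?f1 \<in> Hom T C S" using comp_hom[OF \<pi>f \<iota>[OF j]] .
  have f2: "diff f ?f1 \<in> Hom T C S" using hom_diff[OF f f1] .
  have "supported T F \<iota> (diff f ?f1)"
    unfolding supported_def
  proof (intro ballI impI)
    fix Y a assume Y: "Y \<in> Obj T" and "a \<in> Hom T (Cod T (diff f ?f1)) Y"
      and kill: "\<forall>i\<in>F. a \<cdot> \<iota> i = Zer T (Dom T (\<iota> i)) Y"
    then have a: "a \<in> Hom T S Y" using f2 by (auto simp: Hom_def)
    have aj: "a \<cdot> \<iota> j \<in> Hom T (X j) Y" and aj\<pi>: "(a \<cdot> \<iota> j) \<cdot> \<pi> \<in> Hom T S Y"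
      using comp_hom \<iota>[OF j] \<pi>(1) a by blast+
    \<comment> \<open>\<open>a\<close> kills the summands in \<open>F\<close> but perhaps not the
      one at \<open>j\<close>. Its correction \<open>?b\<close> kills both, and
      \<open>?b \<cdot> f\<close> equals \<open>a\<close> composed with the remainder.\<close>
    let ?b = "diff a ((a \<cdot> \<iota> j) \<cdot> \<pi>)"
    have b: "?b \<in> Hom T S Y" using hom_diff[OF a aj\<pi>] .
    have b\<iota>: "?b \<cdot> \<iota> i = diff (a \<cdot> \<iota> i) ((a \<cdot> \<iota> j) \<cdot> (\<pi> \<cdot> \<iota> i))" if "i \<in> I" for i
      using comp_diff(2)[OF a aj\<pi> \<iota>[OF that]] comp_assoc[OF \<iota>[OF that] \<pi>(1) aj] by simp
    have "?b \<cdot> \<iota> i = Zer T (Dom T (\<iota> i)) Y" if "i \<in> insert j F" for i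
    proof (cases "i = j")
      case True
      have "(a \<cdot> \<iota> j) \<cdot> Idn T (X j) = a \<cdot> \<iota> j"
        using comp_id[OF aj] .
      then show ?thesis
        using b\<iota>[OF j] \<pi>(2) diff_self[OF aj] \<iota>[OF j] True by (simp add: Hom_def)
    next
      case False
      then have i: "i \<in> I" "i \<in> F" using that FI by auto
      note Xi = hom_obj(1)[OF \<iota>[OF i(1)]]
      have "(a \<cdot> \<iota> j) \<cdot> (\<pi> \<cdot> \<iota> i) = Zer T (X i) Y"
        using \<pi>(3)[OF i(1) False] aj Xi by (auto simp: Hom_def)
      moreover have "a \<cdot> \<iota> i = Zer T (X i) Y"
        using kill i(2) \<iota>[OF i(1)] by (simp add: Hom_def)
      ultimately show ?thesis
        using b\<iota>[OF i(1)] diff_self[OF hom_zer[OF Xi Y]] \<iota>[OF i(1)] by (simp add: Hom_def)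
    qed
    then have "?b \<cdot> f = Zer T C Y"
      using insert.prems(2) Y b f unfolding supported_def by (auto simp: Hom_def)
    moreover have "?b \<cdot> f = diff (a \<cdot> f) (a \<cdot> ?f1)"
      using comp_diff(2)[OF a aj\<pi> f] comp_assoc[OF f \<pi>(1) aj] comp_assoc[OF \<pi>f \<iota>[OF j] a] by simp
    moreover have "a \<cdot> diff f ?f1 = diff (a \<cdot> f) (a \<cdot> ?f1)"
      using comp_diff(1)[OF f f1 a] .
    moreover have "Dom T (diff f ?f1) = C" using f2 by (simp add: Hom_def)
    ultimately show "a \<cdot> diff f ?f1 = Zer T (Dom T (diff f ?f1)) Y"
      by simp
  qed
  then have "P (diff f ?f1)"
    using insert.IH[OF FI _ f2] by blast
  then have "P (Add T ?f1 (diff f ?f1))"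
    using add[OF f1 f2 inc[OF j \<pi>f]] by blast
  then show ?case
    using add_diff[OF f f1] by simp
qed

lemma finitely_supported_induct:
  fixes \<kappa> :: "'i rel"
  assumes "uncountable_regular \<kappa>" "finitely_supported \<kappa> T C" "small \<kappa> I"
    and "coproduct T I X S \<iota>" and "f \<in> Hom T C S"
    and "P (Zer T C S)"
    and "\<And>a b. a \<in> Hom T C S \<Longrightarrow> b \<in> Hom T C S \<Longrightarrow> P a \<Longrightarrow> P b \<Longrightarrow> P (Add T a b)"
    and "\<And>i c. i \<in> I \<Longrightarrow> c \<in> Hom T C (X i) \<Longrightarrow> P (\<iota> i \<cdot> c)"
  shows "P f"
proof -
  obtain F where "F \<subseteq> I" "finite F" "supported T F \<iota> f"
    using finitely_supportedD[OF assms(1-5)] by blast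
  then show ?thesis
    using supported_induct[OF assms(4), of P C F f] assms(5-8) by blast
qed

lemma finitely_supported_shift:
  fixes \<kappa> :: "'i rel"
  assumes "finitely_supported \<kappa> T C"
  shows "finitely_supported \<kappa> T (shiftO T n C)"
  unfolding finitely_supported_def
proof (intro conjI allI impI)
  have C: "C \<in> Obj T" using assms by (simp add: finitely_supported_def)
  then show "shiftO T n C \<in> Obj T" by simp
  fix I :: "'i set" and X S \<iota> f
  assume I: "small \<kappa> I" and S: "coproduct T I X S \<iota>" and f: "f \<in> Hom T (shiftO T n C) S"
  have f': "shiftM T (- n) f \<in> Hom T C (shiftO T (- n) S)"
    using shift_hom[OF f, of "- n"] C by (simp add: shiftO_shiftO)
  obtain F where F: "F \<subseteq> I" "finite F" "supported T F (\<lambda>i. shiftM T (- n) (\<iota> i)) (shiftM T (- n) f)"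
    using assms I coproduct_shift[OF S, of "- n"] f' unfolding finitely_supported_def by meson
  have "supported T F \<iota> f"
    unfolding supported_def
  proof (intro ballI impI)
    fix Y a assume Y: "Y \<in> Obj T" and "a \<in> Hom T (Cod T f) Y"
      and kill: "\<forall>i\<in>F. a \<cdot> \<iota> i = Zer T (Dom T (\<iota> i)) Y"
    then have a: "a \<in> Hom T S Y" using f by (simp add: Hom_def)
    have "shiftM T (- n) a \<cdot> shiftM T (- n) (\<iota> i) = Zer T (Dom T (shiftM T (- n) (\<iota> i))) (shiftO T (- n) Y)"
      if "i \<in> F" for i
      using shift_comp[OF coproduct_hom[OF S] a, of i "- n"] that F(1) kill Y
        coproduct_hom[OF S, of i] hom_obj[OF coproduct_hom[OF S], of i]
      by (auto simp: Hom_def subset_iff)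
    then have "shiftM T (- n) a \<cdot> shiftM T (- n) f = Zer T C (shiftO T (- n) Y)"
      using F(3) Y shift_hom[OF a, of "- n"] f' unfolding supported_def by (auto simp: Hom_def)
    then have "shiftM T (- n) (a \<cdot> f) = shiftM T (- n) (Zer T (Dom T f) Y)"
      using shift_comp[OF f a, of "- n"] f C Y by (auto simp: Hom_def shiftO_shiftO)
    then show "a \<cdot> f = Zer T (Dom T f) Y"
      by (rule shift_inj[rotated 2]) (use a f Y C in \<open>auto simp: Hom_def\<close>)
  qed
  then show "\<exists>F\<subseteq>I. finite F \<and> supported T F \<iota> f"
    using F by blast
qed

text \<open>\<open>a \<cdot> g\<close> has finite support \<open>F\<close>. If \<open>e\<close>
  projects \<open>S\<close> onto the summands in \<open>F\<close>, then \<open>a\<close> and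
  \<open>e \<cdot> a\<close> agree on \<open>g\<close>, so their difference comes from a map
  \<open>k\<close> on the suspension of \<open>C\<close>, with finite support \<open>F'\<close>.
  Hence \<open>F \<union> F'\<close> supports \<open>a\<close>.\<close>

lemma finitely_supported_cone:
  fixes \<kappa> :: "'i rel"
  assumes t: "exact_triangle T C D E f g h" and C: "finitely_supported \<kappa> T C" and D: "finitely_supported \<kappa> T D"
  shows "finitely_supported \<kappa> T E"
  unfolding finitely_supported_def
proof (intro conjI allI impI)
  note X = exactD[OF t]
  show "E \<in> Obj T" by (rule X(3))
  fix I :: "'i set" and Z S \<iota> a
  assume I: "small \<kappa> I" and S: "coproduct T I Z S \<iota>" and a: "a \<in> Hom T E S"
  have \<iota>: "\<iota> i \<in> Hom T (Z i) S" if "i \<in> I" for i using coproduct_hom[OF S that] .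
  note So = hom_obj(2)[OF a]
  obtain F where F: "F \<subseteq> I" "finite F" "supported T F \<iota> (a \<cdot> g)"
    using D I S comp_hom[OF X(5) a] unfolding finitely_supported_def by metis
  let ?e = "\<lambda>i. if i \<in> F then \<iota> i else Zer T (Z i) S"
  have "?e i \<in> Hom T (Z i) S" if "i \<in> I" for i
    using \<iota>[OF that] hom_obj[OF \<iota>[OF that]] by simp
  then obtain e where e: "e \<in> Hom T S S" "\<And>i. i \<in> I \<Longrightarrow> e \<cdot> \<iota> i = ?e i"
    using coproduct_desc[OF S So, of ?e] by blast
  have ea: "e \<cdot> a \<in> Hom T E S" using comp_hom[OF a e(1)] .
  have eid: "diff (Idn T S) e \<in> Hom T S S" using hom_diff[OF id_hom[OF So] e(1)] .
  have "diff (Idn T S) e \<cdot> \<iota> i = Zer T (Dom T (\<iota> i)) S" if "i \<in> F" for i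
  proof -
    have i: "i \<in> I" using that F by blast
    have "diff (Idn T S) e \<cdot> \<iota> i = diff (Idn T S \<cdot> \<iota> i) (e \<cdot> \<iota> i)"
      by (rule comp_diff(2)[OF id_hom[OF So] e(1) \<iota>[OF i]])
    then show ?thesis
      using e(2)[OF i] that id_comp[OF \<iota>[OF i]] diff_self[OF \<iota>[OF i]] \<iota>[OF i] by (simp add: Hom_def)
  qed
  then have "diff (Idn T S) e \<cdot> (a \<cdot> g) = Zer T D S"
    using F(3) comp_hom[OF X(5) a] eid So unfolding supported_def by (auto simp: Hom_def)
  moreover have "diff (Idn T S) e \<cdot> (a \<cdot> g) = diff a (e \<cdot> a) \<cdot> g"
    using comp_diff(2)[OF id_hom[OF So] e(1) a] id_comp[OF a] comp_assoc[OF X(5) a eid] by simp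
  ultimately have "diff a (e \<cdot> a) \<cdot> g = Zer T D S" by simp
  then obtain k where k: "k \<in> Hom T (SuspO T C) S" "diff a (e \<cdot> a) = k \<cdot> h"
    using tri_ext[OF rotate[OF t] hom_diff[OF a ea]] by blast
  have "finitely_supported \<kappa> T (SuspO T C)"
    using finitely_supported_shift[OF C, of 1] X(1) by (simp add: susp_eq_shift)
  then obtain F' where F': "F' \<subseteq> I" "finite F'" "supported T F' \<iota> k"
    using I S k(1) unfolding finitely_supported_def by metis
  have "supported T (F \<union> F') \<iota> a"
    unfolding supported_def
  proof (intro ballI impI)
    fix Y b assume Y: "Y \<in> Obj T" and "b \<in> Hom T (Cod T a) Y"
      and kill: "\<forall>i\<in>F \<union> F'. b \<cdot> \<iota> i = Zer T (Dom T (\<iota> i)) Y"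
    then have b: "b \<in> Hom T S Y" using a by (simp add: Hom_def)
    have "b \<cdot> e = Zer T S Y"
    proof (rule coproduct_ext[OF S comp_hom[OF e(1) b] hom_zer[OF So Y]])
      fix i assume i: "i \<in> I"
      note o = hom_obj[OF \<iota>[OF i]]
      have "(b \<cdot> e) \<cdot> \<iota> i = b \<cdot> ?e i"
        using comp_assoc[OF \<iota>[OF i] e(1) b] e(2)[OF i] by simp
      also have "\<dots> = Zer T (Z i) Y"
        using kill \<iota>[OF i] b o by (auto simp: Hom_def)
      finally show "(b \<cdot> e) \<cdot> \<iota> i = Zer T S Y \<cdot> \<iota> i"
        using \<iota>[OF i] o Y by (auto simp: Hom_def)
    qed
    then have "b \<cdot> (e \<cdot> a) = Zer T E Y"
      using comp_assoc[OF a e(1) b] a Y by (auto simp: Hom_def)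
    moreover have "b \<cdot> k = Zer T (SuspO T C) Y"
      using F'(3) kill Y b k(1) unfolding supported_def by (auto simp: Hom_def)
    then have "b \<cdot> diff a (e \<cdot> a) = Zer T E Y"
      using k(2) comp_assoc[OF X(6) k(1) b] X(6) Y by (auto simp: Hom_def)
    then have "diff (b \<cdot> a) (b \<cdot> (e \<cdot> a)) = Zer T E Y"
      using comp_diff(1)[OF a ea b] by simp
    ultimately have "b \<cdot> a = Zer T E Y"
      using diff_zer[OF comp_hom[OF a b]] by simp
    then show "b \<cdot> a = Zer T (Dom T a) Y"
      using a by (simp add: Hom_def)
  qed
  then show "\<exists>F\<subseteq>I. finite F \<and> supported T F \<iota> a"
    using F F' by (intro exI[of _ "F \<union> F'"]) auto
qed

text \<open>Surjectivity of the canonical map writes \<open>f\<close> as the image of a family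
  \<open>c\<close> in the direct sum; the finite support of \<open>c\<close> serves as
  \<open>F\<close>.\<close>

lemma compact_finitely_supported:
  fixes \<kappa> :: "'i rel"
  assumes "compact_object \<kappa> T C"
  shows "finitely_supported \<kappa> T C"
  unfolding finitely_supported_def
proof (intro conjI allI impI)
  show C: "C \<in> Obj T" using assms by (simp add: compact_object_def)
  fix I :: "'i set" and X S \<iota> f
  assume I: "small \<kappa> I" and S: "coproduct T I X S \<iota>" and f: "f \<in> Hom T C S"
  have X: "X i \<in> Obj T" if "i \<in> I" for i
    using hom_obj coproduct_hom[OF S that] by blast
  have So: "S \<in> Obj T" using f hom_obj by blast
  let ?G = "sum_group I (\<lambda>i. Hom_group T C (X i))" and ?H = "Hom_group T C S"
  interpret H: comm_group ?H using Hom_comm_group[OF C So] .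
  have "(\<lambda>c. finprod ?H (\<lambda>i. \<iota> i \<cdot> c i) {i \<in> I. c i \<noteq> Zer T C (X i)}) \<in> iso ?G ?H"
    using assms I X S unfolding compact_object_def by blast
  moreover have "f \<in> carrier ?H" using f by (simp add: Hom_group_def)
  ultimately obtain c where c: "c \<in> carrier ?G" "f = finprod ?H (\<lambda>i. \<iota> i \<cdot> c i) {i \<in> I. c i \<noteq> Zer T C (X i)}"
    unfolding iso_def bij_betw_def by (smt (verit) imageE mem_Collect_eq)
  have grp: "group (Hom_group T C (X i))" if "i \<in> I" for i
    using comm_group.axioms(2)[OF Hom_comm_group[OF C X[OF that]]] .
  have carr: "carrier ?G = {x \<in> \<Pi>\<^sub>E i\<in>I. carrier (Hom_group T C (X i)).
      finite {i \<in> I. x i \<noteq> \<one>\<^bsub>Hom_group T C (X i)\<^esub>}}"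
    by (rule carrier_sum_group) (rule grp)
  have c': "c i \<in> Hom T C (X i)" if "i \<in> I" for i
    using c(1) that unfolding carr by (auto simp: Hom_group_def PiE_iff)
  let ?F = "{i \<in> I. c i \<noteq> Zer T C (X i)}"
  have F: "finite ?F"
    using c(1) unfolding carr by (auto simp: Hom_group_def)
  have hom: "\<iota> i \<cdot> c i \<in> carrier ?H" if "i \<in> I" for i
    using comp_hom[OF c'[OF that] coproduct_hom[OF S that]] by (simp add: Hom_group_def)
  have "supported T ?F \<iota> f"
    unfolding supported_def
  proof (intro ballI impI)
    fix Y a assume Y: "Y \<in> Obj T" and "a \<in> Hom T (Cod T f) Y"
      and kill: "\<forall>i\<in>?F. a \<cdot> \<iota> i = Zer T (Dom T (\<iota> i)) Y"
    then have a: "a \<in> Hom T S Y" using f by (simp add: Hom_def)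
    have "F' \<subseteq> ?F \<Longrightarrow> a \<cdot> finprod ?H (\<lambda>i. \<iota> i \<cdot> c i) F' = Zer T C Y" if "finite F'" for F'
      using that
    proof (induction F' rule: finite_induct)
      case empty
      have "finprod ?H (\<lambda>i. \<iota> i \<cdot> c i) {} = Zer T C S"
        by (subst H.finprod_empty) (simp add: Hom_group_def)
      then show ?case using a C by (auto simp: Hom_def)
    next
      case (insert i F')
      then have i: "i \<in> I" and F': "F' \<subseteq> I" "F' \<subseteq> ?F" by auto
      have p: "finprod ?H (\<lambda>i. \<iota> i \<cdot> c i) F' \<in> Hom T C S" "\<iota> i \<cdot> c i \<in> Hom T C S"
        using H.finprod_closed[of "\<lambda>i. \<iota> i \<cdot> c i" F'] hom[OF i] hom F' by (auto simp: Hom_group_def)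
      have "finprod ?H (\<lambda>i. \<iota> i \<cdot> c i) (insert i F') = Add T (\<iota> i \<cdot> c i) (finprod ?H (\<lambda>i. \<iota> i \<cdot> c i) F')"
        using H.finprod_insert[OF insert(1,2), of "\<lambda>i. \<iota> i \<cdot> c i"] hom F' i
        by (auto simp: Hom_group_def)
      then have "a \<cdot> finprod ?H (\<lambda>i. \<iota> i \<cdot> c i) (insert i F') =
          Add T (a \<cdot> (\<iota> i \<cdot> c i)) (a \<cdot> finprod ?H (\<lambda>i. \<iota> i \<cdot> c i) F')"
        using comp_add_right[OF p(2,1) a] by simp
      moreover have "a \<cdot> (\<iota> i \<cdot> c i) = Zer T C Y"
        using comp_assoc[OF c'[OF i] coproduct_hom[OF S i] a] kill insert.prems c'[OF i]
          coproduct_hom[OF S i] Y by (auto simp: Hom_def)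
      ultimately show ?case
        using insert.IH[OF F'(2)] add_zer[OF hom_zer[OF C Y]] by simp
    qed
    then have "a \<cdot> f = Zer T C Y"
      using F c(2) by blast
    then show "a \<cdot> f = Zer T (Dom T f) Y" using f by (simp add: Hom_def)
  qed
  then show "\<exists>F\<subseteq>I. finite F \<and> supported T F \<iota> f"
    using F by (intro exI[of _ ?F]) auto
qed

end

section \<open>Homotopy colimits and detection by a small set of objects\<close>

context triangulated_category begin

text \<open>One stage of the tower: cone off all maps from \<open>G\<close> to \<open>A\<close>
  simultaneously. The map \<open>g\<close> survives because its composites with these maps vanish,
  \<open>X\<close> being orthogonal to \<open>G\<close>.\<close>

lemma kill_maps:
  fixes \<kappa> :: "'i rel"
  assumes \<kappa>: "uncountable_regular \<kappa>" "has_small_coproducts \<kappa> T" "locally_small \<kappa> T"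
    and V: "localizing \<kappa> T V" "G \<subseteq> V" "small \<kappa> G"
    and A: "A \<in> V" "g \<in> Hom T A X" and X: "X \<in> perp T G"
  obtains B j g' where "B \<in> V" "g' \<in> Hom T B X" "j \<in> Hom T A B" "g' \<cdot> j = g"
    "\<And>D f. D \<in> G \<Longrightarrow> f \<in> Hom T D A \<Longrightarrow> j \<cdot> f = Zer T D B"
proof -
  have GO: "G \<subseteq> Obj T" and AO: "A \<in> Obj T"
    using V A localizingD(1)[OF V(1)] by auto
  let ?K = "\<Union>D\<in>G. Hom T D A"
  have K: "small \<kappa> ?K"
  proof (rule small_UNION[OF \<kappa>(1) V(3)])
    fix D assume "D \<in> G"
    then show "small \<kappa> (Hom T D A)"
      using \<kappa>(3) GO AO unfolding locally_small_def by auto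
  qed
  have DG: "Dom T f \<in> G" "f \<in> Hom T (Dom T f) A" if "f \<in> ?K" for f
    using that by (auto simp: Hom_def)
  \<comment> \<open>Each summand is indexed by a morphism itself, so \<open>Dom T\<close> is the
    family of objects and \<open>u\<close> restricts to the index.\<close>
  obtain P \<iota> where P: "coproduct T ?K (Dom T) P \<iota>"
    using coproducts_exist[OF \<kappa>(1,2) K, of "Dom T"] DG GO by blast
  obtain u where u: "u \<in> Hom T P A" "\<And>f. f \<in> ?K \<Longrightarrow> u \<cdot> \<iota> f = f"
    using coproduct_desc[OF P AO, of "\<lambda>f. f"] DG(2) by blast
  have "P \<in> V"
    using localizing_coproduct[OF \<kappa>(1) V(1) K _ P] DG(1) V(2) by blast
  obtain B j k where t: "exact_triangle T P A B u j k"
    using tri_complete[OF u(1)] by blast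
  note E = exactD[OF t]
  have B: "B \<in> V"
    using localizingD(5)[OF V(1) t] \<open>P \<in> V\<close> A(1) by blast
  have "g \<cdot> u = Zer T P X"
  proof (rule coproduct_ext[OF P comp_hom[OF u(1) A(2)] hom_zer[OF E(1) hom_obj(2)[OF A(2)]]])
    fix f assume f: "f \<in> ?K"
    note \<iota> = coproduct_hom[OF P f]
    have "(g \<cdot> u) \<cdot> \<iota> f = g \<cdot> f"
      using comp_assoc[OF \<iota> u(1) A(2)] u(2)[OF f] by simp
    also have "\<dots> = Zer T (Dom T f) X"
      using perpD[OF X DG(1)[OF f] comp_hom[OF DG(2)[OF f] A(2)]] .
    finally show "(g \<cdot> u) \<cdot> \<iota> f = Zer T P X \<cdot> \<iota> f"
      using \<iota> E hom_obj[OF A(2)] by (auto simp: Hom_def)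
  qed
  then obtain g' where g': "g' \<in> Hom T B X" "g = g' \<cdot> j"
    using tri_ext[OF t A(2)] by blast
  have "j \<cdot> f = Zer T D B" if D: "D \<in> G" and f: "f \<in> Hom T D A" for D f
  proof -
    have fK: "f \<in> ?K" and Df: "Dom T f = D" using D f by (auto simp: Hom_def)
    have "j \<cdot> f = (j \<cdot> u) \<cdot> \<iota> f"
      using comp_assoc[OF coproduct_hom[OF P fK] u(1) E(5)] u(2)[OF fK] by simp
    then show ?thesis
      using tri_comp_zer[OF t] coproduct_hom[OF P fK] E Df by (auto simp: Hom_def)
  qed
  then show thesis
    using that[OF B g'(1) E(5)] g'(2) by blast
qed

text \<open>The homotopy colimit \<open>L\<close> lies in \<open>V\<close> and is orthogonal to
  \<open>G\<close>, so \<open>detect\<close> makes it zero. The compatible maps \<open>g n\<close>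
  assemble to \<open>\<gamma>\<close> with \<open>\<gamma> \<cdot> \<tau> = 0\<close>; thus
  \<open>\<gamma>\<close> factors through \<open>L\<close>, and its restriction \<open>g0\<close> to
  the bottom stage vanishes.\<close>

lemma perp_detect:
  fixes \<kappa> :: "'i rel"
  assumes \<kappa>: "uncountable_regular \<kappa>" "has_small_coproducts \<kappa> T" "locally_small \<kappa> T"
    and V: "localizing \<kappa> T V" "G \<subseteq> V" "small \<kappa> G"
    and G: "\<And>D. D \<in> G \<Longrightarrow> finitely_supported \<kappa> T D" "\<And>D n. D \<in> G \<Longrightarrow> shiftO T n D \<in> G"
    and detect: "\<And>L. L \<in> V \<Longrightarrow> L \<in> perp T G \<Longrightarrow> zero_object T L"
  shows "perp T V = perp T G"
proof
  show "perp T V \<subseteq> perp T G" by (rule perp_antimono[OF V(2)])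
  show "perp T G \<subseteq> perp T V"
  proof
    fix X assume X: "X \<in> perp T G"
    show "X \<in> perp T V"
    proof (rule perpI)
      show XO: "X \<in> Obj T" using X by (rule perp_obj)
      fix A0 g0 assume A0: "A0 \<in> V" and g0: "g0 \<in> Hom T A0 X"
      \<comment> \<open>A state is a stage of the tower with its map to \<open>X\<close>. The clause
        for \<open>n = 0\<close> pins the start of the tower, which the choice principle alone would
        leave open.\<close>
      let ?P = "\<lambda>(n::nat) s. fst s \<in> V \<and> snd s \<in> Hom T (fst s) X \<and> (n = 0 \<longrightarrow> s = (A0, g0))"
      let ?Q = "\<lambda>(n::nat) s t. \<exists>j. j \<in> Hom T (fst s) (fst t) \<and> snd t \<cdot> j = snd s \<and>
        (\<forall>D\<in>G. \<forall>f\<in>Hom T D (fst s). j \<cdot> f = Zer T D (fst t))"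
      have "\<exists>s. \<forall>n. ?P n (s n) \<and> ?Q n (s n) (s (Suc n))"
      proof (rule dependent_nat_choice)
        show "\<exists>s. ?P 0 s" using A0 g0 by auto
        fix s n assume s: "?P n s"
        obtain B j g' where "B \<in> V" "g' \<in> Hom T B X" "j \<in> Hom T (fst s) B" "g' \<cdot> j = snd s"
          "\<And>D f. D \<in> G \<Longrightarrow> f \<in> Hom T D (fst s) \<Longrightarrow> j \<cdot> f = Zer T D B"
          using kill_maps[OF \<kappa> V _ _ X, of "fst s" "snd s"] s by metis
        then show "\<exists>t. ?P (Suc n) t \<and> ?Q n s t"
          by (intro exI[of _ "(B, g')"]) auto
      qed
      then obtain s where s: "\<forall>n. ?P n (s n) \<and> ?Q n (s n) (s (Suc n))" by blast
      then obtain j' where "\<forall>n. j' n \<in> Hom T (fst (s n)) (fst (s (Suc n))) \<and>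
          snd (s (Suc n)) \<cdot> j' n = snd (s n) \<and>
          (\<forall>D\<in>G. \<forall>f\<in>Hom T D (fst (s n)). j' n \<cdot> f = Zer T D (fst (s (Suc n))))"
        by metis
      with s obtain A g j where A: "\<And>n. A n \<in> V" "\<And>n. g n \<in> Hom T (A n) X" "A 0 = A0" "g 0 = g0"
        and j: "\<And>n. j n \<in> Hom T (A n) (A (Suc n))" "\<And>n. g (Suc n) \<cdot> j n = g n"
          "\<And>n D f. D \<in> G \<Longrightarrow> f \<in> Hom T D (A n) \<Longrightarrow> j n \<cdot> f = Zer T D (A (Suc n))"
        using that[of "\<lambda>n. fst (s n)" "\<lambda>n. snd (s n)" j'] by auto
      have AO: "A n \<in> Obj T" for n using A(1) localizingD(1)[OF V(1)] by blast
      have sm: "small \<kappa> (UNIV :: nat set)" by (rule small_countable[OF \<kappa>(1)]) simp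
      obtain S \<iota> where S: "coproduct T UNIV A S \<iota>"
        using coproducts_exist[OF \<kappa>(1,2) sm, of A] AO by blast
      have \<iota>: "\<iota> n \<in> Hom T (A n) S" for n using coproduct_hom[OF S] by simp
      have So: "S \<in> Obj T" using hom_obj \<iota> by blast
      have \<iota>j: "\<iota> (Suc n) \<cdot> j n \<in> Hom T (A n) S" for n
        using comp_hom[OF j(1) \<iota>] .
      obtain \<tau> where \<tau>: "\<tau> \<in> Hom T S S" "\<And>n. \<tau> \<cdot> \<iota> n = diff (\<iota> n) (\<iota> (Suc n) \<cdot> j n)"
        by (rule coproduct_desc[OF S So, of "\<lambda>n. diff (\<iota> n) (\<iota> (Suc n) \<cdot> j n)", OF hom_diff[OF \<iota> \<iota>j]]) simp
      \<comment> \<open>All maps from \<open>G\<close> to a stage of the tower die at the next one, so \<open>\<tau> = 1 - shift\<close> acts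
        as the identity on maps from \<open>G\<close>, and the cone of \<open>\<tau>\<close>, a homotopy colimit, vanishes.\<close>
      have \<tau>id: "\<tau> \<cdot> f = f" if D: "D \<in> G" and f: "f \<in> Hom T D S" for D f
      proof (rule finitely_supported_induct[OF \<kappa>(1) G(1)[OF D] sm S f, of "\<lambda>f. \<tau> \<cdot> f = f"])
        show "\<tau> \<cdot> Zer T D S = Zer T D S"
          using hom_obj[OF f] \<tau>(1) by (auto simp: Hom_def)
        show "\<tau> \<cdot> Add T a b = Add T a b"
          if "a \<in> Hom T D S" "b \<in> Hom T D S" "\<tau> \<cdot> a = a" "\<tau> \<cdot> b = b" for a b
          using comp_add_right[OF that(1,2) \<tau>(1)] that by simp
        fix n c assume c: "c \<in> Hom T D (A n)"
        have "\<tau> \<cdot> (\<iota> n \<cdot> c) = diff (\<iota> n \<cdot> c) ((\<iota> (Suc n) \<cdot> j n) \<cdot> c)"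
          using comp_assoc[OF c \<iota> \<tau>(1)] \<tau>(2) comp_diff(2)[OF \<iota> \<iota>j c] by simp
        also have "(\<iota> (Suc n) \<cdot> j n) \<cdot> c = Zer T D S"
          using comp_assoc[OF c j(1) \<iota>] j(3)[OF D c] \<iota>[of "Suc n"] hom_obj[OF f] AO by (auto simp: Hom_def)
        finally show "\<tau> \<cdot> (\<iota> n \<cdot> c) = \<iota> n \<cdot> c"
          using diff_zer[OF comp_hom[OF c \<iota>]] by simp
      qed
      obtain L p q where t: "exact_triangle T S S L \<tau> p q"
        using tri_complete[OF \<tau>(1)] by blast
      note E = exactD[OF t]
      have "S \<in> V" using localizing_coproduct[OF \<kappa>(1) V(1) sm A(1) S] .
      then have LV: "L \<in> V" using localizingD(5)[OF V(1) t] by blast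
      have "L \<in> perp T G"
      proof (rule perpI)
        show "L \<in> Obj T" by (rule E(3))
        fix D f assume D: "D \<in> G" and f: "f \<in> Hom T D L"
        \<comment> \<open>\<open>\<tau>id\<close> concerns maps into \<open>S\<close>, so
          \<open>q \<cdot> f\<close> is desuspended first; its source stays in \<open>G\<close> by
          closure under shifts. Being both fixed and killed by the suspended \<open>\<tau>\<close>,
          the map \<open>q \<cdot> f\<close> vanishes.\<close>
        have qf: "q \<cdot> f \<in> Hom T D (shiftO T 1 S)"
          using comp_hom[OF f E(6)] So by (simp add: susp_eq_shift)
        obtain y where y: "y \<in> Hom T (shiftO T (- 1) D) S" "q \<cdot> f = shiftM T 1 y"
          using shift_adjunct[OF qf So] by blast
        have "SuspM T \<tau> \<cdot> (q \<cdot> f) = shiftM T 1 (\<tau> \<cdot> y)"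
          using shift_comp[OF y(1) \<tau>(1), of 1] y(2) \<tau>(1) by (simp add: susp_eq_shift Hom_def)
        then have "SuspM T \<tau> \<cdot> (q \<cdot> f) = q \<cdot> f"
          using \<tau>id[OF G(2)[OF D] y(1)] y(2) by simp
        moreover have "Neg T (SuspM T \<tau>) \<cdot> (q \<cdot> f) = Zer T D (SuspO T S)"
          using tri_comp_zer[OF rotate[OF rotate[OF t]]] f
            comp_assoc[OF f E(6) hom_neg(1)[OF susp_hom[OF \<tau>(1)]]] So by (auto simp: Hom_def)
        then have "Neg T (SuspM T \<tau> \<cdot> (q \<cdot> f)) = Zer T D (SuspO T S)"
          using comp_neg(2)[OF comp_hom[OF f E(6)] susp_hom[OF \<tau>(1)]] by simp
        then have "SuspM T \<tau> \<cdot> (q \<cdot> f) = Zer T D (SuspO T S)"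
          using neg_eq_zer comp_hom[OF comp_hom[OF f E(6)] susp_hom[OF \<tau>(1)]] by blast
        ultimately have "q \<cdot> f = Zer T D (SuspO T S)" by simp
        then obtain b where b: "b \<in> Hom T D S" "f = p \<cdot> b"
          using tri_lift[OF rotate[OF t] f] by blast
        have "f = p \<cdot> (\<tau> \<cdot> b)" using \<tau>id[OF D b(1)] b(2) by simp
        then have "f = (p \<cdot> \<tau>) \<cdot> b" using comp_assoc[OF b(1) \<tau>(1) E(5)] by simp
        then show "f = Zer T D L"
          using tri_comp_zer[OF t] b(1) E by (auto simp: Hom_def)
      qed
      then have Lz: "zero_object T L" using detect LV by blast
      obtain \<gamma> where \<gamma>: "\<gamma> \<in> Hom T S X" "\<And>n. \<gamma> \<cdot> \<iota> n = g n"
        by (rule coproduct_desc[OF S XO, of g, OF A(2)]) simp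
      have "\<gamma> \<cdot> \<tau> = Zer T S X"
      proof (rule coproduct_ext[OF S comp_hom[OF \<tau>(1) \<gamma>(1)] hom_zer[OF So XO]])
        fix n
        have "(\<gamma> \<cdot> \<tau>) \<cdot> \<iota> n = \<gamma> \<cdot> diff (\<iota> n) (\<iota> (Suc n) \<cdot> j n)"
          using comp_assoc[OF \<iota> \<tau>(1) \<gamma>(1)] \<tau>(2) by simp
        also have "\<dots> = diff (g n) (g (Suc n) \<cdot> j n)"
          using comp_diff(1)[OF \<iota> \<iota>j \<gamma>(1)] comp_assoc[OF j(1) \<iota> \<gamma>(1)] \<gamma>(2) by simp
        also have "\<dots> = Zer T (A n) X"
          using j(2) diff_self[OF A(2)] by simp
        finally show "(\<gamma> \<cdot> \<tau>) \<cdot> \<iota> n = Zer T S X \<cdot> \<iota> n"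
          using \<iota>[of n] XO So by (auto simp: Hom_def)
      qed
      then obtain b where b: "b \<in> Hom T L X" "\<gamma> = b \<cdot> p"
        using tri_ext[OF t \<gamma>(1)] by blast
      have "\<gamma> = Zer T S X"
        using hom_zero_object(2)[OF Lz b(1)] b(2) E XO by (auto simp: Hom_def)
      then show "g0 = Zer T A0 X"
        using \<gamma>(2)[of 0] \<iota>[of 0] A(3,4) XO So by (auto simp: Hom_def)
    qed
  qed
qed

text \<open>Closed under coproducts because a map from \<open>D\<close> into a coproduct is built by
  addition from maps into the summands.\<close>

lemma localizing_perp:
  fixes \<kappa> :: "'i rel"
  assumes "uncountable_regular \<kappa>" "G \<subseteq> Obj T"
    and G: "\<And>D. D \<in> G \<Longrightarrow> finitely_supported \<kappa> T D" "\<And>D n. D \<in> G \<Longrightarrow> shiftO T n D \<in> G"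
  shows "localizing \<kappa> T (perp T G)"
proof (rule localizingI)
  show "SuspO T X \<in> perp T G \<longleftrightarrow> X \<in> perp T G" if "X \<in> Obj T" for X
    using perp_shift[of G X 1] assms(2) G(2) that by (simp add: susp_eq_shift)
  fix I :: "'i set" and X S \<iota>
  assume I: "small \<kappa> I" and X: "\<And>i. i \<in> I \<Longrightarrow> X i \<in> perp T G" and S: "coproduct T I X S \<iota>"
  show "S \<in> perp T G"
  proof (rule perpI)
    show So: "S \<in> Obj T" using S by (simp add: coproduct_def)
    fix D f assume D: "D \<in> G" and f: "f \<in> Hom T D S"
    have Do: "D \<in> Obj T" using D assms(2) by blast
    show "f = Zer T D S"
    proof (rule finitely_supported_induct[OF assms(1) G(1)[OF D] I S f, of "\<lambda>f. f = Zer T D S"])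
      show "Add T a b = Zer T D S" if "a = Zer T D S" "b = Zer T D S" for a b
        using that add_zer[OF hom_zer[OF Do So]] by simp
      show "\<iota> i \<cdot> c = Zer T D S" if "i \<in> I" "c \<in> Hom T D (X i)" for i c
        using perpD[OF X[OF that(1)] D that(2)] coproduct_hom[OF S that(1)] Do by (auto simp: Hom_def)
    qed simp
  qed
qed (use perp_obj perp_zero perp_ext in blast)+

text \<open>The objects without nonzero maps to any shift of \<open>L\<close> form a localizing
  class containing \<open>G\<close>. It therefore contains \<open>L\<close>, whose identity must be
  zero. Quantifying over all shifts makes the class stable under suspension.\<close>

lemma generators_detect:
  fixes \<kappa> :: "'i rel"
  assumes "Loc \<kappa> T G = Obj T" "L \<in> Obj T"
    and L: "\<And>n D f. D \<in> G \<Longrightarrow> f \<in> Hom T D (shiftO T n L) \<Longrightarrow> f = Zer T D (shiftO T n L)"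
  shows "zero_object T L"
proof -
  let ?N = "{Y \<in> Obj T. \<forall>n. \<forall>f\<in>Hom T Y (shiftO T n L). f = Zer T Y (shiftO T n L)}"
  have "localizing \<kappa> T ?N"
  proof (rule localizingI)
    show "?N \<subseteq> Obj T" by blast
    show "Z \<in> ?N" if "zero_object T Z" for Z
      using zero_obj[OF that] hom_zero_object(2)[OF that] by blast
    have shift: "shiftO T m X \<in> ?N" if X: "X \<in> ?N" for m X
    proof (intro CollectI conjI allI ballI)
      have Xo: "X \<in> Obj T" using X by blast
      then show "shiftO T m X \<in> Obj T" by simp
      fix n f assume f: "f \<in> Hom T (shiftO T m X) (shiftO T n L)"
      have "shiftM T (- m) f \<in> Hom T X (shiftO T (n - m) L)"
        using shift_hom[OF f, of "- m"] Xo assms(2) by (simp add: shiftO_shiftO)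
      then have "shiftM T (- m) f = Zer T X (shiftO T (n - m) L)"
        using X by blast
      then have "shiftM T (- m) f = shiftM T (- m) (Zer T (shiftO T m X) (shiftO T n L))"
        using Xo assms(2) by (simp add: shiftO_shiftO)
      then show "f = Zer T (shiftO T m X) (shiftO T n L)"
        by (rule shift_inj[rotated 2]) (use f Xo assms(2) in \<open>auto simp: Hom_def\<close>)
    qed
    show "SuspO T X \<in> ?N \<longleftrightarrow> X \<in> ?N" if X: "X \<in> Obj T" for X
    proof
      show "SuspO T X \<in> ?N" if "X \<in> ?N"
        using shift[OF that, of 1] X by (simp only: susp_eq_shift)
      have "shiftO T (- 1) (SuspO T X) = X"
        using X by (simp add: susp_eq_shift shiftO_shiftO)
      then show "X \<in> ?N" if "SuspO T X \<in> ?N"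
        using shift[OF that, of "- 1"] by (simp only:)
    qed
    show "Y \<in> ?N" if t: "exact_triangle T X Y Z f g h" and X: "X \<in> ?N" and Z: "Z \<in> ?N" for X Y Z f g h
    proof (intro CollectI conjI allI ballI)
      note E = exactD[OF t]
      show "Y \<in> Obj T" by (rule E(2))
      fix n a assume a: "a \<in> Hom T Y (shiftO T n L)"
      have "a \<cdot> f = Zer T X (shiftO T n L)"
        using X comp_hom[OF E(4) a] by blast
      then obtain b where b: "b \<in> Hom T Z (shiftO T n L)" "a = b \<cdot> g"
        using tri_ext[OF t a] by blast
      then have "b = Zer T Z (shiftO T n L)" using Z by blast
      then show "a = Zer T Y (shiftO T n L)"
        using b(2) E assms(2) by (auto simp: Hom_def)
    qed
    fix I :: "'i set" and X S \<iota>
    assume X: "\<And>i. i \<in> I \<Longrightarrow> X i \<in> ?N" and S: "coproduct T I X S \<iota>"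
    show "S \<in> ?N"
    proof (intro CollectI conjI allI ballI)
      show So: "S \<in> Obj T" using S by (simp add: coproduct_def)
      fix n f assume f: "f \<in> Hom T S (shiftO T n L)"
      have Lo: "shiftO T n L \<in> Obj T" using assms(2) by simp
      show "f = Zer T S (shiftO T n L)"
      proof (rule coproduct_ext[OF S f hom_zer[OF So Lo]])
        fix i assume i: "i \<in> I"
        have "f \<cdot> \<iota> i = Zer T (X i) (shiftO T n L)"
          using X[OF i] comp_hom[OF coproduct_hom[OF S i] f] by blast
        then show "f \<cdot> \<iota> i = Zer T S (shiftO T n L) \<cdot> \<iota> i"
          using coproduct_hom[OF S i] Lo by (auto simp: Hom_def)
      qed
    qed
  qed
  moreover have "G \<subseteq> ?N"
    using L Loc_subset[of G \<kappa> T] assms(1) by blast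
  ultimately have "L \<in> ?N"
    using Loc_least[of \<kappa> T ?N G] assms(1,2) by blast
  then have "\<forall>f\<in>Hom T L (shiftO T 0 L). f = Zer T L (shiftO T 0 L)" by blast
  then show ?thesis
    using id_hom[OF assms(2)] assms(2) by (intro zero_objectI) auto
qed

end

section \<open>Homogeneous primes\<close>

context graded_ring begin

lemma gr_carrier: "x \<in> gr n \<Longrightarrow> x \<in> carrier R"
  using additive_subgroup.a_subset[OF gr_subgroup] by blast

lemma gr_zero: "\<zero> \<in> gr n"
  by (rule additive_subgroup.zero_closed[OF gr_subgroup])

lemma gr_neg: "x \<in> gr n \<Longrightarrow> \<ominus> x \<in> gr n"
  by (rule additive_subgroup.a_inv_closed[OF gr_subgroup])

lemma gr_pow: "r \<in> gr e \<Longrightarrow> r [^] (k::nat) \<in> gr (int k * e)"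
proof (induction k)
  case (Suc k)
  then have "r [^] k \<otimes> r \<in> gr (int k * e + e)"
    using gr_mult by blast
  then show ?case by (simp add: algebra_simps)
qed (simp add: gr_one)

lemma finsum_mem:
  assumes "finite F" "\<And>i. i \<in> F \<Longrightarrow> f i \<in> D" "D \<subseteq> carrier R" "\<zero> \<in> D"
    "\<And>x y. x \<in> D \<Longrightarrow> y \<in> D \<Longrightarrow> x \<oplus> y \<in> D"
  shows "(\<Oplus>i\<in>F. f i) \<in> D"
  using assms(1,2)
proof (induction F rule: finite_induct)
  case (insert i F)
  have "(\<Oplus>i\<in>insert i F. f i) = f i \<oplus> (\<Oplus>i\<in>F. f i)"
    using insert assms(3) by (intro finsum_insert) auto
  then show ?case using insert assms(5) by auto
qed (simp add: assms(4))

lemma homogeneous_induct [consumes 1, case_names zero add hom]: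
  assumes "x \<in> carrier R"
    and "P \<zero>"
    and add: "\<And>x y. x \<in> carrier R \<Longrightarrow> y \<in> carrier R \<Longrightarrow> P x \<Longrightarrow> P y \<Longrightarrow> P (x \<oplus> y)"
    and "\<And>n x. x \<in> gr n \<Longrightarrow> P x"
  shows "P x"
proof -
  obtain c where c: "\<forall>n. c n \<in> gr n" "finite {n. c n \<noteq> \<zero>}" "x = (\<Oplus>n\<in>{n. c n \<noteq> \<zero>}. c n)"
    using gr_direct_sum[OF assms(1)] by blast
  have "x \<in> {x \<in> carrier R. P x}"
    unfolding c(3)
  proof (rule finsum_mem)
    show "c n \<in> {x \<in> carrier R. P x}" for n
      using c(1) assms(4)[of "c n" n] gr_carrier[of "c n" n] by blast
  qed (use c(2) assms(2) add in auto)
  then show ?thesis by simp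
qed

text \<open>The family \<open>c\<close>, cut off outside \<open>F\<close>, and the family
  concentrated in degree \<open>k\<close> decompose the same element; uniqueness of homogeneous
  decompositions identifies them.\<close>

lemma homogeneous_component:
  assumes "finite F" "\<And>n. n \<in> F \<Longrightarrow> c n \<in> gr n" "(\<Oplus>n\<in>F. c n) \<in> gr k"
  shows "(\<Oplus>n\<in>F. c n) = (if k \<in> F then c k else \<zero>)"
proof -
  define x where "x = (\<Oplus>n\<in>F. c n)"
  let ?P = "\<lambda>c. (\<forall>n. c n \<in> gr n) \<and> finite {n. c n \<noteq> \<zero>} \<and> x = (\<Oplus>n\<in>{n. c n \<noteq> \<zero>}. c n)"
  let ?c = "\<lambda>n. if n \<in> F then c n else \<zero>" and ?d = "\<lambda>n. if n = k then x else \<zero>"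
  have x: "x \<in> gr k" "x \<in> carrier R" using assms(3) gr_carrier by (auto simp: x_def)
  have sub: "{n. ?c n \<noteq> \<zero>} \<subseteq> F" by auto
  have "(\<Oplus>n\<in>{n. ?c n \<noteq> \<zero>}. ?c n) = (\<Oplus>n\<in>F. c n)"
    using sub assms(1,2) gr_carrier by (intro add.finprod_mono_neutral_cong_left) auto
  then have c: "?P ?c"
    using assms(1,2) gr_zero finite_subset[OF sub] by (auto simp: x_def)
  have "(\<Oplus>n\<in>{n. ?d n \<noteq> \<zero>}. ?d n) = (\<Oplus>n\<in>{k}. ?d n)"
    using x by (intro add.finprod_mono_neutral_cong_left) auto
  moreover have "finite {n. ?d n \<noteq> \<zero>}"
    by (rule finite_subset[of _ "{k}"]) auto
  ultimately have d: "?P ?d"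
    using x gr_zero by auto
  obtain c0 where u: "\<And>c. ?P c \<Longrightarrow> c = c0"
    using gr_direct_sum[OF x(2)] by (elim ex1E) metis
  have "?c = ?d" using u[OF c] u[OF d] by metis
  then have "?c k = ?d k" by (rule fun_cong)
  then show ?thesis by (simp add: x_def)
qed

text \<open>Negatives come for free, as multiples by \<open>\<ominus> \<one>\<close>.\<close>

lemma idealI_mult:
  assumes "D \<subseteq> carrier R" "\<zero> \<in> D" "\<And>x y. x \<in> D \<Longrightarrow> y \<in> D \<Longrightarrow> x \<oplus> y \<in> D"
    and "\<And>x r. x \<in> D \<Longrightarrow> r \<in> carrier R \<Longrightarrow> r \<otimes> x \<in> D" "\<And>x r. x \<in> D \<Longrightarrow> r \<in> carrier R \<Longrightarrow> x \<otimes> r \<in> D"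
  shows "ideal D R"
proof (rule idealI[OF ring_axioms])
  show "subgroup D (add_monoid R)"
  proof (rule add.subgroupI)
    fix x assume "x \<in> D"
    then have "\<ominus> \<one> \<otimes> x \<in> D" using assms(4) by simp
    then show "\<ominus> x \<in> D" using \<open>x \<in> D\<close> assms(1) l_minus by auto
  qed (use assms in auto)
qed (use assms in auto)

text \<open>Finite sums of elements of the \<open>A n\<close> already form an ideal, and comparing
  components recovers \<open>A k\<close>. The intended case is the annihilator of a morphism, which
  is only given degree by degree.\<close>

lemma genideal_graded:
  assumes A: "\<And>n. A n \<subseteq> gr n" "\<And>n. \<zero> \<in> A n" "\<And>n x y. x \<in> A n \<Longrightarrow> y \<in> A n \<Longrightarrow> x \<oplus> y \<in> A n"
    and mult: "\<And>m n r x. r \<in> gr m \<Longrightarrow> x \<in> A n \<Longrightarrow> r \<otimes> x \<in> A (m + n)"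
      "\<And>m n r x. r \<in> gr m \<Longrightarrow> x \<in> A n \<Longrightarrow> x \<otimes> r \<in> A (n + m)"
  shows "Idl (\<Union>n. A n) \<inter> gr k \<subseteq> A k"
proof
  define D where "D = {x. \<exists>c F. finite F \<and> (\<forall>n\<in>F. c n \<in> A n) \<and> x = (\<Oplus>n\<in>F. c n)}"
  have Ac: "x \<in> carrier R" if "x \<in> A n" for x n using that A(1) gr_carrier by blast
  have D_carrier: "D \<subseteq> carrier R"
    using Ac by (auto simp: D_def intro!: finsum_closed)
  have D_single: "x \<in> D" if "x \<in> A n" for x n
    unfolding D_def using that Ac[OF that] by (intro CollectI exI[of _ "\<lambda>_. x"] exI[of _ "{n}"]) auto
  have D_zero: "\<zero> \<in> D" using D_single A(2) by blast
  have D_add: "x \<oplus> y \<in> D" if x: "x \<in> D" and y: "y \<in> D" for x y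
  proof -
    obtain c F where c: "finite F" "\<forall>n\<in>F. c n \<in> A n" "x = (\<Oplus>n\<in>F. c n)"
      using x unfolding D_def by blast
    obtain d G where d: "finite G" "\<forall>n\<in>G. d n \<in> A n" "y = (\<Oplus>n\<in>G. d n)"
      using y unfolding D_def by blast
    have cc: "\<And>n. n \<in> F \<Longrightarrow> c n \<in> carrier R" and dc: "\<And>n. n \<in> G \<Longrightarrow> d n \<in> carrier R"
      using c(2) d(2) Ac by blast+
    let ?c = "\<lambda>n. if n \<in> F then c n else \<zero>" and ?d = "\<lambda>n. if n \<in> G then d n else \<zero>"
    have "x = (\<Oplus>n\<in>F \<union> G. ?c n)"
      unfolding c(3) using c(1) d(1) cc by (intro add.finprod_mono_neutral_cong_left) auto
    moreover have "y = (\<Oplus>n\<in>F \<union> G. ?d n)"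
      unfolding d(3) using d(1) c(1) dc by (intro add.finprod_mono_neutral_cong_left) auto
    moreover have "(\<Oplus>n\<in>F \<union> G. ?c n \<oplus> ?d n) = (\<Oplus>n\<in>F \<union> G. ?c n) \<oplus> (\<Oplus>n\<in>F \<union> G. ?d n)"
      using cc dc by (intro finsum_addf) (auto simp: Pi_def)
    ultimately have "x \<oplus> y = (\<Oplus>n\<in>F \<union> G. ?c n \<oplus> ?d n)" by simp
    moreover have "\<forall>n\<in>F \<union> G. ?c n \<oplus> ?d n \<in> A n"
      using c(2) d(2) A(2,3) by auto
    ultimately show ?thesis
      unfolding D_def using c(1) d(1) by (intro CollectI exI[of _ "\<lambda>n. ?c n \<oplus> ?d n"] exI[of _ "F \<union> G"]) simp
  qed
  have D_mult: "r \<otimes> x \<in> D \<and> x \<otimes> r \<in> D" if "r \<in> carrier R" and x: "x \<in> D" for r x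
    using that(1)
  proof (induction r rule: homogeneous_induct)
    case zero
    then show ?case using D_zero D_carrier x by auto
  next
    case (add r s)
    then show ?case using D_add D_carrier x by (auto simp: l_distr r_distr subset_iff)
  next
    case (hom m r)
    obtain c F where c: "finite F" "\<forall>n\<in>F. c n \<in> A n" "x = (\<Oplus>n\<in>F. c n)"
      using x unfolding D_def by blast
    have r: "r \<in> carrier R" and cn: "c \<in> F \<rightarrow> carrier R" using hom gr_carrier c(2) Ac by auto
    have "(\<Oplus>n\<in>F. r \<otimes> c n) \<in> D"
      by (rule finsum_mem[OF c(1)]) (use D_single mult(1)[OF hom] c(2) D_carrier D_zero D_add in blast)+
    moreover have "(\<Oplus>n\<in>F. c n \<otimes> r) \<in> D"
      by (rule finsum_mem[OF c(1)]) (use D_single mult(2)[OF hom] c(2) D_carrier D_zero D_add in blast)+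
    ultimately show ?case
      using finsum_rdistr[OF c(1) r cn] finsum_ldistr[OF c(1) r cn] c(3) by simp
  qed
  have "ideal D R"
    using D_carrier D_zero D_add D_mult by (intro idealI_mult) auto
  then have "Idl (\<Union>n. A n) \<subseteq> D"
    using D_single by (intro genideal_minimal) auto
  moreover fix x assume x: "x \<in> Idl (\<Union>n. A n) \<inter> gr k"
  ultimately obtain c F where c: "finite F" "\<forall>n\<in>F. c n \<in> A n" "x = (\<Oplus>n\<in>F. c n)"
    unfolding D_def by blast
  have "x = (if k \<in> F then c k else \<zero>)"
    unfolding c(3) by (rule homogeneous_component) (use c x A(1) in auto)
  then show "x \<in> A k" using c(2) A(2) by (auto split: if_splits)
qed

lemma homogeneous_ideal_genideal:
  assumes "S \<subseteq> (\<Union>n. gr n)"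
  shows "homogeneous_ideal R gr (Idl S)"
proof -
  have S: "S \<subseteq> carrier R" using assms gr_carrier by blast
  have I: "ideal (Idl S) R" by (rule genideal_ideal[OF S])
  have "S \<subseteq> Idl S \<inter> (\<Union>n. gr n)" using genideal_self[OF S] assms by blast
  moreover have "Idl S \<inter> (\<Union>n. gr n) \<subseteq> carrier R" using gr_carrier by blast
  ultimately have "Idl S \<subseteq> Idl (Idl S \<inter> (\<Union>n. gr n))"
    by (intro subset_Idl_subset)
  moreover have "Idl (Idl S \<inter> (\<Union>n. gr n)) \<subseteq> Idl S"
    by (rule genideal_minimal[OF I]) blast
  ultimately show ?thesis
    using I unfolding homogeneous_ideal_def by blast
qed

lemma homogeneous_idealD:
  assumes "homogeneous_ideal R gr I"
  shows "ideal I R" "I \<subseteq> carrier R" "I = Idl (I \<inter> (\<Union>n. gr n))"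
  using assms ideal.axioms(1) additive_subgroup.a_subset unfolding homogeneous_ideal_def by blast+

lemma homogeneous_ideal_Union:
  assumes "subset.chain A C" "C \<noteq> {}" "\<And>I. I \<in> A \<Longrightarrow> homogeneous_ideal R gr I"
  shows "homogeneous_ideal R gr (\<Union>C)"
proof -
  have C: "homogeneous_ideal R gr I" if "I \<in> C" for I
    using assms that by (auto simp: subset_chain_def)
  note CD = homogeneous_idealD[OF C]
  have id: "ideal (\<Union>C) R"
  proof (rule idealI_mult)
    show "\<Union>C \<subseteq> carrier R" using CD(2) by blast
    show "\<zero> \<in> \<Union>C"
      using assms(2) additive_subgroup.zero_closed[OF ideal.axioms(1)[OF CD(1)]] by blast
    show "x \<oplus> y \<in> \<Union>C" if xy: "x \<in> \<Union>C" "y \<in> \<Union>C" for x y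
    proof -
      obtain I J where IJ: "I \<in> C" "x \<in> I" "J \<in> C" "y \<in> J" using xy by blast
      then have "I \<subseteq> J \<or> J \<subseteq> I" using assms(1) by (auto simp: subset_chain_def)
      then obtain K where "K \<in> C" "x \<in> K" "y \<in> K" using IJ by blast
      then show ?thesis
        using additive_subgroup.a_closed[OF ideal.axioms(1)[OF CD(1)]] by blast
    qed
  qed (use ideal.I_l_closed[OF CD(1)] ideal.I_r_closed[OF CD(1)] in blast)+
  have "\<Union>C \<subseteq> Idl (\<Union>C \<inter> (\<Union>n. gr n))"
  proof
    fix x assume "x \<in> \<Union>C"
    then obtain I where I: "I \<in> C" "x \<in> I" by blast
    have "\<Union>C \<inter> (\<Union>n. gr n) \<subseteq> carrier R" using gr_carrier by blast
    then have "Idl (I \<inter> (\<Union>n. gr n)) \<subseteq> Idl (\<Union>C \<inter> (\<Union>n. gr n))"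
      using I(1) by (intro subset_Idl_subset) (auto dest: genideal_self')
    then show "x \<in> Idl (\<Union>C \<inter> (\<Union>n. gr n))" using CD(3)[OF I(1)] I(2) by blast
  qed
  moreover have "Idl (\<Union>C \<inter> (\<Union>n. gr n)) \<subseteq> \<Union>C"
    by (rule genideal_minimal[OF id]) blast
  ultimately show ?thesis
    using id unfolding homogeneous_ideal_def by blast
qed

text \<open>The noetherian condition supplies generators that need not be homogeneous. The ideals
  generated by finite sets of homogeneous elements of \<open>p\<close> are directed with union
  \<open>p\<close>, so each generator already lies in one of them.\<close>

lemma homogeneous_generators:
  assumes "graded_noetherian R gr" "homogeneous_ideal R gr p"
  obtains F where "finite F" "F \<subseteq> p \<inter> (\<Union>n. gr n)" "p = Idl F"
proof -
  note p = homogeneous_idealD[OF assms(2)]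
  let ?H = "p \<inter> (\<Union>n. gr n)"
  have H: "?H \<subseteq> carrier R" using p(2) by blast
  define J where "J = (\<Union>F\<in>{F. finite F \<and> F \<subseteq> ?H}. Idl F)"
  have id: "ideal (Idl F) R" if "F \<subseteq> ?H" for F using genideal_ideal that H by blast
  have mono: "Idl F \<subseteq> Idl G" if "F \<subseteq> G" "G \<subseteq> ?H" for F G
    using genideal_minimal[OF id[OF that(2)], of F] genideal_self[of G] that H by blast
  have "ideal J R"
  proof (rule idealI_mult)
    show "J \<subseteq> carrier R"
      using additive_subgroup.a_subset[OF ideal.axioms(1)[OF id]] unfolding J_def by blast
    show "\<zero> \<in> J"
      using additive_subgroup.zero_closed[OF ideal.axioms(1)[OF id[of "{}"]]] unfolding J_def by blast
    show "x \<oplus> y \<in> J" if xy: "x \<in> J" "y \<in> J" for x y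
    proof -
      obtain F G where FG: "finite F" "F \<subseteq> ?H" "x \<in> Idl F" "finite G" "G \<subseteq> ?H" "y \<in> Idl G"
        using xy unfolding J_def by blast
      have U: "F \<union> G \<subseteq> ?H" "finite (F \<union> G)" using FG by auto
      have "x \<in> Idl (F \<union> G)" "y \<in> Idl (F \<union> G)"
        using mono[of F "F \<union> G"] mono[of G "F \<union> G"] FG U by blast+
      then have "x \<oplus> y \<in> Idl (F \<union> G)"
        using additive_subgroup.a_closed[OF ideal.axioms(1)[OF id[OF U(1)]]] by blast
      then show ?thesis unfolding J_def using U by blast
    qed
    fix x r assume x: "x \<in> J" and r: "r \<in> carrier R"
    then obtain F where F: "finite F" "F \<subseteq> ?H" "x \<in> Idl F"
      unfolding J_def by blast
    show "r \<otimes> x \<in> J"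
      unfolding J_def using F ideal.I_l_closed[OF id[OF F(2)] F(3) r] by blast
    show "x \<otimes> r \<in> J"
      unfolding J_def using F ideal.I_r_closed[OF id[OF F(2)] F(3) r] by blast
  qed
  moreover have "?H \<subseteq> J"
  proof
    fix x assume x: "x \<in> ?H"
    then have "x \<in> Idl {x}" using genideal_self'[of x] H by blast
    then show "x \<in> J" unfolding J_def using x by blast
  qed
  ultimately have pJ: "p \<subseteq> J"
    using genideal_minimal[of J ?H] p(3) by blast
  obtain A where A: "A \<subseteq> carrier R" "finite A" "p = Idl A"
    using assms unfolding graded_noetherian_def by blast
  have "\<forall>a\<in>A. \<exists>F. finite F \<and> F \<subseteq> ?H \<and> a \<in> Idl F"
    using genideal_self[OF A(1)] A(3) pJ unfolding J_def by blast
  then obtain F where F: "\<And>a. a \<in> A \<Longrightarrow> finite (F a)" "\<And>a. a \<in> A \<Longrightarrow> F a \<subseteq> ?H" "\<And>a. a \<in> A \<Longrightarrow> a \<in> Idl (F a)"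
    by metis
  let ?F = "\<Union>(F ` A)"
  have sub: "?F \<subseteq> ?H" using F(2) by blast
  have "A \<subseteq> Idl ?F"
    using F(3) mono[OF _ sub] by blast
  then have "p \<subseteq> Idl ?F" using genideal_minimal[OF id[OF sub]] A(3) by blast
  moreover have "Idl ?F \<subseteq> p" using genideal_minimal[OF p(1)] sub by blast
  ultimately show thesis
    using that[of ?F] A(2) F(1) sub by blast
qed

end

context graded_commutative_ring begin

text \<open>Zorn's lemma, followed by the usual argument that a homogeneous ideal maximal among
  those avoiding the powers of \<open>r\<close> is prime. As the ring commutes only up to sign, the
  quotient ideals \<open>?K\<close> and \<open>?L\<close> replace the explicit expansion of a
  product of two powers of \<open>r\<close>.\<close>

lemma homogeneous_prime_avoiding_powers:
  assumes J: "homogeneous_ideal R gr J" and r: "r \<in> gr e" and powers: "\<And>k::nat. r [^] k \<notin> J"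
  obtains q where "q \<in> Spec R gr" "J \<subseteq> q" "r \<notin> q"
proof -
  let ?A = "{I. homogeneous_ideal R gr I \<and> J \<subseteq> I \<and> (\<forall>k::nat. r [^] k \<notin> I)}"
  have rc: "r \<in> carrier R" using r gr_carrier by blast
  have "\<exists>M\<in>?A. \<forall>X\<in>?A. M \<subseteq> X \<longrightarrow> X = M"
  proof (rule subset_Zorn_nonempty)
    show "?A \<noteq> {}" using J powers by blast
    fix C assume C: "C \<noteq> {}" "subset.chain ?A C"
    have CA: "C \<subseteq> ?A" using C(2) by (simp add: subset_chain_def)
    have "homogeneous_ideal R gr (\<Union>C)"
      by (rule homogeneous_ideal_Union[OF C(2,1)]) blast
    moreover have "J \<subseteq> \<Union>C" using C(1) CA by blast
    moreover have "\<forall>k::nat. r [^] k \<notin> \<Union>C" using CA by blast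
    ultimately show "\<Union>C \<in> ?A" by blast
  qed
  then obtain q where qA: "q \<in> ?A" and max: "\<forall>X\<in>?A. q \<subseteq> X \<longrightarrow> X = q"
    by (rule bexE)
  have q: "homogeneous_ideal R gr q" "J \<subseteq> q" "\<And>k::nat. r [^] k \<notin> q"
    using qA by auto
  note qD = homogeneous_idealD[OF q(1)]
  interpret q: ideal q R by (rule qD(1))
  have ext: "\<exists>k::nat. r [^] k \<in> Idl (q \<union> {a})" if a: "a \<in> gr n" "a \<notin> q" for a n
  proof (rule ccontr)
    assume no: "\<not> ?thesis"
    \<comment> \<open>Homogeneous generators make the enlarged ideal homogeneous, as maximality of
      \<open>q\<close> requires.\<close>
    let ?G = "(q \<inter> (\<Union>n. gr n)) \<union> {a}"
    have sub: "q \<union> {a} \<subseteq> carrier R" using qD(2) a(1) gr_carrier by blast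
    have hom: "homogeneous_ideal R gr (Idl ?G)"
      by (rule homogeneous_ideal_genideal) (use a(1) in blast)
    have G: "?G \<subseteq> Idl ?G" by (rule genideal_self) (use sub in blast)
    have "q \<subseteq> Idl ?G"
      using genideal_minimal[OF homogeneous_idealD(1)[OF hom], of "q \<inter> (\<Union>n. gr n)"] qD(3) G by blast
    moreover have "Idl ?G \<subseteq> Idl (q \<union> {a})"
      using genideal_minimal[OF genideal_ideal[OF sub], of ?G] genideal_self[OF sub] by blast
    ultimately have "Idl ?G = q"
      using hom q(2) no by (intro max[rule_format]) auto
    then show False using G a(2) by blast
  qed
  have prime: "a \<in> q \<or> b \<in> q" if a: "a \<in> gr m" and b: "b \<in> gr n" and ab: "a \<otimes> b \<in> q" for a b m n
  proof (rule ccontr)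
    assume no: "\<not> (a \<in> q \<or> b \<in> q)"
    have ac: "a \<in> carrier R" and bc: "b \<in> carrier R" using a b gr_carrier by auto
    obtain k l :: nat where k: "r [^] k \<in> Idl (q \<union> {a})" and l: "r [^] l \<in> Idl (q \<union> {b})"
      using ext a b no by metis
    \<comment> \<open>The factor \<open>y\<close> in the middle makes this a two-sided ideal. It
      contains \<open>q\<close> and \<open>a\<close>, hence the power \<open>r [^] k\<close>; then
      \<open>?L\<close> does the same for \<open>b\<close> and \<open>r [^] l\<close>.\<close>
    let ?K = "{x \<in> carrier R. \<forall>y\<in>carrier R. x \<otimes> y \<otimes> b \<in> q}"
    have "ideal ?K R"
    proof (rule idealI_mult)
      show "x \<oplus> y \<in> ?K" if "x \<in> ?K" "y \<in> ?K" for x y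
        using that bc by (auto simp: l_distr q.a_closed)
      show "s \<otimes> x \<in> ?K" if "x \<in> ?K" "s \<in> carrier R" for x s
        using that bc q.I_l_closed by (auto simp: m_assoc)
      show "x \<otimes> s \<in> ?K" if "x \<in> ?K" "s \<in> carrier R" for x s
        using that bc m_assoc[of x s] by auto
    qed (use bc in auto)
    moreover have "q \<subseteq> ?K" using qD(2) q.I_r_closed bc by auto
    \<comment> \<open>For homogeneous \<open>y\<close> the sign rule moves \<open>y\<close> to the
      front of \<open>a \<otimes> b\<close>; the general case follows by additivity.\<close>
    moreover have "a \<otimes> y \<otimes> b \<in> q" if "y \<in> carrier R" for y
      using that
    proof (induction y rule: homogeneous_induct)
      case (hom i y)
      have yc: "y \<in> carrier R" using hom gr_carrier by blast
      have yab: "y \<otimes> a \<otimes> b \<in> q" using q.I_l_closed[OF ab yc] yc ac bc by (simp add: m_assoc)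
      have "a \<otimes> y = y \<otimes> a \<or> a \<otimes> y = \<ominus> (y \<otimes> a)"
        using graded_comm[OF a hom] by (auto split: if_splits)
      then show ?case
        using yab q.a_inv_closed[OF yab] l_minus[of "y \<otimes> a" b] yc ac bc by auto
    qed (use ac bc q.a_closed in \<open>auto simp: l_distr r_distr\<close>)
    then have "a \<in> ?K" using ac by blast
    ultimately have "r [^] k \<in> ?K"
      using genideal_minimal[of ?K "q \<union> {a}"] k by blast
    then have rk: "\<And>y. y \<in> carrier R \<Longrightarrow> r [^] k \<otimes> y \<otimes> b \<in> q" by blast
    let ?L = "{z \<in> carrier R. \<forall>y\<in>carrier R. r [^] k \<otimes> y \<otimes> z \<in> q}"
    have rkc: "r [^] k \<in> carrier R" using rc by simp
    have "ideal ?L R"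
    proof (rule idealI_mult)
      show "x \<oplus> y \<in> ?L" if "x \<in> ?L" "y \<in> ?L" for x y
        using that rkc by (auto simp: r_distr q.a_closed)
      show "s \<otimes> x \<in> ?L" if "x \<in> ?L" "s \<in> carrier R" for x s
      proof -
        have "r [^] k \<otimes> y \<otimes> (s \<otimes> x) = r [^] k \<otimes> (y \<otimes> s) \<otimes> x" if "y \<in> carrier R" for y
          using that \<open>x \<in> ?L\<close> \<open>s \<in> carrier R\<close> rkc by (simp add: m_assoc)
        then show ?thesis using that by auto
      qed
      show "x \<otimes> s \<in> ?L" if "x \<in> ?L" "s \<in> carrier R" for x s
      proof -
        have "r [^] k \<otimes> y \<otimes> (x \<otimes> s) = (r [^] k \<otimes> y \<otimes> x) \<otimes> s" if "y \<in> carrier R" for y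
          using that \<open>x \<in> ?L\<close> \<open>s \<in> carrier R\<close> rkc by (simp add: m_assoc)
        then show ?thesis using that q.I_r_closed by auto
      qed
    qed (use rkc in auto)
    moreover have "q \<union> {b} \<subseteq> ?L" using rk bc qD(2) q.I_l_closed rkc by auto
    ultimately have "r [^] l \<in> ?L"
      using genideal_minimal[of ?L "q \<union> {b}"] l by blast
    then have "r [^] k \<otimes> \<one> \<otimes> r [^] l \<in> q" by blast
    then have "r [^] (k + l) \<in> q" using rc by (simp add: nat_pow_mult)
    then show False using q(3) by blast
  qed
  have "q \<noteq> carrier R" using q(3)[of 0] by auto
  then have "q \<in> Spec R gr"
    unfolding Spec_def using q(1) prime by blast
  moreover have "r \<notin> q" using q(3)[of 1] rc by simp
  ultimately show thesis using that q(2) by blast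
qed

lemma Spec_ideal: "p \<in> Spec R gr \<Longrightarrow> homogeneous_ideal R gr p"
  by (simp add: Spec_def)

lemma Spec_prime: "p \<in> Spec R gr \<Longrightarrow> s \<in> gr m - p \<Longrightarrow> t \<in> gr n - p \<Longrightarrow> s \<otimes> t \<in> gr (m + n) - p"
  using gr_mult unfolding Spec_def by blast

lemma Spec_one:
  assumes "p \<in> Spec R gr"
  shows "\<one> \<in> gr 0 - p"
proof -
  have "ideal p R" "p \<noteq> carrier R" using assms by (auto simp: Spec_def homogeneous_ideal_def)
  then show ?thesis using ideal.one_imp_carrier gr_one by blast
qed

end

section \<open>The action of the ring\<close>

text \<open>A fraction is zero exactly if its numerator is killed by some homogeneous element
  outside \<open>p\<close>. Conversely, if all numerators are killed in this way, any two fractions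
  of the same degree are related.\<close>

lemma (in graded_commutative_ring) localization_vanishes_iff:
  assumes p: "p \<in> Spec R gr"
    and z: "\<And>n. z n \<in> M n"
    and act_one: "\<And>n x. x \<in> M n \<Longrightarrow> act 0 \<one> n x = x"
    and act_zero: "\<And>m n r. r \<in> gr m \<Longrightarrow> act m r n (z n) = z (m + n)"
    and act_mult: "\<And>m n k r s x. r \<in> gr m \<Longrightarrow> s \<in> gr n \<Longrightarrow> x \<in> M k \<Longrightarrow>
      act (m + n) (r \<otimes> s) k x = act m r (n + k) (act n s k x)"
  shows "localization_vanishes R gr p M z act \<longleftrightarrow>
    (\<forall>n. \<forall>x\<in>M n. \<exists>m. \<exists>s \<in> gr m - p. act m s n x = z (m + n))"
    (is "_ \<longleftrightarrow> ?R")
proof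
  let ?rel = "fraction_rel R gr p M act" and ?fr = "fractions gr p M"
  have one: "\<one> \<in> gr 0 - p" by (rule Spec_one[OF p])
  have fr1: "(0, x, \<one>) \<in> ?fr n" if "x \<in> M n" for x n
    using one that by (simp add: fractions_def)
  show ?R if van: "localization_vanishes R gr p M z act"
  proof (intro allI ballI)
    fix n x assume x: "x \<in> M n"
    have "?rel n `` {(0, x, \<one>)} \<in> ?fr n // ?rel n"
      using fr1[OF x] by (rule quotientI)
    then have eq: "?rel n `` {(0, x, \<one>)} = ?rel n `` {(0, z n, \<one>)}"
      using van unfolding localization_vanishes_def homogeneous_localization_def by simp
    have "\<exists>i j. \<exists>a \<in> gr i. \<exists>b \<in> gr j. i + 0 = j + 0 \<and> a \<otimes> \<one> = b \<otimes> \<one> \<and> a \<otimes> \<one> \<notin> p \<and>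
        act i a (n + 0) x = act j b (n + 0) x"
      using one by (intro exI[of _ 0] bexI[of _ \<one>]) auto
    then have "((0, x, \<one>), (0, x, \<one>)) \<in> ?rel n"
      unfolding fraction_rel_def using fr1[OF x] by simp
    then have "((0, z n, \<one>), (0, x, \<one>)) \<in> ?rel n" using eq by blast
    then obtain i j a b where ab: "a \<in> gr i" "b \<in> gr j" "i = j" "a \<otimes> \<one> = b \<otimes> \<one>" "a \<otimes> \<one> \<notin> p"
      "act i a n (z n) = act j b n x"
      unfolding fraction_rel_def by auto
    then have "a = b" "a \<notin> p" using gr_carrier by auto
    then show "\<exists>m. \<exists>s \<in> gr m - p. act m s n x = z (m + n)"
      using ab act_zero[OF ab(1), of n] by (intro exI[of _ j] bexI[of _ b]) auto
  qed
  show "localization_vanishes R gr p M z act" if kill: ?R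
  proof -
    have rel: "((k, x, s), (l, y, t)) \<in> ?rel n"
      if xs: "(k, x, s) \<in> ?fr n" and yt: "(l, y, t) \<in> ?fr n" for k x s l y t n
    proof -
      have s: "s \<in> gr k - p" "x \<in> M (n + k)" and t: "t \<in> gr l - p" "y \<in> M (n + l)"
        using xs yt by (auto simp: fractions_def)
      obtain a0 u where u: "u \<in> gr a0 - p" "act a0 u (n + k) x = z (a0 + (n + k))"
        using kill s(2) by blast
      obtain b0 v where v: "v \<in> gr b0 - p" "act b0 v (n + l) y = z (b0 + (n + l))"
        using kill t(2) by blast
      note us = Spec_prime[OF p u(1) s(1)] and vt = Spec_prime[OF p v(1) t(1)]
      have c: "s \<in> carrier R" "t \<in> carrier R" "u \<in> carrier R" "v \<in> carrier R"
        using s(1) t(1) u(1) v(1) gr_carrier by auto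
      \<comment> \<open>The common denominator is
        \<open>(v \<otimes> t) \<otimes> (u \<otimes> s)\<close>. Written as a multiple of
        \<open>t\<close> its factors change places, and \<open>w\<close> absorbs the sign; both
        expanded numerators vanish because \<open>u\<close> kills \<open>x\<close> and
        \<open>v\<close> kills \<open>y\<close>.\<close>
      define w where "w = (if even ((b0 + l) * (a0 + k)) then u \<otimes> s else \<ominus> (u \<otimes> s))"
      have w: "w \<in> gr (a0 + k)" "w \<in> carrier R" using us gr_neg gr_carrier by (auto simp: w_def)
      have "(v \<otimes> t) \<otimes> (u \<otimes> s) = w \<otimes> (v \<otimes> t)"
        using graded_comm[of "v \<otimes> t" "b0 + l" "u \<otimes> s" "a0 + k"] us vt c l_minus[of "u \<otimes> s" "v \<otimes> t"]
        by (auto simp: w_def)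
      then have eq: "((v \<otimes> t) \<otimes> u) \<otimes> s = (w \<otimes> v) \<otimes> t"
        using c w by (simp add: m_assoc)
      have notin: "((v \<otimes> t) \<otimes> u) \<otimes> s \<notin> p"
        using Spec_prime[OF p vt us] c by (simp add: m_assoc)
      have a: "(v \<otimes> t) \<otimes> u \<in> gr ((b0 + l) + a0)" and b: "w \<otimes> v \<in> gr ((a0 + k) + b0)"
        using gr_mult vt u w(1) v by auto
      have "act ((b0 + l) + a0) ((v \<otimes> t) \<otimes> u) (n + k) x = z ((b0 + l) + (a0 + (n + k)))"
        using act_mult[of "v \<otimes> t" "b0 + l" u a0 x "n + k"] vt u s(2) act_zero[of "v \<otimes> t" "b0 + l"] by simp
      moreover have "act ((a0 + k) + b0) (w \<otimes> v) (n + l) y = z ((a0 + k) + (b0 + (n + l)))"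
        using act_mult[of w "a0 + k" v b0 y "n + l"] v w t(2) act_zero[of w "a0 + k"] by simp
      moreover have "(b0 + l) + (a0 + (n + k)) = (a0 + k) + (b0 + (n + l))" by simp
      ultimately have act: "act ((b0 + l) + a0) ((v \<otimes> t) \<otimes> u) (n + k) x = act ((a0 + k) + b0) (w \<otimes> v) (n + l) y"
        by metis
      have deg: "(b0 + l) + a0 + k = (a0 + k) + b0 + l" by simp
      show ?thesis
        unfolding fraction_rel_def using xs yt a b eq notin act deg by blast
    qed
    have "?rel n `` {e} = ?fr n" if "e \<in> ?fr n" for e n
    proof
      show "?rel n `` {e} \<subseteq> ?fr n" by (auto simp: fraction_rel_def)
      show "?fr n \<subseteq> ?rel n `` {e}" using rel that by (cases e) auto
    qed
    then have "?fr n // ?rel n = {?rel n `` {(0, z n, \<one>)}}" for n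
      using fr1[OF z] unfolding quotient_def by blast
    then show ?thesis
      by (simp add: localization_vanishes_def homogeneous_localization_def)
  qed
qed

context suspended_category begin

lemma shift_id: "X \<in> Obj T \<Longrightarrow> shiftM T n (Idn T X) = Idn T (shiftO T n X)"
proof (rule int_bi_induct[of _ n])
  show "shiftM T n (Idn T X) = Idn T (shiftO T n X) \<longleftrightarrow> shiftM T (n + 1) (Idn T X) = Idn T (shiftO T (n + 1) X)"
    if "X \<in> Obj T" for n
    using that susp_inj[of "shiftM T n (Idn T X)" "Idn T (shiftO T n X)"]
    by (simp add: shiftM_step shiftO_step susp_id[symmetric])
qed simp

end

locale linear_triangulated = triangulated_category T + graded_commutative_ring R gr
  for T :: "('o, 'm) tricat" (structure) and R :: "('r, 'b) ring_scheme" and gr +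
  fixes \<kappa> :: "'i rel" and \<phi> :: "int \<Rightarrow> 'r \<Rightarrow> 'o \<Rightarrow> 'm"
  assumes linear: "linear_structure R gr T \<phi>"
begin

lemma \<phi>_hom: "s \<in> gr d \<Longrightarrow> X \<in> Obj T \<Longrightarrow> \<phi> d s X \<in> Hom T X (shiftO T d X)"
  using linear unfolding linear_structure_def graded_center_def by blast

lemma \<phi>_arr [simp]:
  assumes "s \<in> gr d" "X \<in> Obj T"
  shows "\<phi> d s X \<in> Mor T" "Dom T (\<phi> d s X) = X" "Cod T (\<phi> d s X) = shiftO T d X"
  using \<phi>_hom[OF assms] by (auto simp: Hom_def)

lemma \<phi>_natural: "s \<in> gr d \<Longrightarrow> f \<in> Hom T X Y \<Longrightarrow> shiftM T d f \<cdot> \<phi> d s X = \<phi> d s Y \<cdot> f"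
  using linear hom_obj[of f X Y] unfolding linear_structure_def graded_center_def by blast

text \<open>The parity that decides the sign is dropped on purpose: later only the vanishing of
  composites matters, and a sign does not affect it.\<close>

lemma \<phi>_susp:
  assumes "s \<in> gr d" "X \<in> Obj T"
  shows "\<phi> d s (SuspO T X) = SuspM T (\<phi> d s X) \<or> \<phi> d s (SuspO T X) = Neg T (SuspM T (\<phi> d s X))"
proof -
  have "\<phi> d s \<in> graded_center T d"
    using linear assms unfolding linear_structure_def by blast
  then show ?thesis using assms(2) by (auto simp: graded_center_def)
qed

lemma \<phi>_add: "r \<in> gr n \<Longrightarrow> s \<in> gr n \<Longrightarrow> X \<in> Obj T \<Longrightarrow> \<phi> n (r \<oplus>\<^bsub>R\<^esub> s) X = Add T (\<phi> n r X) (\<phi> n s X)"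
  using linear unfolding linear_structure_def by blast

lemma \<phi>_mult: "r \<in> gr m \<Longrightarrow> s \<in> gr n \<Longrightarrow> X \<in> Obj T \<Longrightarrow>
    \<phi> (m + n) (r \<otimes>\<^bsub>R\<^esub> s) X = shiftM T n (\<phi> m r X) \<cdot> \<phi> n s X"
  using linear unfolding linear_structure_def by blast

lemma \<phi>_one: "X \<in> Obj T \<Longrightarrow> \<phi> 0 \<one>\<^bsub>R\<^esub> X = Idn T X"
  using linear unfolding linear_structure_def by blast

lemma \<phi>_zero:
  assumes "X \<in> Obj T"
  shows "\<phi> n \<zero>\<^bsub>R\<^esub> X = Zer T X (shiftO T n X)"
  using add_idem_zer[OF \<phi>_hom[OF gr_zero assms]] \<phi>_add[OF gr_zero gr_zero assms, of n] by simp

lemma \<phi>_shift: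
  assumes s: "s \<in> gr d" and X: "X \<in> Obj T"
  shows "\<phi> d s (shiftO T n X) = shiftM T n (\<phi> d s X) \<or> \<phi> d s (shiftO T n X) = Neg T (shiftM T n (\<phi> d s X))"
proof (rule int_bi_induct[of _ n])
  fix n
  let ?Y = "shiftO T n X"
  have Y: "?Y \<in> Obj T" using X by simp
  have eq: "shiftO T d ?Y = shiftO T n (shiftO T d X)" using X by (simp add: shiftO_shiftO add.commute)
  let ?f = "\<phi> d s ?Y" and ?g = "shiftM T n (\<phi> d s X)"
  have f: "?f \<in> Hom T ?Y (shiftO T d ?Y)" by (rule \<phi>_hom[OF s Y])
  have g: "?g \<in> Hom T ?Y (shiftO T d ?Y)" unfolding eq by (rule shift_hom[OF \<phi>_hom[OF s X]])
  have step: "\<phi> d s (shiftO T (n + 1) X) = SuspM T ?f \<or> \<phi> d s (shiftO T (n + 1) X) = Neg T (SuspM T ?f)"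
    using \<phi>_susp[OF s Y] X by (simp add: shiftO_step)
  have gs: "shiftM T (n + 1) (\<phi> d s X) = SuspM T ?g"
    using s X by (simp add: shiftM_step)
  have n: "SuspM T (Neg T ?g) = Neg T (SuspM T ?g)" "SuspM T (Neg T ?f) = Neg T (SuspM T ?f)"
    using susp_neg f g by auto
  have nn: "Neg T (Neg T (SuspM T ?g)) = SuspM T ?g" "Neg T (Neg T (SuspM T ?f)) = SuspM T ?f"
    "Neg T (Neg T ?f) = ?f" "Neg T (Neg T ?g) = ?g"
    using neg_neg susp_hom f g by blast+
  have mor: "?f \<in> Mor T" "?g \<in> Mor T" "Neg T ?g \<in> Mor T" using f g by (auto simp: Hom_def)
  have inj: "?f = ?g \<longleftrightarrow> SuspM T ?f = SuspM T ?g" "?f = Neg T ?g \<longleftrightarrow> SuspM T ?f = Neg T (SuspM T ?g)"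
    using susp_inj[OF mor(1,2)] susp_inj[OF mor(1,3)] n(1) by auto
  show "(?f = ?g \<or> ?f = Neg T ?g) \<longleftrightarrow> (\<phi> d s (shiftO T (n + 1) X) = shiftM T (n + 1) (\<phi> d s X) \<or>
      \<phi> d s (shiftO T (n + 1) X) = Neg T (shiftM T (n + 1) (\<phi> d s X)))"
    unfolding gs inj using step nn by metis
qed simp

text \<open>Annihilation in the graded module of maps. Source and target are read off from
  \<open>f\<close>, so the predicate also applies to shifted objects. The degree is an argument
  because zero is homogeneous of every degree.\<close>

definition kills :: "int \<Rightarrow> 'r \<Rightarrow> 'm \<Rightarrow> bool" where
  "kills d s f \<longleftrightarrow> \<phi> d s (Cod T f) \<cdot> f = Zer T (Dom T f) (shiftO T d (Cod T f))"

lemma kills_iff: "f \<in> Hom T A B \<Longrightarrow> kills d s f \<longleftrightarrow> \<phi> d s B \<cdot> f = Zer T A (shiftO T d B)"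
  by (auto simp: kills_def Hom_def)

lemma kills_iff': "s \<in> gr d \<Longrightarrow> f \<in> Hom T A B \<Longrightarrow> kills d s f \<longleftrightarrow> shiftM T d f \<cdot> \<phi> d s A = Zer T A (shiftO T d B)"
  using kills_iff \<phi>_natural by simp

lemma kills_shift:
  assumes s: "s \<in> gr d" and f: "f \<in> Hom T A B"
  shows "kills d s (shiftM T n f) \<longleftrightarrow> kills d s f"
proof -
  note o = hom_obj[OF f] and \<phi>B = \<phi>_hom[OF s hom_obj(2)[OF f]]
  let ?z = "Zer T (shiftO T n A) (shiftO T d (shiftO T n B))"
  have eq: "shiftO T d (shiftO T n B) = shiftO T n (shiftO T d B)" using o by (simp add: shiftO_shiftO add.commute)
  have c: "shiftM T n (\<phi> d s B) \<cdot> shiftM T n f = shiftM T n (\<phi> d s B \<cdot> f)"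
    using shift_comp[OF f \<phi>B] by simp
  have h: "shiftM T n (\<phi> d s B \<cdot> f) \<in> Hom T (shiftO T n A) (shiftO T d (shiftO T n B))"
    unfolding eq by (rule shift_hom[OF comp_hom[OF f \<phi>B]])
  have "Neg T (shiftM T n (\<phi> d s B)) \<cdot> shiftM T n f = Neg T (shiftM T n (\<phi> d s B \<cdot> f))"
    using comp_neg(2)[OF shift_hom[OF f] shift_hom[OF \<phi>B]] c by simp
  then have "kills d s (shiftM T n f) \<longleftrightarrow> shiftM T n (\<phi> d s B \<cdot> f) = ?z"
    using \<phi>_shift[OF s o(2), of n] kills_iff[OF shift_hom[OF f]] c neg_eq_zer[OF h] neg_zer o
    by (metis shift_obj)
  also have "?z = shiftM T n (Zer T A (shiftO T d B))"
    using eq o by simp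
  also have "shiftM T n (\<phi> d s B \<cdot> f) = \<dots> \<longleftrightarrow> \<phi> d s B \<cdot> f = Zer T A (shiftO T d B)"
  proof -
    have "\<phi> d s B \<cdot> f \<in> Mor T" "Zer T A (shiftO T d B) \<in> Mor T"
      using comp_hom[OF f \<phi>B] o by (auto simp: Hom_def)
    then show ?thesis using shift_inj by metis
  qed
  finally show ?thesis using kills_iff[OF f] by simp
qed

lemma kills_post:
  assumes s: "s \<in> gr d" and f: "f \<in> Hom T A B" and g: "g \<in> Hom T B C" and k: "kills d s f"
  shows "kills d s (g \<cdot> f)"
proof -
  note o = hom_obj(2)[OF f] hom_obj(2)[OF g] hom_obj(1)[OF f]
  have "\<phi> d s C \<cdot> (g \<cdot> f) = shiftM T d g \<cdot> (\<phi> d s B \<cdot> f)"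
    using comp_assoc[OF f g \<phi>_hom[OF s o(2)]] \<phi>_natural[OF s g]
      comp_assoc[OF f \<phi>_hom[OF s o(1)] shift_hom[OF g]] by simp
  then show ?thesis
    using k g o unfolding kills_iff[OF f] kills_iff[OF comp_hom[OF f g]] by (auto simp: Hom_def)
qed

lemma kills_pre:
  assumes s: "s \<in> gr d" and f: "f \<in> Hom T A B" and g: "g \<in> Hom T B C" and k: "kills d s g"
  shows "kills d s (g \<cdot> f)"
  using k comp_assoc[OF f g \<phi>_hom[OF s hom_obj(2)[OF g]]] f g hom_obj[OF g]
  unfolding kills_iff[OF g] kills_iff[OF comp_hom[OF f g]] by (auto simp: Hom_def)

lemma kills_zero_ring: "f \<in> Hom T A B \<Longrightarrow> kills n \<zero>\<^bsub>R\<^esub> f"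
  using hom_obj[of f A B] by (simp add: kills_iff \<phi>_zero Hom_def)

lemma kills_add_ring:
  assumes "r \<in> gr n" "s \<in> gr n" "f \<in> Hom T A B" "kills n r f" "kills n s f"
  shows "kills n (r \<oplus>\<^bsub>R\<^esub> s) f"
proof -
  note o = hom_obj[OF assms(3)]
  show ?thesis
    using assms(4,5) comp_add_left[OF assms(3) \<phi>_hom[OF assms(1) o(2)] \<phi>_hom[OF assms(2) o(2)]] o
      add_zer(1)[OF hom_zer[OF o(1)], of "shiftO T n B"]
    unfolding kills_iff[OF assms(3)] \<phi>_add[OF assms(1,2) o(2)] by simp
qed

text \<open>Naturality of \<open>\<phi> n s\<close> along \<open>\<phi> m r B\<close> allows the
  factors to act in either order without a sign. Hence a product kills whatever one of its factors
  kills.\<close>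

lemma \<phi>_mult_comp:
  assumes "r \<in> gr m" "s \<in> gr n" "f \<in> Hom T A B"
  shows "\<phi> (m + n) (r \<otimes>\<^bsub>R\<^esub> s) B \<cdot> f = shiftM T n (\<phi> m r B) \<cdot> (\<phi> n s B \<cdot> f)"
    "\<phi> (m + n) (r \<otimes>\<^bsub>R\<^esub> s) B \<cdot> f = \<phi> n s (shiftO T m B) \<cdot> (\<phi> m r B \<cdot> f)"
proof -
  note B = hom_obj(2)[OF assms(3)]
  note h = \<phi>_hom[OF assms(1) B] \<phi>_hom[OF assms(2) B]
  have B': "shiftO T m B \<in> Obj T" using B by simp
  show "\<phi> (m + n) (r \<otimes>\<^bsub>R\<^esub> s) B \<cdot> f = shiftM T n (\<phi> m r B) \<cdot> (\<phi> n s B \<cdot> f)"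
    using \<phi>_mult[OF assms(1,2) B] comp_assoc[OF assms(3) h(2) shift_hom[OF h(1)]] by simp
  show "\<phi> (m + n) (r \<otimes>\<^bsub>R\<^esub> s) B \<cdot> f = \<phi> n s (shiftO T m B) \<cdot> (\<phi> m r B \<cdot> f)"
    using \<phi>_mult[OF assms(1,2) B] \<phi>_natural[OF assms(2) h(1)]
      comp_assoc[OF assms(3) h(1) \<phi>_hom[OF assms(2) B']] by simp
qed

lemma kills_mult:
  assumes "r \<in> gr m" "s \<in> gr n" "f \<in> Hom T A B"
  shows "kills n s f \<Longrightarrow> kills (m + n) (r \<otimes>\<^bsub>R\<^esub> s) f" "kills m r f \<Longrightarrow> kills (m + n) (r \<otimes>\<^bsub>R\<^esub> s) f"
proof -
  note o = hom_obj[OF assms(3)]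
  show "kills (m + n) (r \<otimes>\<^bsub>R\<^esub> s) f" if "kills n s f"
    using that o assms(1) \<phi>_mult_comp(1)[OF assms] unfolding kills_iff[OF assms(3)]
    by (simp add: shiftO_shiftO add.commute)
  show "kills (m + n) (r \<otimes>\<^bsub>R\<^esub> s) f" if "kills m r f"
    using that o assms(2) \<phi>_mult_comp(2)[OF assms] unfolding kills_iff[OF assms(3)]
    by (simp add: shiftO_shiftO add.commute)
qed

lemma kills_add:
  assumes "s \<in> gr d" "f \<in> Hom T A B" "g \<in> Hom T A B" "kills d s f" "kills d s g"
  shows "kills d s (Add T f g)"
proof -
  note o = hom_obj[OF assms(2)]
  have "shiftO T d B \<in> Obj T" using o by simp
  then show ?thesis
    using assms(4,5) comp_add_right[OF assms(2,3) \<phi>_hom[OF assms(1) o(2)]] add_zer(1)[OF hom_zer[OF o(1)]]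
    unfolding kills_iff[OF assms(2)] kills_iff[OF assms(3)] kills_iff[OF hom_add[OF assms(2,3)]] by simp
qed

lemma kills_zer: "s \<in> gr d \<Longrightarrow> A \<in> Obj T \<Longrightarrow> B \<in> Obj T \<Longrightarrow> kills d s (Zer T A B)"
  by (simp add: kills_def)

text \<open>Since \<open>s\<close> kills \<open>g \<cdot> a\<close>, the product of \<open>s\<close>
  with \<open>a\<close> lifts along \<open>f\<close> to a map \<open>b\<close> of shifted degree.
  Annihilating \<open>f \<cdot> b\<close> by \<open>t\<close> then annihilates \<open>a\<close> by
  \<open>t\<close> times \<open>s\<close>; this devissage drives all statements about
  extensions.\<close>

lemma kills_extension:
  assumes s: "s \<in> gr m" and tri: "exact_triangle T X Y Z f g h" and a: "a \<in> Hom T D Y"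
    and ga: "kills m s (g \<cdot> a)"
  obtains b where "b \<in> Hom T (shiftO T (- m) D) X"
    "\<And>n t. t \<in> gr n \<Longrightarrow> kills n t (f \<cdot> b) \<Longrightarrow> kills (n + m) (t \<otimes>\<^bsub>R\<^esub> s) a"
proof -
  note E = exactD[OF tri] and D = hom_obj(1)[OF a]
  have sa: "\<phi> m s Y \<cdot> a \<in> Hom T D (shiftO T m Y)" using comp_hom[OF a \<phi>_hom[OF s E(2)]] .
  have "shiftM T m g \<cdot> (\<phi> m s Y \<cdot> a) = \<phi> m s Z \<cdot> (g \<cdot> a)"
    using comp_assoc[OF a \<phi>_hom[OF s E(2)] shift_hom[OF E(5)]] \<phi>_natural[OF s E(5)]
      comp_assoc[OF a E(5) \<phi>_hom[OF s E(3)]] by simp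
  then have "shiftM T m g \<cdot> (\<phi> m s Y \<cdot> a) = Zer T D (shiftO T m Z)"
    using ga kills_iff[OF comp_hom[OF a E(5)]] by simp
  then obtain c where c: "c \<in> Hom T D (shiftO T m X)" "\<phi> m s Y \<cdot> a = shiftM T m f \<cdot> c"
    using shift_lift[OF tri sa] by blast
  obtain b where b: "b \<in> Hom T (shiftO T (- m) D) X" "c = shiftM T m b"
    using shift_adjunct[OF c(1) E(1)] by blast
  have fb: "f \<cdot> b \<in> Hom T (shiftO T (- m) D) Y" using comp_hom[OF b(1) E(4)] .
  show thesis
  proof (rule that[OF b(1)])
    fix n t assume t: "t \<in> gr n" and k: "kills n t (f \<cdot> b)"
    have "\<phi> (n + m) (t \<otimes>\<^bsub>R\<^esub> s) Y \<cdot> a = shiftM T m (\<phi> n t Y) \<cdot> shiftM T m (f \<cdot> b)"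
      using \<phi>_mult_comp(1)[OF t s a] c(2) b shift_comp[OF b(1) E(4), of m] by simp
    also have "\<dots> = shiftM T m (\<phi> n t Y \<cdot> (f \<cdot> b))"
      using shift_comp[OF fb \<phi>_hom[OF t E(2)]] by simp
    also have "\<dots> = Zer T D (shiftO T (n + m) Y)"
      using k D E(2) unfolding kills_iff[OF fb] by (simp add: shiftO_shiftO add.commute)
    finally show "kills (n + m) (t \<otimes>\<^bsub>R\<^esub> s) a" using kills_iff[OF a] by simp
  qed
qed

text \<open>Multiplication by \<open>r\<close> on its own cone need not vanish, but its square does.\<close>

lemma kills_cone:
  assumes r: "r \<in> gr d" and t: "exact_triangle T Y (shiftO T d Y) W (\<phi> d r Y) g h" and a: "a \<in> Hom T D W"
  shows "kills (d + d) (r \<otimes>\<^bsub>R\<^esub> r) a"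
proof -
  note E = exactD[OF t]
  \<comment> \<open>Up to shift and sign, \<open>r\<close> is the first map of the triangle. As
    consecutive maps compose to zero, \<open>r\<close> kills both \<open>h\<close> and
    \<open>g\<close>, and \<open>kills_extension\<close> multiplies the two annihilators.\<close>
  have "kills d r h"
  proof -
    have z: "Neg T (SuspM T (\<phi> d r Y)) \<cdot> h = Zer T W (SuspO T (shiftO T d Y))"
      using tri_comp_zer[OF rotate[OF rotate[OF t]]] .
    have eq: "SuspO T (shiftO T d Y) = shiftO T d (SuspO T Y)"
      using E(1) by (simp add: susp_eq_shift shiftO_shiftO add.commute)
    have "Neg T (SuspM T (\<phi> d r Y) \<cdot> h) = Zer T W (SuspO T (shiftO T d Y))"
      using z comp_neg(2)[OF E(6) susp_hom[OF E(4)]] by simp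
    then have "SuspM T (\<phi> d r Y) \<cdot> h = Zer T W (SuspO T (shiftO T d Y))"
      using neg_eq_zer[OF comp_hom[OF E(6) susp_hom[OF E(4)]]] by blast
    then have "\<phi> d r (SuspO T Y) \<cdot> h = Zer T W (shiftO T d (SuspO T Y))"
      using \<phi>_susp[OF r E(1)] z eq by auto
    then show ?thesis using kills_iff[OF E(6)] by blast
  qed
  then have "kills d r (h \<cdot> a)" using kills_pre[OF r a E(6)] by blast
  then obtain b where b: "b \<in> Hom T (shiftO T (- d) D) (shiftO T d Y)"
    "kills d r (g \<cdot> b) \<Longrightarrow> kills (d + d) (r \<otimes>\<^bsub>R\<^esub> r) a"
    using kills_extension[OF r rotate[OF t] a] r by metis
  have "kills d r g"
  proof -
    have eq: "shiftM T d (\<phi> d r Y) = \<phi> d r (shiftO T d Y) \<or> shiftM T d (\<phi> d r Y) = Neg T (\<phi> d r (shiftO T d Y))"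
      using \<phi>_shift[OF r E(1), of d] neg_neg[OF shift_hom[OF E(4)]] by metis
    note Y' = \<phi>_hom[OF r E(2)]
    have z: "shiftM T d g \<cdot> shiftM T d (\<phi> d r Y) = Zer T (shiftO T d Y) (shiftO T d W)"
      using shift_comp[OF E(4,5), of d] tri_comp_zer[OF t] E by simp
    have "shiftM T d g \<cdot> Neg T (\<phi> d r (shiftO T d Y)) = Neg T (shiftM T d g \<cdot> \<phi> d r (shiftO T d Y))"
      using comp_neg(1)[OF Y' shift_hom[OF E(5)]] .
    then have "shiftM T d g \<cdot> \<phi> d r (shiftO T d Y) = Zer T (shiftO T d Y) (shiftO T d W)"
      using eq z neg_eq_zer[OF comp_hom[OF Y' shift_hom[OF E(5)]]] by auto
    then show ?thesis using kills_iff'[OF r E(5)] by blast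
  qed
  then show ?thesis using kills_pre[OF r b(1) E(5)] b(2) by blast
qed

end

section \<open>Torsion objects\<close>

context linear_triangulated begin

definition compact_shifts :: "'o set" where
  "compact_shifts = {shiftO T n C | n C. compact_object \<kappa> T C}"

text \<open>Letting the source run through all shifts of \<open>C\<close>, instead of the target through the components of
  the graded module, removes degrees and signs from the torsion condition.\<close>

definition torsion_at :: "'r set \<Rightarrow> 'o set" where
  "torsion_at p = {X \<in> Obj T. \<forall>D\<in>compact_shifts. \<forall>f\<in>Hom T D X. \<exists>d. \<exists>s\<in>gr d - p. kills d s f}"

lemma compact_shifts_shift:
  assumes "D \<in> compact_shifts"
  shows "shiftO T n D \<in> compact_shifts"
proof -
  obtain m C where C: "compact_object \<kappa> T C" "D = shiftO T m C"
    using assms by (auto simp: compact_shifts_def)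
  then have "shiftO T n D = shiftO T (n + m) C"
    by (simp add: compact_object_def shiftO_shiftO)
  then show ?thesis using C(1) by (auto simp: compact_shifts_def)
qed

lemma compact_shifts_supported: "D \<in> compact_shifts \<Longrightarrow> finitely_supported \<kappa> T D"
  unfolding compact_shifts_def using compact_finitely_supported finitely_supported_shift by blast

lemma compact_shifts_obj: "D \<in> compact_shifts \<Longrightarrow> D \<in> Obj T"
  using compact_shifts_supported by (simp add: finitely_supported_def)

lemma torsion_atD:
  assumes "X \<in> torsion_at p" "D \<in> compact_shifts" "f \<in> Hom T D X"
  obtains d s where "s \<in> gr d - p" "kills d s f"
  using assms unfolding torsion_at_def by blast

lemma torsion_atI:
  assumes "X \<in> Obj T" "\<And>D f. D \<in> compact_shifts \<Longrightarrow> f \<in> Hom T D X \<Longrightarrow> \<exists>d. \<exists>s\<in>gr d - p. kills d s f"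
  shows "X \<in> torsion_at p"
  using assms unfolding torsion_at_def by blast

text \<open>An element of degree \<open>n\<close> in the graded module of maps from \<open>C\<close>
  is the \<open>n\<close>-fold shift of a map from a shift of \<open>C\<close>; with
  \<open>localization_vanishes_iff\<close> the vanishing of localizations becomes a condition on
  maps.\<close>

lemma torsion_objects_iff:
  "X \<in> torsion_objects \<kappa> R gr T \<phi> V \<longleftrightarrow> X \<in> Obj T \<and> (\<forall>p\<in>Spec R gr - V. X \<in> torsion_at p)"
proof (cases "X \<in> Obj T")
  case X: True
  \<comment> \<open>The module action on a shifted map is the shift of
    \<open>\<phi> m s X \<cdot> f\<close>, with no sign.\<close>
  have act: "graded_Hom_act T \<phi> X m s n (shiftM T n f) = Zer T C (shiftO T (m + n) X) \<longleftrightarrow> kills m s f"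
    if s: "s \<in> gr m" and C: "C \<in> Obj T" and f: "f \<in> Hom T (shiftO T (- n) C) X" for m s n f C
  proof -
    have "graded_Hom_act T \<phi> X m s n (shiftM T n f) = shiftM T n (\<phi> m s X \<cdot> f)"
      unfolding graded_Hom_act_def using shift_comp[OF f \<phi>_hom[OF s X]] by simp
    moreover have "Zer T C (shiftO T (m + n) X) = shiftM T n (Zer T (shiftO T (- n) C) (shiftO T m X))"
      using X C by (simp add: shiftO_shiftO add.commute)
    moreover have "\<phi> m s X \<cdot> f \<in> Mor T" "Zer T (shiftO T (- n) C) (shiftO T m X) \<in> Mor T"
      using comp_hom[OF f \<phi>_hom[OF s X]] X C by (auto simp: Hom_def)
    ultimately show ?thesis
      unfolding kills_iff[OF f] using shift_inj by metis
  qed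
  have van: "localization_vanishes R gr p (graded_Hom T C X) (\<lambda>n. Zer T C (shiftO T n X)) (graded_Hom_act T \<phi> X)
      \<longleftrightarrow> (\<forall>n. \<forall>f\<in>Hom T (shiftO T n C) X. \<exists>d. \<exists>s\<in>gr d - p. kills d s f)"
    if p: "p \<in> Spec R gr" and C: "C \<in> Obj T" for p C
  proof -
    have "localization_vanishes R gr p (graded_Hom T C X) (\<lambda>n. Zer T C (shiftO T n X)) (graded_Hom_act T \<phi> X)
      \<longleftrightarrow> (\<forall>n. \<forall>f\<in>graded_Hom T C X n. \<exists>m. \<exists>s\<in>gr m - p. graded_Hom_act T \<phi> X m s n f = Zer T C (shiftO T (m + n) X))"
    proof (rule localization_vanishes_iff[OF p])
      show "Zer T C (shiftO T n X) \<in> graded_Hom T C X n" for n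
        using X C by (simp add: graded_Hom_def)
      show "graded_Hom_act T \<phi> X 0 \<one>\<^bsub>R\<^esub> n x = x" if "x \<in> graded_Hom T C X n" for n x
        using that X by (simp add: graded_Hom_act_def graded_Hom_def \<phi>_one shift_id id_comp)
      show "graded_Hom_act T \<phi> X m r n (Zer T C (shiftO T n X)) = Zer T C (shiftO T (m + n) X)"
        if "r \<in> gr m" for m n r
        using that X C by (simp add: graded_Hom_act_def shiftO_shiftO add.commute)
      show "graded_Hom_act T \<phi> X (m + n) (r \<otimes>\<^bsub>R\<^esub> s) k x =
          graded_Hom_act T \<phi> X m r (n + k) (graded_Hom_act T \<phi> X n s k x)"
        if r: "r \<in> gr m" and s: "s \<in> gr n" and x: "x \<in> graded_Hom T C X k" for m n k r s x
      proof -
        note hr = \<phi>_hom[OF r X] and hs = \<phi>_hom[OF s X]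
        have "shiftM T k (\<phi> (m + n) (r \<otimes>\<^bsub>R\<^esub> s) X) = shiftM T k (shiftM T n (\<phi> m r X)) \<cdot> shiftM T k (\<phi> n s X)"
          using \<phi>_mult[OF r s X] shift_comp[OF hs shift_hom[OF hr]] by simp
        also have "shiftM T k (shiftM T n (\<phi> m r X)) = shiftM T (n + k) (\<phi> m r X)"
          using r X by (simp add: shiftM_shiftM add.commute)
        finally have eq: "shiftM T k (\<phi> (m + n) (r \<otimes>\<^bsub>R\<^esub> s) X) = shiftM T (n + k) (\<phi> m r X) \<cdot> shiftM T k (\<phi> n s X)" .
        have "shiftM T k (\<phi> n s X) \<in> Hom T (shiftO T k X) (shiftO T (n + k) X)"
          using shift_hom[OF hs, of k] X by (simp add: shiftO_shiftO add.commute)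
        then show ?thesis
          unfolding graded_Hom_act_def eq
          using x comp_assoc shift_hom[OF hr, of "n + k"] unfolding graded_Hom_def by blast
      qed
    qed
    also have "\<dots> \<longleftrightarrow> (\<forall>n. \<forall>f\<in>Hom T (shiftO T (- n) C) X. \<exists>m. \<exists>s\<in>gr m - p. kills m s f)"
    proof (intro iffI allI ballI)
      fix n f assume *: "\<forall>n. \<forall>f\<in>graded_Hom T C X n. \<exists>m. \<exists>s\<in>gr m - p. graded_Hom_act T \<phi> X m s n f = Zer T C (shiftO T (m + n) X)"
        and f: "f \<in> Hom T (shiftO T (- n) C) X"
      have "shiftM T n f \<in> graded_Hom T C X n"
        using shift_hom[OF f, of n] C by (simp add: graded_Hom_def shiftO_shiftO)
      then obtain m s where "s \<in> gr m - p" "graded_Hom_act T \<phi> X m s n (shiftM T n f) = Zer T C (shiftO T (m + n) X)"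
        using * by blast
      then show "\<exists>m. \<exists>s\<in>gr m - p. kills m s f" using act[OF _ C f] by blast
    next
      fix n f assume *: "\<forall>n. \<forall>f\<in>Hom T (shiftO T (- n) C) X. \<exists>m. \<exists>s\<in>gr m - p. kills m s f"
        and f: "f \<in> graded_Hom T C X n"
      obtain f' where f': "f' \<in> Hom T (shiftO T (- n) C) X" "f = shiftM T n f'"
        using shift_adjunct[of f C n X] f X unfolding graded_Hom_def by blast
      then obtain m s where "s \<in> gr m - p" "kills m s f'" using * by blast
      then show "\<exists>m. \<exists>s\<in>gr m - p. graded_Hom_act T \<phi> X m s n f = Zer T C (shiftO T (m + n) X)"
        using act[OF _ C f'(1)] f'(2) by blast
    qed
    also have "\<dots> \<longleftrightarrow> (\<forall>n. \<forall>f\<in>Hom T (shiftO T n C) X. \<exists>m. \<exists>s\<in>gr m - p. kills m s f)"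
    proof -
      have "(\<forall>n :: int. Q (- n)) \<longleftrightarrow> (\<forall>n. Q n)" for Q
      proof (intro iffI allI)
        show "Q n" if "\<forall>n. Q (- n)" for n
          using spec[OF that, of "- n"] by simp
      qed simp
      then show ?thesis .
    qed
    finally show ?thesis .
  qed
  have "X \<in> torsion_at p \<longleftrightarrow> (\<forall>C. compact_object \<kappa> T C \<longrightarrow>
      localization_vanishes R gr p (graded_Hom T C X) (\<lambda>n. Zer T C (shiftO T n X)) (graded_Hom_act T \<phi> X))"
    if p: "p \<in> Spec R gr" for p
  proof -
    have "(\<forall>D\<in>compact_shifts. Q D) \<longleftrightarrow> (\<forall>C. compact_object \<kappa> T C \<longrightarrow> (\<forall>n. Q (shiftO T n C)))" for Q
      unfolding compact_shifts_def by blast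
    then have "X \<in> torsion_at p \<longleftrightarrow> (\<forall>C. compact_object \<kappa> T C \<longrightarrow>
        (\<forall>n. \<forall>f\<in>Hom T (shiftO T n C) X. \<exists>d. \<exists>s\<in>gr d - p. kills d s f))"
      unfolding torsion_at_def using X by simp
    then show ?thesis
      using van[OF p] by (simp add: compact_object_def)
  qed
  then show ?thesis
    unfolding torsion_objects_def using X by auto
qed (simp add: torsion_objects_def)

lemma torsion_objects_mono: "V \<subseteq> V' \<Longrightarrow> torsion_objects \<kappa> R gr T \<phi> V \<subseteq> torsion_objects \<kappa> R gr T \<phi> V'"
  unfolding subset_iff torsion_objects_iff by blast

text \<open>Extensions multiply two annihilators, and primality keeps the product outside
  \<open>p\<close>. For coproducts, finite support of the sources reduces to finitely many
  annihilators, combined in the same way.\<close>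

lemma localizing_torsion_at:
  assumes \<kappa>: "uncountable_regular \<kappa>" and p: "p \<in> Spec R gr"
  shows "localizing \<kappa> T (torsion_at p)"
proof (rule localizingI)
  show "torsion_at p \<subseteq> Obj T" by (auto simp: torsion_at_def)
  have zer: "\<exists>d. \<exists>s\<in>gr d - p. kills d s (Zer T A B)" if "A \<in> Obj T" "B \<in> Obj T" for A B
    using Spec_one[OF p] kills_zer[OF _ that] by blast
  show "Z \<in> torsion_at p" if Z: "zero_object T Z" for Z
  proof (rule torsion_atI[OF zero_obj[OF Z]])
    fix D f assume "f \<in> Hom T D Z"
    then show "\<exists>d. \<exists>s\<in>gr d - p. kills d s f"
      using hom_zero_object(1)[OF Z] zer hom_obj by metis
  qed
  have shift: "shiftO T n X \<in> torsion_at p" if X: "X \<in> torsion_at p" for n X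
  proof (rule torsion_atI)
    have Xo: "X \<in> Obj T" using X by (simp add: torsion_at_def)
    then show "shiftO T n X \<in> Obj T" by simp
    fix D f assume D: "D \<in> compact_shifts" and f: "f \<in> Hom T D (shiftO T n X)"
    obtain f' where f': "f' \<in> Hom T (shiftO T (- n) D) X" "f = shiftM T n f'"
      using shift_adjunct[OF f Xo] by blast
    obtain d s where "s \<in> gr d - p" "kills d s f'"
      using torsion_atD[OF X compact_shifts_shift[OF D] f'(1)] by blast
    then show "\<exists>d. \<exists>s\<in>gr d - p. kills d s f"
      using kills_shift[OF _ f'(1)] f'(2) by blast
  qed
  show "SuspO T X \<in> torsion_at p \<longleftrightarrow> X \<in> torsion_at p" if "X \<in> Obj T" for X
    using shift[of X 1] shift[of "SuspO T X" "- 1"] that by (auto simp: susp_eq_shift shiftO_shiftO)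
  show "Y \<in> torsion_at p" if t: "exact_triangle T X Y Z f g h" and X: "X \<in> torsion_at p" and Z: "Z \<in> torsion_at p"
    for X Y Z f g h
  proof (rule torsion_atI)
    note E = exactD[OF t]
    show "Y \<in> Obj T" by (rule E(2))
    fix D a assume D: "D \<in> compact_shifts" and a: "a \<in> Hom T D Y"
    obtain m s where s: "s \<in> gr m - p" "kills m s (g \<cdot> a)"
      using torsion_atD[OF Z D comp_hom[OF a E(5)]] by blast
    then obtain b where b: "b \<in> Hom T (shiftO T (- m) D) X"
      "\<And>n r. r \<in> gr n \<Longrightarrow> kills n r (f \<cdot> b) \<Longrightarrow> kills (n + m) (r \<otimes>\<^bsub>R\<^esub> s) a"
      using kills_extension[OF _ t a s(2)] by blast
    obtain n r where r: "r \<in> gr n - p" "kills n r b"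
      using torsion_atD[OF X compact_shifts_shift[OF D] b(1)] by blast
    then have "kills (n + m) (r \<otimes>\<^bsub>R\<^esub> s) a"
      using b(2) kills_post[OF _ b(1) E(4)] by blast
    then show "\<exists>d. \<exists>s\<in>gr d - p. kills d s a"
      using Spec_prime[OF p r(1) s(1)] by blast
  qed
  fix I :: "'i set" and X S \<iota>
  assume I: "small \<kappa> I" and X: "\<And>i. i \<in> I \<Longrightarrow> X i \<in> torsion_at p" and S: "coproduct T I X S \<iota>"
  show "S \<in> torsion_at p"
  proof (rule torsion_atI)
    show So: "S \<in> Obj T" using S by (simp add: coproduct_def)
    fix D f assume D: "D \<in> compact_shifts" and f: "f \<in> Hom T D S"
    show "\<exists>d. \<exists>s\<in>gr d - p. kills d s f"
    proof (rule finitely_supported_induct[OF \<kappa> compact_shifts_supported[OF D] I S f,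
          of "\<lambda>f. \<exists>d. \<exists>s\<in>gr d - p. kills d s f"])
      show "\<exists>d. \<exists>s\<in>gr d - p. kills d s (Zer T D S)"
        using zer So compact_shifts_obj[OF D] by blast
      show "\<exists>d. \<exists>s\<in>gr d - p. kills d s (Add T a b)"
        if a: "a \<in> Hom T D S" and b: "b \<in> Hom T D S"
          and ka: "\<exists>d. \<exists>s\<in>gr d - p. kills d s a" and kb: "\<exists>d. \<exists>s\<in>gr d - p. kills d s b" for a b
      proof -
        obtain m s n r where s: "s \<in> gr m - p" "kills m s a" and r: "r \<in> gr n - p" "kills n r b"
          using ka kb by blast
        have sr: "s \<otimes>\<^bsub>R\<^esub> r \<in> gr (m + n) - p" using Spec_prime[OF p s(1) r(1)] .
        have "kills (m + n) (s \<otimes>\<^bsub>R\<^esub> r) a" "kills (m + n) (s \<otimes>\<^bsub>R\<^esub> r) b"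
          using kills_mult s r a b by auto
        then show ?thesis using kills_add[OF _ a b] sr by blast
      qed
      show "\<exists>d. \<exists>s\<in>gr d - p. kills d s (\<iota> i \<cdot> c)" if i: "i \<in> I" and c: "c \<in> Hom T D (X i)" for i c
      proof -
        obtain d s where "s \<in> gr d - p" "kills d s c"
          using torsion_atD[OF X[OF i] D c] by blast
        then show ?thesis using kills_post[OF _ c coproduct_hom[OF S i]] by blast
      qed
    qed
  qed
qed

lemma localizing_torsion:
  assumes "uncountable_regular \<kappa>"
  shows "localizing \<kappa> T (torsion_objects \<kappa> R gr T \<phi> V)"
proof -
  \<comment> \<open>\<open>Obj T\<close> is inserted so that the intersection is not empty when
    \<open>V\<close> contains all primes.\<close>
  have "torsion_objects \<kappa> R gr T \<phi> V = \<Inter>(insert (Obj T) (torsion_at ` (Spec R gr - V)))"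
    by (auto simp: torsion_objects_iff)
  then show ?thesis
    using localizing_Inter[of "insert (Obj T) (torsion_at ` (Spec R gr - V))" \<kappa> T]
      localizing_Obj localizing_torsion_at[OF assms] by auto
qed

section \<open>Cones on ring elements and Koszul objects\<close>

lemma cone_torsion_at:
  assumes "p \<in> Spec R gr" "r \<in> gr d - p" "exact_triangle T Y (shiftO T d Y) W (\<phi> d r Y) g h"
  shows "W \<in> torsion_at p"
proof (rule torsion_atI)
  show "W \<in> Obj T" using exactD(3)[OF assms(3)] .
  fix D f assume "f \<in> Hom T D W"
  then show "\<exists>d. \<exists>s\<in>gr d - p. kills d s f"
    using kills_cone[OF _ assms(3)] Spec_prime[OF assms(1) assms(2,2)] assms(2) by blast
qed

text \<open>Cancellation: the product of \<open>s\<close> with \<open>f\<close> is the shift of a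
  map \<open>b\<close> killed by \<open>r\<close>, and \<open>r\<close> acts injectively on maps
  with this source.\<close>

lemma kills_mult_inj:
  assumes r: "r \<in> gr m" and s: "s \<in> gr n" and f: "f \<in> Hom T D X" and k: "kills (m + n) (r \<otimes>\<^bsub>R\<^esub> s) f"
    and inj: "\<And>b. b \<in> Hom T (shiftO T (- n) D) X \<Longrightarrow> kills m r b \<Longrightarrow> b = Zer T (shiftO T (- n) D) X"
  shows "kills n s f"
proof -
  note X = hom_obj(2)[OF f] and D = hom_obj(1)[OF f]
  have sf: "\<phi> n s X \<cdot> f \<in> Hom T D (shiftO T n X)" using comp_hom[OF f \<phi>_hom[OF s X]] .
  obtain b where b: "b \<in> Hom T (shiftO T (- n) D) X" "\<phi> n s X \<cdot> f = shiftM T n b"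
    using shift_adjunct[OF sf X] by blast
  have "shiftM T n (\<phi> m r X \<cdot> b) = shiftM T n (Zer T (shiftO T (- n) D) (shiftO T m X))"
    using k \<phi>_mult_comp(1)[OF r s f] b(2) shift_comp[OF b(1) \<phi>_hom[OF r X]] X D
    unfolding kills_iff[OF f] by (simp add: shiftO_shiftO add.commute)
  moreover have "\<phi> m r X \<cdot> b \<in> Mor T" using comp_hom[OF b(1) \<phi>_hom[OF r X]] by (simp add: Hom_def)
  ultimately have "kills m r b"
    using shift_inj[of "\<phi> m r X \<cdot> b"] X D unfolding kills_iff[OF b(1)] by simp
  then show ?thesis
    using inj[OF b(1)] b(2) D X unfolding kills_iff[OF f] by (simp add: shiftO_shiftO)
qed

text \<open>The square of \<open>r\<close> kills the identity of the cone, hence every map out of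
  it. Cancelling \<open>r\<close> twice makes maps into \<open>X\<close> vanish.\<close>

lemma cone_perp:
  assumes r: "r \<in> gr d" and t: "exact_triangle T Y (shiftO T d Y) W (\<phi> d r Y) g h"
    and X: "X \<in> Obj T" and inj: "\<And>D f. f \<in> Hom T D X \<Longrightarrow> kills d r f \<Longrightarrow> f = Zer T D X"
    and a: "a \<in> Hom T (shiftO T n W) X"
  shows "a = Zer T (shiftO T n W) X"
proof -
  have W: "W \<in> Obj T" and rr: "r \<otimes>\<^bsub>R\<^esub> r \<in> gr (d + d)" using exactD(3)[OF t] gr_mult[OF r r] by auto
  have "kills (d + d) (r \<otimes>\<^bsub>R\<^esub> r) (Idn T (shiftO T n W))"
    using kills_cone[OF r t id_hom[OF W]] kills_shift[OF rr id_hom[OF W], of n] shift_id[OF W] by simp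
  then have "kills (d + d) (r \<otimes>\<^bsub>R\<^esub> r) a"
    using kills_post[OF rr id_hom a] W comp_id[OF a] by simp
  then have "kills d r a"
    using kills_mult_inj[OF r r a _ inj] by blast
  then show ?thesis
    by (rule inj[OF a])
qed

text \<open>Cones are unique only up to noncanonical isomorphism; choosing one for each map keeps
  the collection \<open>cones P G\<close> small.\<close>

definition cone :: "int \<Rightarrow> 'r \<Rightarrow> 'o \<Rightarrow> 'o" where
  "cone d r D = (SOME W. \<exists>g h. exact_triangle T D (shiftO T d D) W (\<phi> d r D) g h)"

lemma cone_triangle:
  assumes "r \<in> gr d" "D \<in> Obj T"
  obtains g h where "exact_triangle T D (shiftO T d D) (cone d r D) (\<phi> d r D) g h"
proof -
  have "\<exists>W g h. exact_triangle T D (shiftO T d D) W (\<phi> d r D) g h"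
    using tri_complete[OF \<phi>_hom[OF assms]] .
  from someI_ex[OF this] show thesis
    using that unfolding cone_def by blast
qed

text \<open>All shifts are adjoined, because the detection argument requires sets closed under
  shifts and the construction is iterated.\<close>

definition cones :: "(int \<times> 'r) set \<Rightarrow> 'o set \<Rightarrow> 'o set" where
  "cones P G = (\<lambda>(n, (d, r), D). shiftO T n (cone d r D)) ` (UNIV \<times> P \<times> G)"

lemma conesE:
  assumes "W \<in> cones P G"
  obtains n d r D where "(d, r) \<in> P" "D \<in> G" "W = shiftO T n (cone d r D)"
  using assms unfolding cones_def by auto

lemma conesI: "(d, r) \<in> P \<Longrightarrow> D \<in> G \<Longrightarrow> shiftO T n (cone d r D) \<in> cones P G"
  unfolding cones_def by force

lemma cone_obj: "r \<in> gr d \<Longrightarrow> D \<in> Obj T \<Longrightarrow> cone d r D \<in> Obj T"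
  using cone_triangle exactD(3) by metis

text \<open>What \<open>perp_detect\<close> and \<open>localizing_perp\<close> ask of a detecting
  set; the property is inherited by \<open>cones\<close>.\<close>

definition test_objects :: "'o set \<Rightarrow> bool" where
  "test_objects G \<longleftrightarrow> small \<kappa> G \<and> (\<forall>D\<in>G. finitely_supported \<kappa> T D \<and> (\<forall>n. shiftO T n D \<in> G))"

lemma test_objectsD:
  assumes "test_objects G"
  shows "small \<kappa> G" "D \<in> G \<Longrightarrow> finitely_supported \<kappa> T D" "D \<in> G \<Longrightarrow> shiftO T n D \<in> G" "G \<subseteq> Obj T"
  using assms by (auto simp: test_objects_def finitely_supported_def)

lemma test_objects_cones:
  assumes \<kappa>: "uncountable_regular \<kappa>" and G: "test_objects G"
    and P: "small \<kappa> P" "\<And>d r. (d, r) \<in> P \<Longrightarrow> r \<in> gr d"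
  shows "test_objects (cones P G)"
  unfolding test_objects_def
proof (intro conjI ballI allI)
  note G = test_objectsD[OF G]
  show "small \<kappa> (cones P G)"
    unfolding cones_def
    by (intro small_image small_Times[OF \<kappa>] small_countable[OF \<kappa>] P(1) G(1)) simp
  fix W assume "W \<in> cones P G"
  then obtain n d r D where W: "(d, r) \<in> P" "D \<in> G" "W = shiftO T n (cone d r D)"
    by (rule conesE)
  have D: "D \<in> Obj T" using W(2) G(4) by blast
  note r = P(2)[OF W(1)]
  obtain g h where t: "exact_triangle T D (shiftO T d D) (cone d r D) (\<phi> d r D) g h"
    using cone_triangle[OF r D] by blast
  show "finitely_supported \<kappa> T W"
    unfolding W(3) by (intro finitely_supported_shift finitely_supported_cone[OF t] G(2) G(3) W(2))
  show "shiftO T m W \<in> cones P G" for m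
    unfolding W(3) using conesI[OF W(1,2)] by (simp add: shiftO_shiftO cone_obj[OF r D])
qed

text \<open>The alternatives match the two ways torsion arises in an iterated cone: it is created by
  an element outside \<open>p\<close>, and it is inherited from the objects coned
  afterwards.\<close>

lemma cones_torsion_at:
  assumes \<kappa>: "uncountable_regular \<kappa>" and p: "p \<in> Spec R gr" and G: "G \<subseteq> Obj T"
    and P: "\<And>d r. (d, r) \<in> P \<Longrightarrow> r \<in> gr d"
    and "(\<forall>(d, r)\<in>P. r \<notin> p) \<or> G \<subseteq> torsion_at p"
  shows "cones P G \<subseteq> torsion_at p"
proof
  fix W assume "W \<in> cones P G"
  then obtain n d r D where W: "(d, r) \<in> P" "D \<in> G" "W = shiftO T n (cone d r D)"
    by (rule conesE)
  have D: "D \<in> Obj T" using W(2) G by blast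
  note r = P[OF W(1)] and L = localizing_torsion_at[OF \<kappa> p]
  obtain g h where t: "exact_triangle T D (shiftO T d D) (cone d r D) (\<phi> d r D) g h"
    using cone_triangle[OF r D] by blast
  have "cone d r D \<in> torsion_at p"
    using assms(5)
  proof
    assume "\<forall>(d, r)\<in>P. r \<notin> p"
    then have "r \<in> gr d - p" using r W(1) by blast
    then show ?thesis using cone_torsion_at[OF p _ t] by blast
  next
    assume "G \<subseteq> torsion_at p"
    then have "D \<in> torsion_at p" using W(2) by blast
    then show ?thesis using localizingD(5)[OF L t] localizing_shift[OF L D] by blast
  qed
  then show "W \<in> torsion_at p"
    using localizing_shift[OF L cone_obj[OF r D]] W(3) by blast
qed

text \<open>If \<open>r\<close> kills \<open>f\<close>, a shift of \<open>f\<close> extends over the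
  cone of \<open>r\<close>, and all maps from there to shifts of \<open>L\<close> are zero. Thus
  orthogonality to the cones makes \<open>r\<close> act injectively on maps from
  \<open>G\<close>.\<close>

lemma cones_detect:
  assumes L: "L \<in> perp T (cones P G)" and P: "\<And>d r. (d, r) \<in> P \<Longrightarrow> r \<in> gr d" and G: "G \<subseteq> Obj T"
    and D: "D \<in> G" and f: "f \<in> Hom T D L" and r: "(d, r) \<in> P" "kills d r f"
  shows "f = Zer T D L"
proof -
  note r' = P[OF r(1)] and Lo = perp_obj[OF L]
  have Do: "D \<in> Obj T" using G D by blast
  obtain g h where t: "exact_triangle T D (shiftO T d D) (cone d r D) (\<phi> d r D) g h"
    using cone_triangle[OF r' Do] by blast
  note E = exactD[OF t]
  have "shiftM T d f \<cdot> \<phi> d r D = Zer T D (shiftO T d L)"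
    using r(2) kills_iff'[OF r' f] by blast
  then obtain k where k: "k \<in> Hom T (cone d r D) (shiftO T d L)" "shiftM T d f = k \<cdot> g"
    using tri_ext[OF t shift_hom[OF f]] by blast
  have "k = Zer T (cone d r D) (shiftO T d L)"
    by (rule hom_shift_zer[OF k(1) Lo]) (rule perpD[OF L conesI[OF r(1) D]])
  then have "shiftM T d f = shiftM T d (Zer T D L)"
    using k(2) E Lo Do by (auto simp: Hom_def)
  then show ?thesis
    by (rule shift_inj[rotated 2]) (use f Do Lo in \<open>auto simp: Hom_def\<close>)
qed

text \<open>Powers are allowed because exponents add up along a cone; all shifts of \<open>L\<close>
  occur so that the class is closed under shifts.\<close>

definition power_torsion :: "int \<Rightarrow> 'r \<Rightarrow> 'o \<Rightarrow> 'o set" where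
  "power_torsion e t L = {D \<in> Obj T. \<forall>n. \<forall>f\<in>Hom T D (shiftO T n L). \<exists>k::nat. kills (int k * e) (t [^]\<^bsub>R\<^esub> k) f}"

lemma power_torsion_shift:
  assumes t: "t \<in> gr e" and L: "L \<in> Obj T" and D: "D \<in> power_torsion e t L"
  shows "shiftO T m D \<in> power_torsion e t L"
  unfolding power_torsion_def
proof (intro CollectI conjI allI ballI)
  have Do: "D \<in> Obj T" using D by (simp add: power_torsion_def)
  then show "shiftO T m D \<in> Obj T" by simp
  fix n f assume f: "f \<in> Hom T (shiftO T m D) (shiftO T n L)"
  have "shiftM T (- m) f \<in> Hom T D (shiftO T (n - m) L)"
    using shift_hom[OF f, of "- m"] Do L by (simp add: shiftO_shiftO)
  then obtain k :: nat where "kills (int k * e) (t [^]\<^bsub>R\<^esub> k) (shiftM T (- m) f)"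
    using D unfolding power_torsion_def by blast
  then show "\<exists>k::nat. kills (int k * e) (t [^]\<^bsub>R\<^esub> k) f"
    using kills_shift[OF gr_pow[OF t] f] by blast
qed

lemma power_torsion_cone:
  assumes t: "t \<in> gr e" and L: "L \<in> Obj T" and tri: "exact_triangle T C D E f g h"
    and C: "C \<in> power_torsion e t L" and D: "D \<in> power_torsion e t L"
  shows "E \<in> power_torsion e t L"
  unfolding power_torsion_def
proof (intro CollectI conjI allI ballI)
  note X = exactD[OF tri]
  show "E \<in> Obj T" by (rule X(3))
  fix n a assume a: "a \<in> Hom T E (shiftO T n L)"
  have L': "shiftO T n L \<in> Obj T" using L by simp
  obtain k :: nat where k: "kills (int k * e) (t [^]\<^bsub>R\<^esub> k) (a \<cdot> g)"
    using D comp_hom[OF X(5) a] unfolding power_torsion_def by blast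
  note tk = gr_pow[OF t, of k]
  note ta = comp_hom[OF a \<phi>_hom[OF tk L']]
  have "(\<phi> (int k * e) (t [^]\<^bsub>R\<^esub> k) (shiftO T n L) \<cdot> a) \<cdot> g = Zer T D (shiftO T (int k * e) (shiftO T n L))"
    using k comp_assoc[OF X(5) a \<phi>_hom[OF tk L']] unfolding kills_iff[OF comp_hom[OF X(5) a]] by simp
  then obtain b where b: "b \<in> Hom T (SuspO T C) (shiftO T (int k * e) (shiftO T n L))"
    "\<phi> (int k * e) (t [^]\<^bsub>R\<^esub> k) (shiftO T n L) \<cdot> a = b \<cdot> h"
    using tri_ext[OF rotate[OF tri] ta] by blast
  have "SuspO T C \<in> power_torsion e t L"
    using power_torsion_shift[OF t L C, of 1] X(1) by (simp add: susp_eq_shift)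
  moreover have "b \<in> Hom T (SuspO T C) (shiftO T (int k * e + n) L)"
    using b(1) L by (simp add: shiftO_shiftO)
  ultimately obtain m :: nat where m: "kills (int m * e) (t [^]\<^bsub>R\<^esub> m) b"
    unfolding power_torsion_def by blast
  note tm = gr_pow[OF t, of m]
  have "kills (int m * e) (t [^]\<^bsub>R\<^esub> m) (b \<cdot> h)"
    using kills_pre[OF tm X(6) b(1) m] .
  then have "\<phi> (int m * e) (t [^]\<^bsub>R\<^esub> m) (shiftO T (int k * e) (shiftO T n L)) \<cdot>
      (\<phi> (int k * e) (t [^]\<^bsub>R\<^esub> k) (shiftO T n L) \<cdot> a) = Zer T E (shiftO T (int k * e + int m * e) (shiftO T n L))"
    using b(2) L unfolding kills_iff[OF comp_hom[OF X(6) b(1)]] by (simp add: shiftO_shiftO algebra_simps)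
  then have "kills (int k * e + int m * e) (t [^]\<^bsub>R\<^esub> k \<otimes>\<^bsub>R\<^esub> t [^]\<^bsub>R\<^esub> m) a"
    using \<phi>_mult_comp(2)[OF tk tm a] kills_iff[OF a] by simp
  moreover have "t [^]\<^bsub>R\<^esub> k \<otimes>\<^bsub>R\<^esub> t [^]\<^bsub>R\<^esub> m = t [^]\<^bsub>R\<^esub> (k + m)" "int k * e + int m * e = int (k + m) * e"
    using gr_carrier[OF t] by (simp_all add: nat_pow_mult algebra_simps)
  ultimately show "\<exists>k::nat. kills (int k * e) (t [^]\<^bsub>R\<^esub> k) a" by metis
qed

lemma power_torsion_inj:
  assumes t: "t \<in> gr e"
    and G: "\<And>D n. D \<in> G \<Longrightarrow> shiftO T n D \<in> G"
    and inj: "\<And>D f. D \<in> G \<Longrightarrow> f \<in> Hom T D L \<Longrightarrow> kills e t f \<Longrightarrow> f = Zer T D L"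
  shows "D \<in> G \<Longrightarrow> f \<in> Hom T D L \<Longrightarrow> kills (int k * e) (t [^]\<^bsub>R\<^esub> k) f \<Longrightarrow> f = Zer T D L"
proof (induction k arbitrary: D f)
  case 0
  then show ?case
    using kills_iff[OF 0(2)] hom_obj[OF 0(2)] \<phi>_one id_comp[OF 0(2)] by simp
next
  case (Suc k)
  note f = Suc.prems(2) and tk = gr_pow[OF t, of k]
  have "kills (int k * e + e) (t [^]\<^bsub>R\<^esub> k \<otimes>\<^bsub>R\<^esub> t) f"
    using Suc.prems(3) by (simp add: algebra_simps)
  then have "kills e t f"
    using kills_mult_inj[OF tk t f _ Suc.IH[OF G[OF Suc.prems(1)]]] by blast
  then show ?case
    by (rule inj[OF Suc.prems(1) f])
qed

text \<open>If no power of \<open>r\<close> killed \<open>f\<close>, some prime \<open>q\<close>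
  would contain the annihilator of \<open>f\<close> but not \<open>r\<close>. Then \<open>q\<close>
  does not contain \<open>p\<close>, so torsion at \<open>q\<close> yields an annihilator of
  \<open>f\<close> outside \<open>q\<close>, a contradiction.\<close>

lemma power_torsion_of_torsion:
  assumes p: "p \<in> Spec R gr" and L: "L \<in> torsion_objects \<kappa> R gr T \<phi> (V_set R gr p)"
    and r: "r \<in> gr e" "r \<in> p" and D: "D \<in> compact_shifts"
  shows "D \<in> power_torsion e r L"
proof -
  have Lo: "L \<in> Obj T" and Do: "D \<in> Obj T"
    using L torsion_objects_iff compact_shifts_obj[OF D] by blast+
  have main: "\<exists>k::nat. kills (int k * e) (r [^]\<^bsub>R\<^esub> k) f" if D: "D \<in> compact_shifts" and f: "f \<in> Hom T D L" for D f
  proof (rule ccontr)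
    assume no: "\<not> ?thesis"
    define A where "A n = {s \<in> gr n. kills n s f}" for n
    let ?J = "genideal R (\<Union>n. A n)"
    have sub: "(\<Union>n. A n) \<subseteq> (\<Union>n. gr n)" by (auto simp: A_def)
    have J: "?J \<inter> gr k \<subseteq> A k" for k
    proof (rule genideal_graded)
      show "A n \<subseteq> gr n" for n by (auto simp: A_def)
      show "\<zero>\<^bsub>R\<^esub> \<in> A n" for n using gr_zero kills_zero_ring[OF f] by (simp add: A_def)
      show "x \<oplus>\<^bsub>R\<^esub> y \<in> A n" if "x \<in> A n" "y \<in> A n" for n x y
        using that kills_add_ring[OF _ _ f] additive_subgroup.a_closed[OF gr_subgroup] by (auto simp: A_def)
      show "s \<otimes>\<^bsub>R\<^esub> x \<in> A (m + n)" if "s \<in> gr m" "x \<in> A n" for m n s x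
        using that kills_mult(1)[OF _ _ f] gr_mult by (auto simp: A_def)
      show "x \<otimes>\<^bsub>R\<^esub> s \<in> A (n + m)" if "s \<in> gr m" "x \<in> A n" for m n s x
        using that kills_mult(2)[OF _ _ f] gr_mult by (auto simp: A_def)
    qed
    have "r [^]\<^bsub>R\<^esub> k \<notin> ?J" for k :: nat
      using J[of "int k * e"] gr_pow[OF r(1), of k] no by (auto simp: A_def)
    then obtain q where q: "q \<in> Spec R gr" "?J \<subseteq> q" "r \<notin> q"
      using homogeneous_prime_avoiding_powers[OF homogeneous_ideal_genideal[OF sub] r(1)] by blast
    have "q \<in> Spec R gr - V_set R gr p" using q(1,3) r(2) by (auto simp: V_set_def)
    then have "L \<in> torsion_at q" using L torsion_objects_iff by blast
    then obtain d s where s: "s \<in> gr d - q" "kills d s f"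
      using torsion_atD[OF _ D f] by blast
    have "(\<Union>n. A n) \<subseteq> ?J"
      by (rule genideal_self) (use sub gr_carrier in blast)
    then have "s \<in> q" using s q(2) by (auto simp: A_def)
    then show False using s(1) by blast
  qed
  show ?thesis
    unfolding power_torsion_def
  proof (intro CollectI conjI allI ballI)
    show "D \<in> Obj T" by fact
    fix n f assume f: "f \<in> Hom T D (shiftO T n L)"
    obtain f' where f': "f' \<in> Hom T (shiftO T (- n) D) L" "f = shiftM T n f'"
      using shift_adjunct[OF f Lo] by blast
    then show "\<exists>k::nat. kills (int k * e) (r [^]\<^bsub>R\<^esub> k) f"
      using main[OF compact_shifts_shift[OF D] f'(1)] kills_shift[OF gr_pow[OF r(1)] f'(1)] by blast
  qed
qed

text \<open>The Koszul objects \<open>D // (r\<^sub>1, \<dots>, r\<^sub>n)\<close> of the literature, with all shifts.\<close>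

primrec koszul :: "(int \<times> 'r) list \<Rightarrow> 'o set \<Rightarrow> 'o set" where
  "koszul [] G = G"
| "koszul (x # xs) G = koszul xs (cones {x} G)"

lemma test_objects_koszul:
  assumes "uncountable_regular \<kappa>"
  shows "test_objects G \<Longrightarrow> (\<And>d r. (d, r) \<in> set xs \<Longrightarrow> r \<in> gr d) \<Longrightarrow> test_objects (koszul xs G)"
proof (induction xs arbitrary: G)
  case (Cons x xs)
  have "test_objects (cones {x} G)"
    by (rule test_objects_cones[OF assms Cons.prems(1)])
      (use Cons.prems(2) small_countable[OF assms, of "{x}"] in auto)
  then show ?case using Cons by auto
qed simp

text \<open>One element of the list outside \<open>p\<close> is enough: the cone on it is torsion at
  \<open>p\<close>, and the later cones inherit this.\<close>

lemma koszul_torsion_at: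
  assumes \<kappa>: "uncountable_regular \<kappa>" and p: "p \<in> Spec R gr"
  shows "test_objects G \<Longrightarrow> (\<And>d r. (d, r) \<in> set xs \<Longrightarrow> r \<in> gr d) \<Longrightarrow>
    (\<exists>(d, r)\<in>set xs. r \<notin> p) \<or> G \<subseteq> torsion_at p \<Longrightarrow> koszul xs G \<subseteq> torsion_at p"
proof (induction xs arbitrary: G)
  case (Cons x xs)
  have t: "test_objects (cones {x} G)"
    by (rule test_objects_cones[OF \<kappa> Cons.prems(1)])
      (use Cons.prems(2) small_countable[OF \<kappa>, of "{x}"] in auto)
  have "cones {x} G \<subseteq> torsion_at p" if "(\<forall>(d, r)\<in>{x}. r \<notin> p) \<or> G \<subseteq> torsion_at p"
    by (rule cones_torsion_at[OF \<kappa> p test_objectsD(4)[OF Cons.prems(1)] _ that]) (use Cons.prems(2) in auto)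
  then have "(\<exists>(d, r)\<in>set xs. r \<notin> p) \<or> cones {x} G \<subseteq> torsion_at p"
    using Cons.prems(3) by auto
  then show ?case using Cons.IH[OF t] Cons.prems(2) by simp
qed simp

text \<open>Power torsion passes to cones, so induction gives orthogonality to
  \<open>cones {x} G\<close>. Then \<open>t\<close> acts injectively on maps from \<open>G\<close>
  to \<open>L\<close>, while each such map is killed by a power of \<open>t\<close>; so all of them
  vanish.\<close>

lemma koszul_detect:
  assumes \<kappa>: "uncountable_regular \<kappa>" and L: "L \<in> Obj T"
  shows "test_objects G \<Longrightarrow> (\<And>d r. (d, r) \<in> set xs \<Longrightarrow> r \<in> gr d \<and> G \<subseteq> power_torsion d r L) \<Longrightarrow>
    L \<in> perp T (koszul xs G) \<Longrightarrow> L \<in> perp T G"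
proof (induction xs arbitrary: G)
  case (Cons x xs)
  obtain e t where x: "x = (e, t)" by (cases x)
  note G = test_objectsD[OF Cons.prems(1)]
  have t: "t \<in> gr e" "G \<subseteq> power_torsion e t L" using Cons.prems(2) x by auto
  have test: "test_objects (cones {x} G)"
    by (rule test_objects_cones[OF \<kappa> Cons.prems(1)])
      (use x t small_countable[OF \<kappa>, of "{x}"] in auto)
  have "cones {x} G \<subseteq> power_torsion d r L" if dr: "(d, r) \<in> set xs" for d r
  proof
    have r: "r \<in> gr d" "G \<subseteq> power_torsion d r L" using Cons.prems(2) dr by auto
    fix W assume "W \<in> cones {x} G"
    then obtain n D where W: "D \<in> G" "W = shiftO T n (cone e t D)"
      using x by (auto elim: conesE)
    have D: "D \<in> Obj T" using W(1) G(4) by blast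
    obtain g h where tri: "exact_triangle T D (shiftO T e D) (cone e t D) (\<phi> e t D) g h"
      using cone_triangle[OF t(1) D] by blast
    have "cone e t D \<in> power_torsion d r L"
      using power_torsion_cone[OF r(1) L tri] r(2) W(1) G(3)[OF W(1)] by blast
    then show "W \<in> power_torsion d r L"
      unfolding W(2) by (rule power_torsion_shift[OF r(1) L])
  qed
  then have Lc: "L \<in> perp T (cones {x} G)"
    using Cons.IH[OF test] Cons.prems(2,3) by auto
  have inj: "f = Zer T D L" if "D \<in> G" "f \<in> Hom T D L" "kills e t f" for D f
    by (rule cones_detect[OF Lc _ G(4) that(1,2) _ that(3)]) (use x t(1) in auto)
  show ?case
  proof (rule perpI[OF L])
    fix D f assume D: "D \<in> G" and f: "f \<in> Hom T D L"
    have "f \<in> Hom T D (shiftO T 0 L)" using f by simp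
    then obtain k :: nat where "kills (int k * e) (t [^]\<^bsub>R\<^esub> k) f"
      using t(2) D unfolding power_torsion_def by blast
    then show "f = Zer T D L"
      using power_torsion_inj[OF t(1) G(3) inj D f] by blast
  qed
qed simp

end

section \<open>Orthogonals of the torsion classes for Z(p) and V(p)\<close>

locale compactly_generated_linear = linear_triangulated T R gr \<kappa> \<phi>
  for T :: "('o, 'm) tricat" (structure) and R :: "('r, 'b) ring_scheme" and gr
    and \<kappa> :: "'i rel" and \<phi> +
  assumes regular: "uncountable_regular \<kappa>"
    and noetherian: "graded_noetherian R gr"
    and small_ring: "small \<kappa> (carrier R)"
    and homs_small: "locally_small \<kappa> T"
    and coproducts: "has_small_coproducts \<kappa> T"
    and generated: "compactly_generated \<kappa> T"
begin

abbreviation torsion :: "'r set set \<Rightarrow> 'o set" where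
  "torsion \<equiv> torsion_objects \<kappa> R gr T \<phi>"

text \<open>Closing the generators under shifts lets orthogonality in degree zero see all shifts of
  \<open>L\<close>.\<close>

lemma generating_test_objects:
  obtains G where "test_objects G" "G \<subseteq> compact_shifts" "\<And>L. L \<in> Obj T \<Longrightarrow> L \<in> perp T G \<Longrightarrow> zero_object T L"
proof -
  obtain C where C: "small \<kappa> C" "\<forall>D\<in>C. compact_object \<kappa> T D" "Loc \<kappa> T C = Obj T"
    using generated unfolding compactly_generated_def by blast
  let ?G = "(\<lambda>(n, D). shiftO T n D) ` (UNIV \<times> C)"
  show thesis
  proof
    show sub: "?G \<subseteq> compact_shifts"
      using C(2) by (auto simp: compact_shifts_def)
    have "small \<kappa> ?G"
      by (intro small_image small_Times[OF regular] small_countable[OF regular] C(1)) simp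
    moreover have "shiftO T m W \<in> ?G" if W: "W \<in> ?G" for m W
    proof -
      obtain n D where "D \<in> C" "W = shiftO T n D" using W by auto
      moreover from this have "D \<in> Obj T" using C(2) by (auto simp: compact_object_def)
      ultimately have "shiftO T m W = (\<lambda>(n, D). shiftO T n D) (m + n, D)" "(m + n, D) \<in> UNIV \<times> C"
        by (auto simp: shiftO_shiftO)
      then show ?thesis by (metis imageI)
    qed
    ultimately show "test_objects ?G"
      unfolding test_objects_def using compact_shifts_supported sub by blast
    show "zero_object T L" if "L \<in> Obj T" "L \<in> perp T ?G" for L
    proof (rule generators_detect[OF C(3) that(1)])
      fix n D f assume D: "D \<in> C" and f: "f \<in> Hom T D (shiftO T n L)"
      have "shiftO T (- n) D \<in> ?G" using D by force
      then show "f = Zer T D (shiftO T n L)"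
        using hom_shift_zer[OF f that(1)] perpD[OF that(2)] by blast
    qed
  qed
qed

lemma localizing_perp_of_test:
  assumes G: "test_objects G" "G \<subseteq> torsion V"
    and detect: "\<And>L. L \<in> torsion V \<Longrightarrow> L \<in> perp T G \<Longrightarrow> zero_object T L"
  shows "perp T (torsion V) = perp T G" "localizing \<kappa> T (perp T (torsion V))"
proof -
  note G' = test_objectsD[OF G(1)]
  show eq: "perp T (torsion V) = perp T G"
    by (rule perp_detect[OF regular coproducts homs_small localizing_torsion[OF regular] G(2) G'(1,2,3) detect])
  show "localizing \<kappa> T (perp T (torsion V))"
    unfolding eq by (rule localizing_perp[OF regular G'(4,2,3)])
qed

text \<open>The primes outside \<open>Z(p)\<close> are those below \<open>p\<close>, and an element
  outside \<open>p\<close> avoids all of them. So its cones are torsion, and torsion at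
  \<open>p\<close> itself lets them detect. The second part recognizes orthogonality by injectivity
  of the elements outside \<open>p\<close>, through \<open>cone_perp\<close>.\<close>

lemma perp_torsion_Z:
  assumes p: "p \<in> Spec R gr"
  shows "localizing \<kappa> T (perp T (torsion (Z_set R gr p)))"
    and "X \<in> Obj T \<Longrightarrow> (\<And>d s D f. s \<in> gr d - p \<Longrightarrow> f \<in> Hom T D X \<Longrightarrow> kills d s f \<Longrightarrow> f = Zer T D X) \<Longrightarrow>
      X \<in> perp T (torsion (Z_set R gr p))"
proof -
  obtain G where G: "test_objects G" "G \<subseteq> compact_shifts" "\<And>L. L \<in> Obj T \<Longrightarrow> L \<in> perp T G \<Longrightarrow> zero_object T L"
    using generating_test_objects by blast
  let ?P = "{(d, s). s \<in> gr d - p}"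
  have P: "r \<in> gr d" if "(d, r) \<in> ?P" for d r using that by simp
  \<comment> \<open>All elements outside \<open>p\<close> are used at once; smallness of the ring
    bounds their number.\<close>
  have "?P \<subseteq> UNIV \<times> carrier R" using gr_carrier by auto
  then have "small \<kappa> ?P"
    using small_mono small_Times[OF regular small_countable[OF regular, of "UNIV :: int set"] small_ring] by blast
  then have test: "test_objects (cones ?P G)"
    using test_objects_cones[OF regular G(1) _ P] by blast
  have GO: "G \<subseteq> Obj T" using test_objectsD(4)[OF G(1)] .
  have sub: "cones ?P G \<subseteq> torsion (Z_set R gr p)"
  proof
    fix W assume W: "W \<in> cones ?P G"
    have "W \<in> torsion_at q" if "q \<in> Spec R gr - Z_set R gr p" for q
    proof -
      have "q \<in> Spec R gr" "q \<subseteq> p" using that by (auto simp: Z_set_def)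
      then have "cones ?P G \<subseteq> torsion_at q"
        by (intro cones_torsion_at[OF regular _ GO P]) auto
      then show ?thesis using W by blast
    qed
    then show "W \<in> torsion (Z_set R gr p)"
      using W test_objectsD(4)[OF test] torsion_objects_iff by blast
  qed
  have detect: "zero_object T L" if L: "L \<in> torsion (Z_set R gr p)" "L \<in> perp T (cones ?P G)" for L
  proof (rule G(3))
    show Lo: "L \<in> Obj T" using L(2) by (rule perp_obj)
    have "L \<in> torsion_at p" using L(1) p by (auto simp: torsion_objects_iff Z_set_def)
    show "L \<in> perp T G"
    proof (rule perpI[OF Lo])
      fix D f assume D: "D \<in> G" and f: "f \<in> Hom T D L"
      obtain d s where s: "s \<in> gr d - p" "kills d s f"
        using torsion_atD[OF \<open>L \<in> torsion_at p\<close> _ f] D G(2) by blast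
      then show "f = Zer T D L"
        by (intro cones_detect[OF L(2) P GO D f]) auto
    qed
  qed
  have perp: "perp T (torsion (Z_set R gr p)) = perp T (cones ?P G)"
    by (rule localizing_perp_of_test(1)[OF test sub detect])
  show "localizing \<kappa> T (perp T (torsion (Z_set R gr p)))"
    by (rule localizing_perp_of_test(2)[OF test sub detect])
  show "X \<in> perp T (torsion (Z_set R gr p))" if X: "X \<in> Obj T"
    and inj: "\<And>d s D f. s \<in> gr d - p \<Longrightarrow> f \<in> Hom T D X \<Longrightarrow> kills d s f \<Longrightarrow> f = Zer T D X"
    unfolding perp
  proof (rule perpI[OF X])
    fix W f assume WG: "W \<in> cones ?P G" and f: "f \<in> Hom T W X"
    obtain n d r D where W: "(d, r) \<in> ?P" "D \<in> G" "W = shiftO T n (cone d r D)"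
      using WG by (rule conesE)
    have r: "r \<in> gr d" "r \<in> gr d - p" and D: "D \<in> Obj T" using W GO by auto
    obtain g h where t: "exact_triangle T D (shiftO T d D) (cone d r D) (\<phi> d r D) g h"
      using cone_triangle[OF r(1) D] by blast
    show "f = Zer T W X" using cone_perp[OF r(1) t X inj[OF r(2)]] f W(3)
      by blast
  qed
qed

text \<open>Finitely many homogeneous generators of \<open>p\<close> turn
  \<open>\<not> p \<subseteq> q\<close> into the absence of one listed element from
  \<open>q\<close>, which is what an iterated cone can express.\<close>

lemma perp_torsion_V:
  assumes p: "p \<in> Spec R gr"
  shows "localizing \<kappa> T (perp T (torsion (V_set R gr p)))"
proof -
  obtain G where G: "test_objects G" "G \<subseteq> compact_shifts" "\<And>L. L \<in> Obj T \<Longrightarrow> L \<in> perp T G \<Longrightarrow> zero_object T L"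
    using generating_test_objects by blast
  obtain F where F: "finite F" "F \<subseteq> p \<inter> (\<Union>n. gr n)" "p = genideal R F"
    using homogeneous_generators[OF noetherian Spec_ideal[OF p]] by blast
  have "\<forall>r\<in>F. \<exists>d. r \<in> gr d" using F(2) by blast
  then obtain deg where deg: "\<And>r. r \<in> F \<Longrightarrow> r \<in> gr (deg r)" by metis
  obtain rs where rs: "set rs = F" using finite_list[OF F(1)] by blast
  define xs where "xs = map (\<lambda>r. (deg r, r)) rs"
  have xs: "r \<in> gr d" "r \<in> p" if "(d, r) \<in> set xs" for d r
    using that deg rs F(2) by (auto simp: xs_def)
  have test: "test_objects (koszul xs G)"
    using test_objects_koszul[OF regular G(1)] xs(1) by blast
  have sub: "koszul xs G \<subseteq> torsion (V_set R gr p)"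
  proof
    fix W assume W: "W \<in> koszul xs G"
    have "W \<in> torsion_at q" if q: "q \<in> Spec R gr - V_set R gr p" for q
    proof -
      have q': "q \<in> Spec R gr" "\<not> p \<subseteq> q" using q by (auto simp: V_set_def)
      have "\<not> F \<subseteq> q"
        using q'(2) F(3) genideal_minimal[OF homogeneous_idealD(1)[OF Spec_ideal[OF q'(1)]]] by blast
      then have "\<exists>(d, r)\<in>set xs. r \<notin> q" using rs by (auto simp: xs_def)
      then show ?thesis
        using koszul_torsion_at[OF regular q'(1) G(1), of xs] xs(1) W by blast
    qed
    then show "W \<in> torsion (V_set R gr p)"
      using W test_objectsD(4)[OF test] torsion_objects_iff by blast
  qed
  have detect: "zero_object T L" if L: "L \<in> torsion (V_set R gr p)" "L \<in> perp T (koszul xs G)" for L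
  proof (rule G(3))
    show Lo: "L \<in> Obj T" using L(2) by (rule perp_obj)
    have "r \<in> gr d \<and> G \<subseteq> power_torsion d r L" if "(d, r) \<in> set xs" for d r
      using power_torsion_of_torsion[OF p L(1) xs[OF that]] xs[OF that] G(2) by blast
    then show "L \<in> perp T G"
      using koszul_detect[OF regular Lo G(1), of xs] L(2) by blast
  qed
  show ?thesis
    by (rule localizing_perp_of_test(2)[OF test sub detect])
qed

section \<open>The image of local cohomology at a prime\<close>

lemma localization_triangle_iff:
  "localization_triangle \<kappa> R gr T \<phi> V G X L \<longleftrightarrow>
    (\<exists>f g h. exact_triangle T G X L f g h) \<and> G \<in> torsion V \<and> L \<in> perp T (torsion V)"
proof -
  have "(\<forall>A\<in>torsion V. Hom T A L = {Zer T A L}) \<longleftrightarrow> L \<in> perp T (torsion V)" if L: "L \<in> Obj T"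
  proof -
    have "A \<in> Obj T" if "A \<in> torsion V" for A using that torsion_objects_iff by blast
    then show ?thesis
      using hom_zer[OF _ L] L unfolding perp_def by blast
  qed
  then show ?thesis
    unfolding localization_triangle_def using exactD(3) by blast
qed

text \<open>The difficulty is orthogonality of \<open>X\<close> to \<open>?Z\<close>: in the
  triangle \<open>X \<rightarrow> Y \<rightarrow> L\<close> this is known for \<open>Y\<close>, but
  \<open>L\<close> is only orthogonal to \<open>?V\<close>. It is recovered by showing that elements
  outside \<open>p\<close> act injectively on maps into \<open>X\<close>.\<close>

lemma Gamma_image_eq:
  assumes p: "p \<in> Spec R gr"
  shows "Gamma_image \<kappa> R gr T \<phi> p = torsion (V_set R gr p) \<inter> perp T (torsion (Z_set R gr p))"
    (is "_ = ?V \<inter> perp T ?Z")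
proof (intro equalityI subsetI)
  fix X assume "X \<in> Gamma_image \<kappa> R gr T \<phi> p"
  then obtain Y L f g h where t: "exact_triangle T X Y L f g h" and Y: "Y \<in> perp T ?Z" and X: "X \<in> ?V"
    and L: "L \<in> perp T ?V"
    unfolding Gamma_image_def Gamma_at_def Gamma_V_def L_V_def localization_triangle_iff by blast
  note E = exactD[OF t]
  note V = localizing_torsion[OF regular, of "V_set R gr p"] and Z = localizing_torsion[OF regular, of "Z_set R gr p"]
  \<comment> \<open>A map from an object in both classes dies in \<open>Y\<close>, so it factors
    through the desuspension of \<open>L\<close>, where it must vanish as well.\<close>
  have zero: "u = Zer T B X" if B: "B \<in> ?V" "B \<in> ?Z" and u: "u \<in> Hom T B X" for B u
  proof -
    obtain L' where L': "L' \<in> Obj T" "L = SuspO T L'"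
      using susp_obj_surj[OF E(3)] by blast
    then obtain l where l: "l \<in> Hom T L' X" "exact_triangle T L' X Y l f g"
      using unrotate[of X Y L' f g h] t by blast
    have "L' \<in> perp T ?V"
      using localizingD(4)[OF perp_torsion_V[OF p] L'(1)] L L'(2) by blast
    moreover obtain b where b: "b \<in> Hom T B L'" "u = l \<cdot> b"
      using tri_lift[OF l(2) u] perpD[OF Y B(2) comp_hom[OF u E(4)]] by blast
    ultimately have "b = Zer T B L'" using perpD B(1) by blast
    then show ?thesis using b l(1) hom_obj[OF u] by (auto simp: Hom_def)
  qed
  have "X \<in> perp T ?Z"
  proof (rule perp_torsion_Z(2)[OF p E(1)])
    fix d s D a assume s: "s \<in> gr d - p" and a: "a \<in> Hom T D X" and k: "kills d s a"
    have s': "s \<in> gr d" using s by simp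
    \<comment> \<open>The cone of \<open>s\<close> on \<open>X\<close> lies in \<open>?Z\<close>
      because \<open>s\<close> avoids every prime below \<open>p\<close>, and in \<open>?V\<close>
      because \<open>X\<close> does. A map killed by \<open>s\<close> factors through its
      desuspension.\<close>
    obtain W w w' where W: "exact_triangle T X (shiftO T d X) W (\<phi> d s X) w w'"
      using tri_complete[OF \<phi>_hom[OF s' E(1)]] by blast
    have "W \<in> torsion_at q" if "q \<in> Spec R gr - Z_set R gr p" for q
      using cone_torsion_at[OF _ _ W, of q] that s by (auto simp: Z_set_def)
    then have WZ: "W \<in> ?Z" using exactD(3)[OF W] torsion_objects_iff by blast
    have WV: "W \<in> ?V"
      using localizingD(5)[OF V W X] localizing_shift[OF V E(1)] X by blast
    obtain W' where W': "W' \<in> Obj T" "W = SuspO T W'"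
      using susp_obj_surj exactD(3)[OF W] by blast
    then obtain u where u: "u \<in> Hom T W' X" "exact_triangle T W' X (shiftO T d X) u (\<phi> d s X) w"
      using unrotate[of X "shiftO T d X" W' "\<phi> d s X" w w'] W by blast
    have "W' \<in> ?V" "W' \<in> ?Z"
      using localizingD(4)[OF V W'(1)] localizingD(4)[OF Z W'(1)] WV WZ W'(2) by auto
    then have "u = Zer T W' X" using zero u(1) by blast
    moreover obtain b where "b \<in> Hom T D W'" "a = u \<cdot> b"
      using tri_lift[OF u(2) a] k kills_iff[OF a] by blast
    ultimately show "a = Zer T D X" using E(1) by (auto simp: Hom_def)
  qed
  then show "X \<in> ?V \<inter> perp T ?Z" using X by blast
next
  fix X assume X: "X \<in> ?V \<inter> perp T ?Z"
  then have Xo: "X \<in> Obj T" by (auto simp: torsion_objects_iff)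
  \<comment> \<open>Conversely, trivial triangles show that \<open>X\<close> is its own localization
    and its own local cohomology.\<close>
  obtain N where N: "zero_object T N" using zero_object_exists by blast
  obtain f g h where "exact_triangle T N X X f g h"
    using zero_triangle[OF N Xo] by blast
  then have "X \<in> L_V \<kappa> R gr T \<phi> (Z_set R gr p) X"
    unfolding L_V_def localization_triangle_iff
    using X localizingD(2)[OF localizing_torsion[OF regular] N] by blast
  moreover have "X \<in> Gamma_V \<kappa> R gr T \<phi> (V_set R gr p) X"
    unfolding Gamma_V_def localization_triangle_iff using X tri_id[OF Xo N] perp_zero[OF N] by blast
  ultimately show "X \<in> Gamma_image \<kappa> R gr T \<phi> p"
    unfolding Gamma_image_def Gamma_at_def using Xo by blast
qed

lemma localizing_Gamma_image:
  assumes "p \<in> Spec R gr"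
  shows "localizing \<kappa> T (Gamma_image \<kappa> R gr T \<phi> p)"
  unfolding Gamma_image_eq[OF assms]
  by (intro localizing_Int localizing_torsion[OF regular] perp_torsion_Z(1)[OF assms])

section \<open>Gluing prescribed fibres and the bijection\<close>

lemma star_left:
  assumes "A \<subseteq> Obj T" "localizing \<kappa> T B"
  shows "A \<subseteq> star T A B"
proof
  fix X assume X: "X \<in> A"
  obtain N where N: "zero_object T N" using zero_object_exists by blast
  have "X \<in> Obj T" using X assms(1) by blast
  then show "X \<in> star T A B"
    by (rule starI[OF tri_id[OF _ N] X localizingD(2)[OF assms(2) N]])
qed

lemma star_right:
  assumes "localizing \<kappa> T A" "B \<subseteq> Obj T"
  shows "B \<subseteq> star T A B"
proof
  fix X assume X: "X \<in> B"
  obtain N where N: "zero_object T N" using zero_object_exists by blast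
  have "X \<in> Obj T" using X assms(2) by blast
  then obtain f g h where t: "exact_triangle T N X X f g h"
    using zero_triangle[OF N] by blast
  show "X \<in> star T A B"
    by (rule starI[OF t localizingD(2)[OF assms(1) N] X])
qed

text \<open>The objects filtered by pieces in \<open>torsion (Z_set R gr p)\<close>, \<open>U p\<close> and the objects orthogonal to
  both torsion classes form a localizing subcategory; it contains every \<open>U q\<close>, and the only piece an
  object of \<open>Gamma_image \<kappa> R gr T \<phi> p\<close> can have is the middle one.\<close>

lemma Loc_Int_Gamma_image:
  assumes p: "p \<in> Spec R gr"
    and U: "\<And>q. q \<in> Spec R gr \<Longrightarrow> localizing \<kappa> T (U q) \<and> U q \<subseteq> Gamma_image \<kappa> R gr T \<phi> q"
  shows "Loc \<kappa> T (\<Union>q\<in>Spec R gr. U q) \<inter> Gamma_image \<kappa> R gr T \<phi> p = U p"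
proof
  let ?S = "\<Union>q\<in>Spec R gr. U q"
  show "U p \<subseteq> Loc \<kappa> T ?S \<inter> Gamma_image \<kappa> R gr T \<phi> p"
    using U[OF p] Loc_subset[of ?S \<kappa> T] p by blast
  let ?V = "torsion (V_set R gr p)" and ?Z = "torsion (Z_set R gr p)"
  let ?M = "perp T ?V \<inter> perp T ?Z"
  let ?B = "star T (U p) ?M"
  have Uq: "localizing \<kappa> T (U q)" "U q \<subseteq> torsion (V_set R gr q)" "U q \<subseteq> perp T (torsion (Z_set R gr q))"
    if "q \<in> Spec R gr" for q
    using U[OF that] Gamma_image_eq[OF that] by auto
  have V: "localizing \<kappa> T ?V" and Z: "localizing \<kappa> T ?Z" by (rule localizing_torsion[OF regular])+
  note PZ = perp_torsion_Z(1)[OF p]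
  have M: "localizing \<kappa> T ?M"
    by (intro localizing_Int perp_torsion_V[OF p] PZ)
  \<comment> \<open>\<open>U p\<close> lies in \<open>?V\<close>, and \<open>?M\<close> is
    orthogonal to \<open>?V\<close>.\<close>
  have "?M \<subseteq> perp T (U p)"
    using perp_antimono[OF Uq(2)[OF p]] by blast
  then have B: "localizing \<kappa> T ?B"
    by (rule localizing_star[OF regular coproducts Uq(1)[OF p] M])
  have BZ: "?B \<subseteq> perp T ?Z"
    using star_mono[OF Uq(3)[OF p], of ?M "perp T ?Z"] star_self[OF PZ] by blast
  have A: "localizing \<kappa> T (star T ?Z ?B)"
    by (rule localizing_star[OF regular coproducts Z B BZ])
  have "U q \<subseteq> star T ?Z ?B" if q: "q \<in> Spec R gr" for q
  proof -
    \<comment> \<open>Each position of \<open>q\<close> relative to \<open>p\<close> fills one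
      piece. If \<open>q\<close> is not below \<open>p\<close>, then \<open>V(q)\<close> lies in
      \<open>Z(p)\<close>. If \<open>q\<close> is strictly below \<open>p\<close>, both
      \<open>Z(p)\<close> and \<open>V(p)\<close> lie in \<open>Z(q)\<close>, so \<open>U q\<close>
      is orthogonal to both torsion classes.\<close>
    consider "q = p" | "\<not> q \<subseteq> p" | "q \<subseteq> p" "\<not> p \<subseteq> q" by blast
    then show ?thesis
    proof cases
      case 1
      have "U p \<subseteq> ?B" by (rule star_left[OF localizingD(1)[OF Uq(1)[OF p]] M])
      also have "?B \<subseteq> star T ?Z ?B" by (rule star_right[OF Z localizingD(1)[OF B]])
      finally show ?thesis using 1 by simp
    next
      case 2
      then have "V_set R gr q \<subseteq> Z_set R gr p" by (auto simp: V_set_def Z_set_def)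
      then have "U q \<subseteq> ?Z" using Uq(2)[OF q] torsion_objects_mono by blast
      also have "?Z \<subseteq> star T ?Z ?B" by (rule star_left[OF localizingD(1)[OF Z] B])
      finally show ?thesis .
    next
      case 3
      then have "Z_set R gr p \<subseteq> Z_set R gr q" "V_set R gr p \<subseteq> Z_set R gr q"
        by (auto simp: V_set_def Z_set_def)
      then have "perp T (torsion (Z_set R gr q)) \<subseteq> ?M"
        using perp_antimono[OF torsion_objects_mono] by blast
      then have "U q \<subseteq> ?M" using Uq(3)[OF q] by blast
      also have "?M \<subseteq> ?B" by (rule star_right[OF Uq(1)[OF p] localizingD(1)[OF M]])
      also have "?B \<subseteq> star T ?Z ?B" by (rule star_right[OF Z localizingD(1)[OF B]])
      finally show ?thesis .
    qed
  qed
  then have "Loc \<kappa> T ?S \<subseteq> star T ?Z ?B"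
    by (intro Loc_least[OF A]) blast
  moreover have "X \<in> U p" if XA: "X \<in> star T ?Z ?B" and "X \<in> Gamma_image \<kappa> R gr T \<phi> p" for X
  proof -
    have X: "X \<in> ?V" "X \<in> perp T ?Z" using that Gamma_image_eq[OF p] by auto
    obtain Q Y f g h where t: "exact_triangle T Q X Y f g h" "Q \<in> ?Z" "Y \<in> ?B"
      using XA unfolding star_def by blast
    \<comment> \<open>\<open>X\<close> and \<open>Y\<close> are orthogonal to \<open>?Z\<close>, so
      \<open>Q\<close> is orthogonal to a class that contains it and must be zero.\<close>
    have "Q \<in> perp T ?Z" using localizing_rev(1)[OF PZ t(1) X(2)] t(3) BZ by blast
    then have "zero_object T Q" using perp_self_zero[OF t(2)] by blast
    then have "X \<in> ?B"
      using localizing_rev(2)[OF B t(1)] localizingD(2)[OF B] t(3) by blast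
    then obtain W N f g h where t: "exact_triangle T W X N f g h" "W \<in> U p" "N \<in> ?M"
      unfolding star_def by blast
    \<comment> \<open>The same argument at the other end: \<open>N\<close> is the cone of a map
      inside \<open>?V\<close> and is orthogonal to \<open>?V\<close>.\<close>
    have "N \<in> ?V" using localizingD(5)[OF V t(1)] t(2) Uq(2)[OF p] X(1) by blast
    then have "zero_object T N" using perp_self_zero t(3) by blast
    then show ?thesis
      using localizing_rev(2)[OF Uq(1)[OF p] t(1)] localizingD(2)[OF Uq(1)[OF p]] t(2) by blast
  qed
  ultimately show "Loc \<kappa> T ?S \<inter> Gamma_image \<kappa> R gr T \<phi> p \<subseteq> U p" by blast
qed

lemma localizing_determined_by_fibres:
  assumes lgp: "local_global_principle \<kappa> R gr T \<phi>"
    and S: "localizing \<kappa> T S" and S': "localizing \<kappa> T S'"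
    and eq: "\<And>p. p \<in> Spec R gr \<Longrightarrow> S \<inter> Gamma_image \<kappa> R gr T \<phi> p \<subseteq> S'"
  shows "S \<subseteq> S'"
proof
  fix X assume X: "X \<in> S"
  then have Xo: "X \<in> Obj T" using localizingD(1)[OF S] by blast
  let ?\<Gamma> = "\<Union>p\<in>Spec R gr. Gamma_at \<kappa> R gr T \<phi> p X"
  have lgp: "Loc \<kappa> T {X} = Loc \<kappa> T ?\<Gamma>"
    using assms(1) Xo unfolding local_global_principle_def by blast
  have "?\<Gamma> \<subseteq> Loc \<kappa> T {X}" unfolding lgp by (rule Loc_subset)
  also have "\<dots> \<subseteq> S" using Loc_least[OF S] X by blast
  finally have "?\<Gamma> \<subseteq> S'" using eq Xo unfolding Gamma_image_def by blast
  then have "Loc \<kappa> T ?\<Gamma> \<subseteq> S'" by (rule Loc_least[OF S'])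
  then show "X \<in> S'" using lgp Loc_subset[of "{X}" \<kappa> T] by blast
qed

lemma fibres_bij_betw:
  assumes lgp: "local_global_principle \<kappa> R gr T \<phi>"
  shows "bij_betw (\<lambda>S. \<lambda>p \<in> Spec R gr. S \<inter> Gamma_image \<kappa> R gr T \<phi> p) {S. localizing \<kappa> T S}
    (\<Pi>\<^sub>E p \<in> Spec R gr. {U. localizing \<kappa> T U \<and> U \<subseteq> Gamma_image \<kappa> R gr T \<phi> p})"
    (is "bij_betw ?F ?L ?P")
proof (rule bij_betw_imageI)
  show "inj_on ?F ?L"
  proof (rule inj_onI)
    fix S S' assume S: "S \<in> ?L" and S': "S' \<in> ?L" and eq: "?F S = ?F S'"
    have "S \<inter> Gamma_image \<kappa> R gr T \<phi> p = S' \<inter> Gamma_image \<kappa> R gr T \<phi> p" if "p \<in> Spec R gr" for p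
      using fun_cong[OF eq, of p] that by simp
    then show "S = S'"
      using localizing_determined_by_fibres[OF lgp] S S' by blast
  qed
  show "?F ` ?L = ?P"
  proof (intro equalityI subsetI)
    fix U assume "U \<in> ?F ` ?L"
    then show "U \<in> ?P"
      using localizing_Gamma_image by (auto intro!: localizing_Int)
  next
    fix U assume U: "U \<in> ?P"
    let ?S = "Loc \<kappa> T (\<Union>q\<in>Spec R gr. U q)"
    have U': "localizing \<kappa> T (U q) \<and> U q \<subseteq> Gamma_image \<kappa> R gr T \<phi> q" if "q \<in> Spec R gr" for q
      using U that by blast
    have "U = ?F ?S"
    proof
      fix p
      show "U p = ?F ?S p"
      proof (cases "p \<in> Spec R gr")
        case True
        then show ?thesis using Loc_Int_Gamma_image[of p U] U' by simp
      qed (use U in \<open>auto simp: PiE_def extensional_def\<close>)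
    qed
    moreover have "localizing \<kappa> T ?S"
      using U' localizingD(1) by (intro localizing_Loc) blast
    ultimately show "U \<in> ?F ` ?L" by blast
  qed
qed

end

theorem theorem1p1:
  fixes \<kappa> :: "'i rel"
    and R :: "('r, 'b) ring_scheme"
    and gr :: "int \<Rightarrow> 'r set"
    and T :: "('o, 'm) tricat"
    and \<phi> :: "int \<Rightarrow> 'r \<Rightarrow> 'o \<Rightarrow> 'm"
  assumes "uncountable_regular \<kappa>"
    and "graded_commutative_ring R gr"
    and "graded_noetherian R gr"
    and "small \<kappa> (carrier R)"
    and "triangulated_category T"
    and "locally_small \<kappa> T"
    and "has_small_coproducts \<kappa> T"
    and "compactly_generated \<kappa> T"
    and "linear_structure R gr T \<phi>"
    and "local_global_principle \<kappa> R gr T \<phi>"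
  shows "bij_betw
           (\<lambda>S. \<lambda>p \<in> Spec R gr. S \<inter> Gamma_image \<kappa> R gr T \<phi> p)
           {S. localizing \<kappa> T S}
           (\<Pi>\<^sub>E p \<in> Spec R gr. {U. localizing \<kappa> T U \<and> U \<subseteq> Gamma_image \<kappa> R gr T \<phi> p})"
proof -
  interpret triangulated_category T by (rule assms(5))
  interpret graded_commutative_ring R gr by (rule assms(2))
  interpret compactly_generated_linear T R gr \<kappa> \<phi>
    by unfold_locales (fact assms)+
  show ?thesis
    by (rule fibres_bij_betw[OF assms(10)])
qed

end
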